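(* Let $n\ge1$ and let $\Gamma:\mathcal{D}_2\to\mathcal{L}(L^2(\mathbb{T}^n))$ be the mapping defined by $$\Gamma(A):=\mathcal{F}_{\mathbb{T}^n}^{-1}A\,\mathcal{F}_{\mathbb{T}^n},\qquad A\in\mathcal{D}_2 .$$ Then: (i) $\Gamma$ is an algebra isomorphism between $\mathcal{D}_2$ and $\Gamma(\mathcal{D}_2)$; and when $\Gamma(\mathcal{D}_2)$ is given the norm induced from $\mathcal{D}_2$, i.e. $\|\Gamma(A)\|_{\Gamma(\mathcal{D}_2)}:=\|A\|_{\mathcal{D}_2}$, it is an isometric isomorphism. (ii) $\Gamma(\mathcal{D}_2)$ is an approximable embedded subalgebra of $\mathcal{L}(L^2(\mathbb{T}^n))$, and for every operator $T\in\Gamma(\mathcal{D}_2)$, a trace of $T$ and a determinant of $I+T$ can be defined by means of the algebra isomorphism $\Gamma$, namely by $\operatorname{Tr}(T):=\operatorname{Tr}(A)$ and $\operatorname{Det}_\Gamma(I+T):=\operatorname{Det}(I+A)$, where $T=\mathcal{F}_{\mathbb{T}^n}^{-1}A\,\mathcal{F}_{\mathbb{T}^n}$ with $A\in\mathcal{D}_2$.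
   Context: $\mathbb{T}^n=\mathbb{R}^n/\mathbb{Z}^n$. $\mathcal{L}(\mathcal{B})$ denotes the bounded linear operators on a Banach space $\mathcal{B}$, and $\mathfrak{F}(\mathcal{B})$ the bounded finite rank operators. $\mathcal{F}_{\mathbb{T}^n}:L^2(\mathbb{T}^n)\to\ell^2(\mathbb{Z}^n)$ is the (unitary) Fourier transform $(\mathcal{F}_{\mathbb{T}^n}\varphi)(k)=\int_{\mathbb{T}^n}e^{-2\pi i x\cdot k}\varphi(x)\,dx$. $\mathcal{D}_2$ is the algebra of all bounded operators on $\ell^2(\mathbb{Z}^n)$ whose matrix $(a_{jk})_{j,k\in\mathbb{Z}^n}$ with respect to the standard basis satisfies $\sum_{(j,k)\in\mathbb{Z}^n\times\mathbb{Z}^n}|a_{jk}|<\infty$; its norm $\|\cdot\|_{\mathcal{D}_2}$ is this sum. Embedded subalgebra: a subalgebra $\mathcal{D}$ of $\mathcal{L}(\mathcal{B})$ is (continuously) embedded if it carries a norm $\|\cdot\|_{\mathcal{D}}$ such that, for some constant $C>0$, $\|A\|_{\mathcal{L}(\mathcal{B})}\le C\|A\|_{\mathcal{D}}$ for all $A\in\mathcal{D}$, and $\|AB\|_{\mathcal{D}}\le\|A\|_{\mathcal{D}}\|B\|_{\mathcal{D}}$ for all $A,B\in\mathcal{D}$. It is approximable if $\mathfrak{F}(\mathcal{B})\cap\mathcal{D}$ is dense in $\mathcal{D}$ for $\|\cdot\|_{\mathcal{D}}$. Trace and determinant: for $F\in\mathfrak{F}(\mathcal{B})$ write $\mathcal{B}=M_F\oplus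 N_F$ with $M_F$ finite dimensional, $F(M_F)\subset M_F$, $N_F\subset\ker F$, and set $\operatorname{Tr}(F)=\operatorname{tr}(F|_{M_F})$, $\operatorname{Det}(I+F)=\det(I_{M_F}+F|_{M_F})$ (independent of the choice of $M_F$). On $\mathcal{D}_2$ the trace $\operatorname{Tr}(A)$ and the (Poincaré) determinant $\operatorname{Det}(I+A)$ are the continuous extensions, in the norm $\|\cdot\|_{\mathcal{D}_2}$, of these functionals from $\mathfrak{F}(\ell^2(\mathbb{Z}^n))\cap\mathcal{D}_2$ to $\mathcal{D}_2$; these extensions exist. *)

theory Defs
  imports "HOL-Analysis.Analysis" "Jordan_Normal_Form.Determinant"
begin

no_notation Matrix.vec_index (infixl \<open>$\<close> 100)

section \<open>Complex normed spaces and algebras of bounded operators\<close>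

class complex_normed_vector = real_normed_vector +
  fixes scaleC :: "complex \<Rightarrow> 'a \<Rightarrow> 'a"
  assumes scaleC_add_right: "scaleC c (x + y) = scaleC c x + scaleC c y"
    and scaleC_add_left: "scaleC (c + d) x = scaleC c x + scaleC d x"
    and scaleC_scaleC: "scaleC c (scaleC d x) = scaleC (c * d) x"
    and scaleC_one: "scaleC 1 x = x"
    and scaleR_scaleC: "scaleR r x = scaleC (complex_of_real r) x"
    and norm_scaleC: "norm (scaleC c x) = cmod c * norm x"

interpretation complex_vector: vector_space "scaleC :: complex \<Rightarrow> 'a \<Rightarrow> 'a::complex_normed_vector"
  by unfold_locales
    (auto simp: scaleC_add_right scaleC_add_left scaleC_scaleC scaleC_one)

definition bounded_ops :: "('a::complex_normed_vector \<Rightarrow> 'a) set" where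
  "bounded_ops = {A. bounded_linear A \<and> (\<forall>c x. A (scaleC c x) = scaleC c (A x))}"

definition finite_rank_ops :: "('a::complex_normed_vector \<Rightarrow> 'a) set" where
  "finite_rank_ops =
     {F \<in> bounded_ops. \<exists>S. finite S \<and> range F \<subseteq> complex_vector.span S}"

text \<open>Algebras of operators are not required to contain the identity.\<close>

definition operator_subalgebra :: "('a::complex_normed_vector \<Rightarrow> 'a) set \<Rightarrow> bool" where
  "operator_subalgebra D \<longleftrightarrow>
     D \<subseteq> bounded_ops \<and>
     (\<lambda>x. 0) \<in> D \<and>
     (\<forall>A\<in>D. \<forall>B\<in>D. (\<lambda>x. A x + B x) \<in> D) \<and>
     (\<forall>c. \<forall>A\<in>D. (\<lambda>x. scaleC c (A x)) \<in> D) \<and>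
     (\<forall>A\<in>D. \<forall>B\<in>D. A \<circ> B \<in> D)"

definition norm_on_algebra ::
    "('a::complex_normed_vector \<Rightarrow> 'a) set \<Rightarrow> (('a \<Rightarrow> 'a) \<Rightarrow> real) \<Rightarrow> bool" where
  "norm_on_algebra D N \<longleftrightarrow>
     (\<forall>A\<in>D. 0 \<le> N A) \<and>
     (\<forall>A\<in>D. N A = 0 \<longleftrightarrow> A = (\<lambda>x. 0)) \<and>
     (\<forall>c. \<forall>A\<in>D. N (\<lambda>x. scaleC c (A x)) = cmod c * N A) \<and>
     (\<forall>A\<in>D. \<forall>B\<in>D. N (\<lambda>x. A x + B x) \<le> N A + N B)"

definition embedded_subalgebra ::
    "('a::complex_normed_vector \<Rightarrow> 'a) set \<Rightarrow> (('a \<Rightarrow> 'a) \<Rightarrow> real) \<Rightarrow> bool" where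
  "embedded_subalgebra D N \<longleftrightarrow>
     operator_subalgebra D \<and>
     norm_on_algebra D N \<and>
     (\<exists>C>0. \<forall>A\<in>D. onorm A \<le> C * N A) \<and>
     (\<forall>A\<in>D. \<forall>B\<in>D. N (A \<circ> B) \<le> N A * N B)"

definition approximable ::
    "('a::complex_normed_vector \<Rightarrow> 'a) set \<Rightarrow> (('a \<Rightarrow> 'a) \<Rightarrow> real) \<Rightarrow> bool" where
  "approximable D N \<longleftrightarrow>
     (\<forall>A\<in>D. \<forall>e>0. \<exists>F \<in> finite_rank_ops \<inter> D. N (\<lambda>x. A x - F x) < e)"

definition algebra_isomorphism ::
    "('a::complex_normed_vector \<Rightarrow> 'a) set \<Rightarrow> ('b::complex_normed_vector \<Rightarrow> 'b) set \<Rightarrow>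
     (('a \<Rightarrow> 'a) \<Rightarrow> ('b \<Rightarrow> 'b)) \<Rightarrow> bool" where
  "algebra_isomorphism D E f \<longleftrightarrow>
     operator_subalgebra D \<and> operator_subalgebra E \<and>
     bij_betw f D E \<and>
     (\<forall>A\<in>D. \<forall>B\<in>D. f (\<lambda>x. A x + B x) = (\<lambda>y. f A y + f B y)) \<and>
     (\<forall>c. \<forall>A\<in>D. f (\<lambda>x. scaleC c (A x)) = (\<lambda>y. scaleC c (f A y))) \<and>
     (\<forall>A\<in>D. \<forall>B\<in>D. f (A \<circ> B) = f A \<circ> f B)"

section \<open>Trace and determinant\<close>

definition reducing_decomposition ::
    "('a::complex_normed_vector \<Rightarrow> 'a) \<Rightarrow> 'a set \<Rightarrow> 'a set \<Rightarrow> bool" where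
  "reducing_decomposition F M N \<longleftrightarrow>
     complex_vector.subspace M \<and> complex_vector.subspace N \<and>
     M \<inter> N = {0} \<and> {x + y |x y. x \<in> M \<and> y \<in> N} = UNIV \<and>
     F ` M \<subseteq> M \<and> (\<forall>x\<in>N. F x = 0)"

definition basis_list :: "'a::complex_normed_vector list \<Rightarrow> 'a set \<Rightarrow> bool" where
  "basis_list bs M \<longleftrightarrow>
     distinct bs \<and> complex_vector.independent (set bs) \<and> complex_vector.span (set bs) = M"

definition matrix_on :: "'a::complex_normed_vector list \<Rightarrow> ('a \<Rightarrow> 'a) \<Rightarrow> complex mat" where
  "matrix_on bs F = Matrix.mat (length bs) (length bs)
     (\<lambda>(i, j). complex_vector.representation (set bs) (F (bs ! j)) (bs ! i))"

text \<open>The value is the same for every admissible decomposition and every basis of its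
  finite-dimensional part, so the definite descriptions below are meaningful for operators of
  finite rank.\<close>

definition finite_rank_trace :: "('a::complex_normed_vector \<Rightarrow> 'a) \<Rightarrow> complex" where
  "finite_rank_trace F = (THE t. \<exists>M N bs. reducing_decomposition F M N \<and> basis_list bs M \<and>
     t = (\<Sum>i<length bs. matrix_on bs F $$ (i, i)))"

text \<open>The determinant functionals map an operator \<open>F\<close> to \<open>Det (I + F)\<close>.\<close>

definition finite_rank_det :: "('a::complex_normed_vector \<Rightarrow> 'a) \<Rightarrow> complex" where
  "finite_rank_det F = (THE d. \<exists>M N bs. reducing_decomposition F M N \<and> basis_list bs M \<and>
     d = Determinant.det (1\<^sub>m (length bs) + matrix_on bs F))"

definition continuous_extension ::
    "('a::complex_normed_vector \<Rightarrow> 'a) set \<Rightarrow> (('a \<Rightarrow> 'a) \<Rightarrow> real) \<Rightarrow>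
     (('a \<Rightarrow> 'a) \<Rightarrow> complex) \<Rightarrow> (('a \<Rightarrow> 'a) \<Rightarrow> complex) \<Rightarrow> bool" where
  "continuous_extension D N f g \<longleftrightarrow>
     (\<forall>F \<in> finite_rank_ops \<inter> D. g F = f F) \<and>
     (\<forall>A\<in>D. \<forall>e>0. \<exists>d>0. \<forall>B\<in>D. N (\<lambda>x. B x - A x) < d \<longrightarrow> cmod (g B - g A) < e)"

section \<open>The space \<open>\<ell>\<^sup>2\<close>\<close>

lemma sqrt_triangle_aux:
  fixes A B C :: real
  assumes "A \<ge> 0" "B \<ge> 0" and *: "\<And>t. t > 0 \<Longrightarrow> C \<le> (1 + t) * A + (1 + 1 / t) * B"
  shows "sqrt C \<le> sqrt A + sqrt B"
proof -
  have "C \<le> (sqrt A + sqrt B)\<^sup>2"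
  proof (cases "A = 0 \<or> B = 0")
    case False
    then have pos: "sqrt A > 0" "sqrt B > 0" using assms by auto
    have "C \<le> (1 + sqrt B / sqrt A) * A + (1 + 1 / (sqrt B / sqrt A)) * B"
      using pos by (intro *) auto
    also have "\<dots> = (1 + sqrt B / sqrt A) * (sqrt A)\<^sup>2 + (1 + sqrt A / sqrt B) * (sqrt B)\<^sup>2"
      using assms by simp
    also have "\<dots> = (sqrt A + sqrt B)\<^sup>2"
      using pos by (simp add: field_simps power2_eq_square del: real_sqrt_mult_self)
    finally show ?thesis .
  next
    case True
    have "C \<le> A + B + e" if "e > 0" for e
    proof (cases "A = 0")
      case True
      have "C \<le> (1 + 1 / ((B + 1) / e)) * B"
        using *[of "(B + 1) / e"] True that assms by simp
      also have "\<dots> = B + e * (B / (B + 1))"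
        using that assms by (simp add: field_simps)
      also have "\<dots> \<le> B + e * 1"
        using that assms by (intro add_left_mono mult_left_mono) auto
      finally show ?thesis using True by simp
    next
      case False
      with True have "B = 0" by simp
      have "C \<le> (1 + e / (A + 1)) * A"
        using *[of "e / (A + 1)"] \<open>B = 0\<close> that assms by simp
      also have "\<dots> = A + e * (A / (A + 1))"
        using that assms by (simp add: field_simps)
      also have "\<dots> \<le> A + e * 1"
        using that assms by (intro add_left_mono mult_left_mono) auto
      finally show ?thesis using \<open>B = 0\<close> by simp
    qed
    then have "C \<le> A + B" by (rule field_le_epsilon)
    then show ?thesis using True assms by (auto simp: power2_eq_square)
  qed
  then have "sqrt C \<le> sqrt ((sqrt A + sqrt B)\<^sup>2)" by (rule real_sqrt_le_mono)
  then show ?thesis using assms by simp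
qed

lemma cmod_add_sq_le:
  assumes "t > 0"
  shows "(cmod (x + y))\<^sup>2 \<le> (1 + t) * (cmod x)\<^sup>2 + (1 + 1 / t) * (cmod y)\<^sup>2"
proof -
  have "(cmod (x + y))\<^sup>2 \<le> (cmod x + cmod y)\<^sup>2"
    by (intro power_mono norm_triangle_ineq) auto
  moreover have "0 \<le> (t * cmod x - cmod y)\<^sup>2 / t" using assms by simp
  moreover have "(t * cmod x - cmod y)\<^sup>2 / t = t * (cmod x)\<^sup>2 + (cmod y)\<^sup>2 / t - 2 * cmod x * cmod y"
    using assms by (simp add: field_simps power2_eq_square)
  ultimately show ?thesis
    by (simp add: power2_sum field_simps)
qed

typedef 'i ell2 = "{a :: 'i \<Rightarrow> complex. (\<lambda>k. (cmod (a k))\<^sup>2) summable_on UNIV}"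
  morphisms ell2_coeff Abs_ell2
  by (rule exI[of _ "\<lambda>_. 0"]) simp

setup_lifting type_definition_ell2

lemma ell2_add_summable:
  fixes a b :: "'i \<Rightarrow> complex"
  assumes "(\<lambda>k. (cmod (a k))\<^sup>2) summable_on UNIV" "(\<lambda>k. (cmod (b k))\<^sup>2) summable_on UNIV"
  shows "(\<lambda>k. (cmod (a k + b k))\<^sup>2) summable_on UNIV"
proof (rule summable_on_comparison_test)
  show "(\<lambda>k. (1 + 1) * (cmod (a k))\<^sup>2 + (1 + 1 / 1) * (cmod (b k))\<^sup>2) summable_on UNIV"
    by (intro summable_on_add summable_on_cmult_right assms)
qed (use cmod_add_sq_le[of 1] in auto)

lemma ell2_scale_summable:
  fixes a :: "'i \<Rightarrow> complex"
  assumes "(\<lambda>k. (cmod (a k))\<^sup>2) summable_on UNIV"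
  shows "(\<lambda>k. (cmod (c * a k))\<^sup>2) summable_on UNIV"
  using summable_on_cmult_right[OF assms, of "(cmod c)\<^sup>2"]
  by (simp add: norm_mult power_mult_distrib)

instantiation ell2 :: (type) complex_normed_vector
begin

lift_definition zero_ell2 :: "'a ell2" is "\<lambda>_. 0" by simp
lift_definition plus_ell2 :: "'a ell2 \<Rightarrow> 'a ell2 \<Rightarrow> 'a ell2" is "\<lambda>a b k. a k + b k"
  by (rule ell2_add_summable)
lift_definition uminus_ell2 :: "'a ell2 \<Rightarrow> 'a ell2" is "\<lambda>a k. - a k" by simp
lift_definition minus_ell2 :: "'a ell2 \<Rightarrow> 'a ell2 \<Rightarrow> 'a ell2" is "\<lambda>a b k. a k - b k"
proof -
  fix a b :: "'a \<Rightarrow> complex"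
  assume "(\<lambda>k. (cmod (a k))\<^sup>2) summable_on UNIV" "(\<lambda>k. (cmod (b k))\<^sup>2) summable_on UNIV"
  then show "(\<lambda>k. (cmod (a k - b k))\<^sup>2) summable_on UNIV"
    using ell2_add_summable[of a "\<lambda>k. - b k"] by simp
qed
lift_definition scaleC_ell2 :: "complex \<Rightarrow> 'a ell2 \<Rightarrow> 'a ell2" is "\<lambda>c a k. c * a k"
  by (rule ell2_scale_summable)
lift_definition scaleR_ell2 :: "real \<Rightarrow> 'a ell2 \<Rightarrow> 'a ell2" is "\<lambda>r a k. complex_of_real r * a k"
  by (rule ell2_scale_summable)
lift_definition norm_ell2 :: "'a ell2 \<Rightarrow> real" is "\<lambda>a. sqrt (\<Sum>\<^sub>\<infinity>k. (cmod (a k))\<^sup>2)" .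

definition sgn_ell2 :: "'a ell2 \<Rightarrow> 'a ell2" where "sgn_ell2 x = inverse (norm x) *\<^sub>R x"
definition dist_ell2 :: "'a ell2 \<Rightarrow> 'a ell2 \<Rightarrow> real" where "dist_ell2 x y = norm (x - y)"
definition uniformity_ell2 :: "('a ell2 \<times> 'a ell2) filter" where
  "uniformity_ell2 = (INF e\<in>{0 <..}. principal {(x, y). dist x y < e})"
definition open_ell2 :: "'a ell2 set \<Rightarrow> bool" where
  "open_ell2 U \<longleftrightarrow> (\<forall>x\<in>U. \<forall>\<^sub>F (x', y) in uniformity. x' = x \<longrightarrow> y \<in> U)"

instance
proof
  fix x y z :: "'a ell2" and c d :: complex and r s :: real and U :: "'a ell2 set"
  show "x + y + z = x + (y + z)" by transfer (simp add: add.assoc)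
  show "x + y = y + x" by transfer (simp add: add.commute)
  show "0 + x = x" by transfer simp
  show "- x + x = 0" by transfer simp
  show "x - y = x + - y" by transfer simp
  show "r *\<^sub>R (x + y) = r *\<^sub>R x + r *\<^sub>R y" by transfer (simp add: ring_distribs)
  show "(r + s) *\<^sub>R x = r *\<^sub>R x + s *\<^sub>R x" by transfer (simp add: ring_distribs)
  show "r *\<^sub>R s *\<^sub>R x = (r * s) *\<^sub>R x" by transfer (simp add: mult.assoc)
  show "1 *\<^sub>R x = x" by transfer simp
  show "scaleC c (x + y) = scaleC c x + scaleC c y" by transfer (simp add: ring_distribs)
  show "scaleC (c + d) x = scaleC c x + scaleC d x" by transfer (simp add: ring_distribs)
  show "scaleC c (scaleC d x) = scaleC (c * d) x" by transfer (simp add: mult.assoc)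
  show "scaleC 1 x = x" by transfer simp
  show "r *\<^sub>R x = scaleC (complex_of_real r) x" by transfer simp
  show "dist x y = norm (x - y)" by (rule dist_ell2_def)
  show "sgn x = inverse (norm x) *\<^sub>R x" by (rule sgn_ell2_def)
  show "uniformity = (INF e\<in>{0 <..}. principal {(x, y :: 'a ell2). dist x y < e})"
    by (rule uniformity_ell2_def)
  show "open U \<longleftrightarrow> (\<forall>x\<in>U. \<forall>\<^sub>F (x', y) in uniformity. x' = x \<longrightarrow> y \<in> U)"
    by (rule open_ell2_def)
  show scC: "norm (scaleC c x) = cmod c * norm x" for c :: complex
    by transfer (simp add: norm_mult power_mult_distrib infsum_cmult_right' real_sqrt_mult)
  show "norm (r *\<^sub>R x) = \<bar>r\<bar> * norm x"
    using scC[of "complex_of_real r"]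
    by (metis \<open>r *\<^sub>R x = scaleC (complex_of_real r) x\<close> norm_of_real)
  show "norm x = 0 \<longleftrightarrow> x = 0"
  proof transfer
    fix a :: "'a \<Rightarrow> complex"
    assume a: "(\<lambda>k. (cmod (a k))\<^sup>2) summable_on UNIV"
    show "sqrt (\<Sum>\<^sub>\<infinity>k. (cmod (a k))\<^sup>2) = 0 \<longleftrightarrow> a = (\<lambda>_. 0)"
    proof
      assume "sqrt (\<Sum>\<^sub>\<infinity>k. (cmod (a k))\<^sup>2) = 0"
      then have "(\<Sum>\<^sub>\<infinity>k. (cmod (a k))\<^sup>2) \<le> 0" by simp
      then have "(cmod (a k))\<^sup>2 = 0" for k
        using nonneg_infsum_le_0D[OF _ a, of k] by simp
      then show "a = (\<lambda>_. 0)" by (intro ext) simp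
    qed simp
  qed
  show "norm (x + y) \<le> norm x + norm y"
  proof transfer
    fix a b :: "'a \<Rightarrow> complex"
    assume a: "(\<lambda>k. (cmod (a k))\<^sup>2) summable_on UNIV" and b: "(\<lambda>k. (cmod (b k))\<^sup>2) summable_on UNIV"
    show "sqrt (\<Sum>\<^sub>\<infinity>k. (cmod (a k + b k))\<^sup>2)
        \<le> sqrt (\<Sum>\<^sub>\<infinity>k. (cmod (a k))\<^sup>2) + sqrt (\<Sum>\<^sub>\<infinity>k. (cmod (b k))\<^sup>2)"
    proof (rule sqrt_triangle_aux)
      fix t :: real assume t: "t > 0"
      have "(\<Sum>\<^sub>\<infinity>k. (cmod (a k + b k))\<^sup>2)
          \<le> (\<Sum>\<^sub>\<infinity>k. (1 + t) * (cmod (a k))\<^sup>2 + (1 + 1 / t) * (cmod (b k))\<^sup>2)"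
        by (intro infsum_mono summable_on_add summable_on_cmult_right ell2_add_summable a b
            cmod_add_sq_le t)
      also have "\<dots> = (1 + t) * (\<Sum>\<^sub>\<infinity>k. (cmod (a k))\<^sup>2) + (1 + 1 / t) * (\<Sum>\<^sub>\<infinity>k. (cmod (b k))\<^sup>2)"
        by (simp add: infsum_add summable_on_cmult_right a b infsum_cmult_right' del: distrib_right)
      finally show "(\<Sum>\<^sub>\<infinity>k. (cmod (a k + b k))\<^sup>2)
          \<le> (1 + t) * (\<Sum>\<^sub>\<infinity>k. (cmod (a k))\<^sup>2) + (1 + 1 / t) * (\<Sum>\<^sub>\<infinity>k. (cmod (b k))\<^sup>2)" .
    qed (auto intro: infsum_nonneg)
  qed
qed

end

lift_definition ell2_unit :: "'i \<Rightarrow> 'i ell2" is "\<lambda>k j. if j = k then 1 else 0"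
proof -
  fix k :: 'i
  have "(\<lambda>j. (cmod (if j = k then 1 else 0))\<^sup>2) summable_on {k}" by simp
  then show "(\<lambda>j. (cmod (if j = k then 1 else 0))\<^sup>2) summable_on UNIV"
    by (rule summable_on_cong_neutral[THEN iffD1, rotated -1]) auto
qed

definition ell2_matrix :: "('i ell2 \<Rightarrow> 'i ell2) \<Rightarrow> 'i \<Rightarrow> 'i \<Rightarrow> complex" where
  "ell2_matrix A j k = ell2_coeff (A (ell2_unit k)) j"

definition D2 :: "('i ell2 \<Rightarrow> 'i ell2) set" where
  "D2 = {A \<in> bounded_ops. (\<lambda>(j, k). cmod (ell2_matrix A j k)) summable_on UNIV}"

definition D2_norm :: "('i ell2 \<Rightarrow> 'i ell2) \<Rightarrow> real" where
  "D2_norm A = (\<Sum>\<^sub>\<infinity>(j, k). cmod (ell2_matrix A j k))"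

definition D2_trace :: "('i ell2 \<Rightarrow> 'i ell2) \<Rightarrow> complex" where
  "D2_trace A = (THE t. \<exists>g. continuous_extension D2 D2_norm finite_rank_trace g \<and> t = g A)"

definition D2_det :: "('i ell2 \<Rightarrow> 'i ell2) \<Rightarrow> complex" where
  "D2_det A = (THE d. \<exists>g. continuous_extension D2 D2_norm finite_rank_det g \<and> d = g A)"

section \<open>The torus and its \<open>L\<^sup>2\<close> space\<close>

quotient_type 'n torus = "real ^ 'n" / "\<lambda>x y :: real ^ 'n. \<forall>i. x $ i - y $ i \<in> \<int>"
proof (rule equivpI)
  show "reflp (\<lambda>x y :: real ^ 'n. \<forall>i. x $ i - y $ i \<in> \<int>)" by (simp add: reflp_def)
  show "symp (\<lambda>x y :: real ^ 'n. \<forall>i. x $ i - y $ i \<in> \<int>)"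
    by (auto simp: symp_def) (metis Ints_minus minus_diff_eq)
  show "transp (\<lambda>x y :: real ^ 'n. \<forall>i. x $ i - y $ i \<in> \<int>)"
  proof (rule transpI, rule allI)
    fix x y z :: "real ^ 'n" and i
    assume "\<forall>i. x $ i - y $ i \<in> \<int>" "\<forall>i. y $ i - z $ i \<in> \<int>"
    then have "(x $ i - y $ i) + (y $ i - z $ i) \<in> \<int>" by (intro Ints_add) auto
    then show "x $ i - z $ i \<in> \<int>" by simp
  qed
qed

instantiation torus :: (finite) topological_space
begin

definition open_torus :: "'a torus set \<Rightarrow> bool" where
  "open_torus U \<longleftrightarrow> open (abs_torus -` U)"

instance
  by standard (auto simp: open_torus_def vimage_Union)

end

text \<open>The normalised Haar measure, as the image of Lebesgue measure on a fundamental domain.\<close>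

definition torus_measure :: "('n::finite) torus measure" where
  "torus_measure =
     distr (restrict_space lborel {x :: real ^ 'n. \<forall>i. 0 \<le> x $ i \<and> x $ i < 1}) borel abs_torus"

definition square_integrable :: "(('n::finite) torus \<Rightarrow> complex) \<Rightarrow> bool" where
  "square_integrable f \<longleftrightarrow>
     f \<in> borel_measurable torus_measure \<and> integrable torus_measure (\<lambda>x. (cmod (f x))\<^sup>2)"

quotient_type 'n L2_torus = "('n::finite) torus \<Rightarrow> complex" / partial:
  "\<lambda>f g. square_integrable f \<and> square_integrable g \<and> (AE x in torus_measure. f x = g x)"
proof (rule part_equivpI)
  show "\<exists>f :: 'n torus \<Rightarrow> complex.
      square_integrable f \<and> square_integrable f \<and> (AE x in torus_measure. f x = f x)"
    by (rule exI[of _ "\<lambda>_. 0"]) (simp add: square_integrable_def)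
  show "symp (\<lambda>f g :: 'n torus \<Rightarrow> complex.
      square_integrable f \<and> square_integrable g \<and> (AE x in torus_measure. f x = g x))"
    by (auto simp: symp_def elim: eventually_mono)
  show "transp (\<lambda>f g :: 'n torus \<Rightarrow> complex.
      square_integrable f \<and> square_integrable g \<and> (AE x in torus_measure. f x = g x))"
    by (auto simp: transp_def elim: eventually_elim2)
qed

lemma square_integrable_zero: "square_integrable (\<lambda>_. 0)"
  by (simp add: square_integrable_def)

lemma square_integrable_add:
  assumes "square_integrable f" "square_integrable g"
  shows "square_integrable (\<lambda>x. f x + g x)"
proof -
  have [measurable]: "f \<in> borel_measurable torus_measure" "g \<in> borel_measurable torus_measure"
    using assms by (auto simp: square_integrable_def)
  have "integrable torus_measure (\<lambda>x. (cmod (f x + g x))\<^sup>2)"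
  proof (rule Bochner_Integration.integrable_bound)
    show "integrable torus_measure (\<lambda>x. (1 + 1) * (cmod (f x))\<^sup>2 + (1 + 1 / 1) * (cmod (g x))\<^sup>2)"
      using assms unfolding square_integrable_def
      by (intro Bochner_Integration.integrable_add integrable_mult_right) auto
    show "AE x in torus_measure. norm ((cmod (f x + g x))\<^sup>2)
        \<le> norm ((1 + 1) * (cmod (f x))\<^sup>2 + (1 + 1 / 1) * (cmod (g x))\<^sup>2)"
      using cmod_add_sq_le[of 1] by (intro AE_I2) auto
  qed measurable
  then show ?thesis by (simp add: square_integrable_def)
qed

lemma square_integrable_scale:
  assumes "square_integrable f"
  shows "square_integrable (\<lambda>x. c * f x)"
  using assms by (auto simp: square_integrable_def norm_mult power_mult_distrib)

lemma square_integrable_uminus: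
  assumes "square_integrable f"
  shows "square_integrable (\<lambda>x. - f x)"
  using square_integrable_scale[OF assms, of "-1"] by simp

lemma square_integrable_diff:
  assumes "square_integrable f" "square_integrable g"
  shows "square_integrable (\<lambda>x. f x - g x)"
  using square_integrable_add[OF assms(1) square_integrable_uminus[OF assms(2)]] by simp

instantiation L2_torus :: (finite) complex_normed_vector
begin

lift_definition zero_L2_torus :: "'a L2_torus" is "\<lambda>_. 0"
  by (simp add: square_integrable_zero)
lift_definition plus_L2_torus :: "'a L2_torus \<Rightarrow> 'a L2_torus \<Rightarrow> 'a L2_torus"
  is "\<lambda>f g x. f x + g x"
  by (auto intro: square_integrable_add elim: eventually_elim2)
lift_definition uminus_L2_torus :: "'a L2_torus \<Rightarrow> 'a L2_torus" is "\<lambda>f x. - f x"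
  by (auto intro: square_integrable_uminus)
lift_definition minus_L2_torus :: "'a L2_torus \<Rightarrow> 'a L2_torus \<Rightarrow> 'a L2_torus"
  is "\<lambda>f g x. f x - g x"
  by (auto intro: square_integrable_diff elim: eventually_elim2)
lift_definition scaleC_L2_torus :: "complex \<Rightarrow> 'a L2_torus \<Rightarrow> 'a L2_torus" is "\<lambda>c f x. c * f x"
  by (auto intro: square_integrable_scale elim: eventually_mono)
lift_definition scaleR_L2_torus :: "real \<Rightarrow> 'a L2_torus \<Rightarrow> 'a L2_torus"
  is "\<lambda>r f x. complex_of_real r * f x"
  by (auto intro: square_integrable_scale elim: eventually_mono)
lift_definition norm_L2_torus :: "'a L2_torus \<Rightarrow> real"
  is "\<lambda>f. sqrt (LINT x|torus_measure. (cmod (f x))\<^sup>2)"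
  by (auto simp: square_integrable_def intro!: integral_cong_AE elim: eventually_mono)

definition sgn_L2_torus :: "'a L2_torus \<Rightarrow> 'a L2_torus" where "sgn_L2_torus x = inverse (norm x) *\<^sub>R x"
definition dist_L2_torus :: "'a L2_torus \<Rightarrow> 'a L2_torus \<Rightarrow> real" where
  "dist_L2_torus x y = norm (x - y)"
definition uniformity_L2_torus :: "('a L2_torus \<times> 'a L2_torus) filter" where
  "uniformity_L2_torus = (INF e\<in>{0 <..}. principal {(x, y). dist x y < e})"
definition open_L2_torus :: "'a L2_torus set \<Rightarrow> bool" where
  "open_L2_torus U \<longleftrightarrow> (\<forall>x\<in>U. \<forall>\<^sub>F (x', y) in uniformity. x' = x \<longrightarrow> y \<in> U)"

instance
proof
  fix x y z :: "'a L2_torus" and c d :: complex and r s :: real and U :: "'a L2_torus set"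
  note sq = square_integrable_zero square_integrable_add square_integrable_scale
    square_integrable_uminus square_integrable_diff
  show "x + y + z = x + (y + z)" by transfer (auto simp: add.assoc sq)
  show "x + y = y + x" by transfer (auto simp: add.commute sq)
  show "0 + x = x" by transfer (auto simp: sq)
  show "- x + x = 0" by transfer (auto simp: sq)
  show "x - y = x + - y" by transfer (auto simp: sq)
  show "r *\<^sub>R (x + y) = r *\<^sub>R x + r *\<^sub>R y" by transfer (auto simp: ring_distribs sq)
  show "(r + s) *\<^sub>R x = r *\<^sub>R x + s *\<^sub>R x" by transfer (auto simp: ring_distribs sq)
  show "r *\<^sub>R s *\<^sub>R x = (r * s) *\<^sub>R x" by transfer (auto simp: mult.assoc sq)
  show "1 *\<^sub>R x = x" by transfer (auto simp: sq)
  show "scaleC c (x + y) = scaleC c x + scaleC c y" by transfer (auto simp: ring_distribs sq)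
  show "scaleC (c + d) x = scaleC c x + scaleC d x" by transfer (auto simp: ring_distribs sq)
  show "scaleC c (scaleC d x) = scaleC (c * d) x" by transfer (auto simp: mult.assoc sq)
  show "scaleC 1 x = x" by transfer (auto simp: sq)
  show "r *\<^sub>R x = scaleC (complex_of_real r) x" by transfer (auto simp: sq)
  show "dist x y = norm (x - y)" by (rule dist_L2_torus_def)
  show "sgn x = inverse (norm x) *\<^sub>R x" by (rule sgn_L2_torus_def)
  show "uniformity = (INF e\<in>{0 <..}. principal {(x, y :: 'a L2_torus). dist x y < e})"
    by (rule uniformity_L2_torus_def)
  show "open U \<longleftrightarrow> (\<forall>x\<in>U. \<forall>\<^sub>F (x', y) in uniformity. x' = x \<longrightarrow> y \<in> U)"
    by (rule open_L2_torus_def)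
  show scC: "norm (scaleC c x) = cmod c * norm x" for c :: complex
    by transfer (simp add: norm_mult power_mult_distrib real_sqrt_mult)
  show "norm (r *\<^sub>R x) = \<bar>r\<bar> * norm x"
    using scC[of "complex_of_real r"]
    by (metis \<open>r *\<^sub>R x = scaleC (complex_of_real r) x\<close> norm_of_real)
  show "norm x = 0 \<longleftrightarrow> x = 0"
  proof transfer
    fix f :: "'a torus \<Rightarrow> complex"
    assume "square_integrable f \<and> square_integrable f \<and> (AE x in torus_measure. f x = f x)"
    then show "sqrt (LINT x|torus_measure. (cmod (f x))\<^sup>2) = 0 \<longleftrightarrow>
      square_integrable f \<and> square_integrable (\<lambda>_ :: 'a torus. 0) \<and> (AE x in torus_measure. f x = 0)"
      by (simp add: square_integrable_zero integral_nonneg_eq_0_iff_AE square_integrable_def)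
  qed
  show "norm (x + y) \<le> norm x + norm y"
  proof transfer
    fix f g :: "'a torus \<Rightarrow> complex"
    assume "square_integrable f \<and> square_integrable f \<and> (AE x in torus_measure. f x = f x)"
      "square_integrable g \<and> square_integrable g \<and> (AE x in torus_measure. g x = g x)"
    then have sqi: "square_integrable f" "square_integrable g" by auto
    then have f: "integrable torus_measure (\<lambda>x. (cmod (f x))\<^sup>2)"
      and g: "integrable torus_measure (\<lambda>x. (cmod (g x))\<^sup>2)"
      and fg: "integrable torus_measure (\<lambda>x. (cmod (f x + g x))\<^sup>2)"
      using square_integrable_add[OF sqi] by (auto simp: square_integrable_def)
    show "sqrt (LINT x|torus_measure. (cmod (f x + g x))\<^sup>2)
        \<le> sqrt (LINT x|torus_measure. (cmod (f x))\<^sup>2) + sqrt (LINT x|torus_measure. (cmod (g x))\<^sup>2)"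
    proof (rule sqrt_triangle_aux)
      fix t :: real assume t: "t > 0"
      have "(LINT x|torus_measure. (cmod (f x + g x))\<^sup>2)
          \<le> (LINT x|torus_measure. (1 + t) * (cmod (f x))\<^sup>2 + (1 + 1 / t) * (cmod (g x))\<^sup>2)"
        by (intro integral_mono Bochner_Integration.integrable_add integrable_mult_right f g fg
            cmod_add_sq_le t)
      also have "\<dots> = (1 + t) * (LINT x|torus_measure. (cmod (f x))\<^sup>2)
          + (1 + 1 / t) * (LINT x|torus_measure. (cmod (g x))\<^sup>2)"
        using f g by (subst Bochner_Integration.integral_add) auto
      finally show "(LINT x|torus_measure. (cmod (f x + g x))\<^sup>2)
          \<le> (1 + t) * (LINT x|torus_measure. (cmod (f x))\<^sup>2)
            + (1 + 1 / t) * (LINT x|torus_measure. (cmod (g x))\<^sup>2)" .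
    qed auto
  qed
qed

end

section \<open>The Fourier transform and the map \<open>\<Gamma>\<close>\<close>

lift_definition torus_character :: "int ^ 'n \<Rightarrow> ('n::finite) torus \<Rightarrow> complex"
  is "\<lambda>k x. exp (- 2 * complex_of_real pi * \<i> * complex_of_real (\<Sum>i\<in>UNIV. x $ i * real_of_int (k $ i)))"
proof -
  fix k :: "int ^ 'n" and x y :: "real ^ 'n"
  assume *: "\<And>i. x $ i - y $ i \<in> \<int>"
  have "(\<Sum>i\<in>UNIV. x $ i * real_of_int (k $ i)) - (\<Sum>i\<in>UNIV. y $ i * real_of_int (k $ i))
      = (\<Sum>i\<in>UNIV. (x $ i - y $ i) * real_of_int (k $ i))"
    by (simp add: sum_subtractf algebra_simps)
  also have "\<dots> \<in> \<int>"
    by (intro Ints_sum Ints_mult) (use * in auto)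
  finally obtain m where m: "(\<Sum>i\<in>UNIV. x $ i * real_of_int (k $ i))
      = (\<Sum>i\<in>UNIV. y $ i * real_of_int (k $ i)) + of_int m"
    by (metis Ints_cases add.commute diff_add_cancel)
  show "exp (- 2 * complex_of_real pi * \<i> * complex_of_real (\<Sum>i\<in>UNIV. x $ i * real_of_int (k $ i)))
      = exp (- 2 * complex_of_real pi * \<i> * complex_of_real (\<Sum>i\<in>UNIV. y $ i * real_of_int (k $ i)))"
    unfolding m exp_eq by (rule exI[of _ "- m"]) (simp add: algebra_simps)
qed

lemma torus_character_measurable: "torus_character k \<in> borel_measurable torus_measure"
proof -
  have "torus_character k \<in> borel_measurable borel"
  proof (rule borel_measurable_continuous_onI)
    have "continuous_on UNIV (\<lambda>x. torus_character k (abs_torus x))"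
      unfolding torus_character.abs_eq by (intro continuous_intros)
    then have "open ((\<lambda>x. torus_character k (abs_torus x)) -` U)" if "open U" for U
      using that by (simp add: open_vimage)
    then show "continuous_on UNIV (torus_character k)"
      by (auto simp: continuous_on_open_vimage open_torus_def vimage_def)
  qed
  then show ?thesis by (simp add: torus_measure_def)
qed

lift_definition fourier_coeff :: "('n::finite) L2_torus \<Rightarrow> int ^ 'n \<Rightarrow> complex"
  is "\<lambda>f k. LINT x|torus_measure. torus_character k x * f x"
proof
  fix f g :: "'n torus \<Rightarrow> complex" and k :: "int ^ 'n"
  assume "square_integrable f \<and> square_integrable g \<and> (AE x in torus_measure. f x = g x)"
  then show "(LINT x|torus_measure. torus_character k x * f x)
      = (LINT x|torus_measure. torus_character k x * g x)"
    using torus_character_measurable[of k]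
    by (intro integral_cong_AE) (auto simp: square_integrable_def elim: eventually_mono)
qed

text \<open>The coefficients are square-summable by Bessel's inequality, so \<open>Abs_ell2\<close> is applied
  only inside its domain.\<close>

definition fourier :: "('n::finite) L2_torus \<Rightarrow> (int ^ 'n) ell2" where
  "fourier f = Abs_ell2 (fourier_coeff f)"

definition fourier_conj :: "((int ^ 'n) ell2 \<Rightarrow> (int ^ 'n) ell2) \<Rightarrow> ('n::finite) L2_torus \<Rightarrow> 'n L2_torus" where
  "fourier_conj A = inv_into UNIV fourier \<circ> A \<circ> fourier"

definition Gamma_norm :: "(('n::finite) L2_torus \<Rightarrow> 'n L2_torus) \<Rightarrow> real" where
  "Gamma_norm T = D2_norm (the_inv_into D2 fourier_conj T)"

definition Gamma_trace :: "(('n::finite) L2_torus \<Rightarrow> 'n L2_torus) \<Rightarrow> complex" where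
  "Gamma_trace T = D2_trace (the_inv_into D2 fourier_conj T)"

definition Gamma_det :: "(('n::finite) L2_torus \<Rightarrow> 'n L2_torus) \<Rightarrow> complex" where
  "Gamma_det T = D2_det (the_inv_into D2 fourier_conj T)"

end

theory Submission
  imports Defs
begin

text \<open>Conjugation by a bijection preserves every algebraic structure, so the content of the theorem lies in
three analytic facts.

\<^emph>\<open>Conjugation stays inside the operators on square-integrable functions.\<close> An operator with
absolutely summable matrix maps \<open>\<ell>\<^sup>2\<close> into \<open>\<ell>\<^sup>1\<close>, with
\<open>\<Sum>\<^sub>j \<bar>(A x)\<^sub>j\<bar> \<le> D2_norm A * norm x\<close> (\<open>D2_maps_to_l1\<close>). An absolutely summable family is the family
of Fourier coefficients of the uniformly convergent series it defines
(\<open>absolutely_summable_is_fourier_coeff\<close>), and the Fourier transform is injective. Hence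
\<open>fourier (fourier_conj A f) = A (fourier f)\<close> for every \<open>A\<close> in the algebra
(\<open>fourier_fourier_conj\<close>), and this equation determines \<open>fourier_conj A\<close>. Injectivity follows from the
expansion of \<open>f\<close> into its Fourier series (\<open>fourier_expansion\<close>): Bessel's identity shows that the
partial sums are best approximations, and trigonometric polynomials are dense by the
Stone-Weierstrass theorem on the image of the compact torus in \<open>\<complex>\<^sup>n\<close>, followed by a monotone class
argument from open sets to measurable functions.

\<^emph>\<open>Trace and determinant of a finite-rank operator can be read off from a coordinate system.\<close> Let
\<open>e\<^sub>k\<close>, \<open>u\<^sub>k\<close> be vectors and bounded functionals with \<open>x = \<Sum>\<^sub>k u\<^sub>k(x) e\<^sub>k\<close> for all \<open>x\<close>. For
\<open>F = \<Sum>\<^sub>i \<phi>\<^sub>i \<otimes> b\<^sub>i\<close> the \<open>n \<times> n\<close> section \<open>(u\<^sub>i(F e\<^sub>j))\<close> factors as \<open>B C\<close> with \<open>B = (u\<^sub>i(b\<^sub>j))\<close> and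
\<open>C = (\<phi>\<^sub>i(e\<^sub>j))\<close>. Since \<open>det (1 + B C) = det (1 + C B)\<close> and \<open>C B\<close> has the fixed size of the basis and
converges to \<open>(\<phi>\<^sub>i(b\<^sub>j))\<close>, the determinants of the sections converge to \<open>Det (I + F)\<close>; likewise for the
trace (\<open>finite_rank_trace_limit\<close>, \<open>finite_rank_det_limit\<close>). Both \<open>\<ell>\<^sup>2\<close> with its unit vectors and
\<open>L\<^sup>2\<close> of the torus with the exponentials are such coordinate systems, and the sections of \<open>A\<close> and of
\<open>fourier_conj A\<close> are the same matrices. Thus the functionals on both sides agree.

\<^emph>\<open>The extensions to the whole algebra exist.\<close> As functions of \<open>A\<close>, the section determinants are
equicontinuous for \<open>D2_norm\<close>, because
\<open>\<bar>det (1 + b) - det (1 + a)\<bar> \<le> exp \<parallel>a\<parallel> (exp \<parallel>b - a\<parallel> - 1)\<close> with entrywise \<open>\<ell>\<^sup>1\<close> norms, independently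
of the size of the matrices (\<open>norm_det_one_plus_diff_le\<close>). They converge on the dense set of
finite-rank operators, hence everywhere, and the limit is the unique continuous extension
(\<open>section_functional_extension\<close>).\<close>

section \<open>Determinants: commuting factors and perturbation bounds\<close>

text \<open>Both sides are the determinant of the block matrix with rows \<open>(1, -C)\<close> and \<open>(B, 1)\<close>, factored once
from the left and once from the right by the unipotent matrix with rows \<open>(1, 0)\<close> and \<open>(B, 1)\<close>.\<close>

lemma det_one_plus_mult_commute:
  fixes B C :: "'a::idom mat"
  assumes B: "B \<in> carrier_mat n m" and C: "C \<in> carrier_mat m n"
  shows "Determinant.det (1\<^sub>m n + B * C) = Determinant.det (1\<^sub>m m + C * B)"
proof -
  define L where "L = four_block_mat (1\<^sub>m m) (0\<^sub>m m n) B (1\<^sub>m n)"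
  define U where "U = four_block_mat (1\<^sub>m m) (- C) (0\<^sub>m n m) (1\<^sub>m n + B * C)"
  define U' where "U' = four_block_mat (1\<^sub>m m + C * B) (- C) (0\<^sub>m n m) (1\<^sub>m n)"
  have carr: "L \<in> carrier_mat (m + n) (m + n)" "U \<in> carrier_mat (m + n) (m + n)"
    "U' \<in> carrier_mat (m + n) (m + n)"
    unfolding L_def U_def U'_def using B C by auto
  have "L * U = four_block_mat (1\<^sub>m m) (- C) B (1\<^sub>m n)"
    unfolding L_def U_def using B C
    by (subst mult_four_block_mat[where ?nr1.0 = m and ?n1.0 = m and ?n2.0 = n and ?nr2.0 = n
          and ?nc1.0 = m and ?nc2.0 = n]) (auto intro!: eq_matI cong_four_block_mat)
  moreover have "U' * L = four_block_mat (1\<^sub>m m) (- C) B (1\<^sub>m n)"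
    unfolding L_def U'_def using B C
    by (subst mult_four_block_mat[where ?nr1.0 = m and ?n1.0 = m and ?n2.0 = n and ?nr2.0 = n
          and ?nc1.0 = m and ?nc2.0 = n]) (auto intro!: eq_matI cong_four_block_mat)
  ultimately have "L * U = U' * L" by simp
  then have eq: "Determinant.det L * Determinant.det U = Determinant.det U' * Determinant.det L"
    using carr by (metis Determinant.det_mult)
  have "Determinant.det L = 1"
    unfolding L_def using B by (subst det_four_block_mat_upper_right_zero) auto
  moreover have "Determinant.det U = Determinant.det (1\<^sub>m n + B * C)"
    unfolding U_def using B C by (subst det_four_block_mat_lower_left_zero) auto
  moreover have "Determinant.det U' = Determinant.det (1\<^sub>m m + C * B)"
    unfolding U'_def using B C by (subst det_four_block_mat_lower_left_zero) auto
  ultimately show ?thesis using eq by simp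
qed

lemma tendsto_det_mat:
  fixes f :: "'b \<Rightarrow> nat \<Rightarrow> nat \<Rightarrow> 'a::{real_normed_field}"
  assumes "\<And>i j. i < m \<Longrightarrow> j < m \<Longrightarrow> ((\<lambda>x. f x i j) \<longlongrightarrow> g i j) F"
  shows "((\<lambda>x. Determinant.det (Matrix.mat m m (\<lambda>(i, j). f x i j))) \<longlongrightarrow>
    Determinant.det (Matrix.mat m m (\<lambda>(i, j). g i j))) F"
proof -
  have eq: "Determinant.det (Matrix.mat m m (\<lambda>(i, j). h i j)) =
      (\<Sum>p | p permutes {0..<m}. signof p * (\<Prod>i = 0..<m. h i (p i)))" for h :: "nat \<Rightarrow> nat \<Rightarrow> 'a"
    by (subst Determinant.det_def'[of _ m])
      (auto intro!: sum.cong prod.cong simp: permutes_in_image[of _ "{0..<m}", simplified] 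
         dest: permutes_in_image)
  show ?thesis unfolding eq
    by (intro tendsto_sum tendsto_mult tendsto_const tendsto_prod assms)
       (auto dest: permutes_in_image)
qed

text \<open>The majorant is itself a difference of products, so that the bound can be summed over all maps and
refactored by distributivity in the determinant estimate below.\<close>

lemma norm_prod_diff_le:
  fixes x y :: "'i \<Rightarrow> 'a::{real_normed_field}"
  assumes "finite S" "\<And>i. i \<in> S \<Longrightarrow> norm (x i) \<le> c i" "\<And>i. i \<in> S \<Longrightarrow> norm (y i - x i) \<le> d i"
  shows "norm ((\<Prod>i\<in>S. y i) - (\<Prod>i\<in>S. x i)) \<le> (\<Prod>i\<in>S. c i + d i) - (\<Prod>i\<in>S. c i)"
  using assms
proof (induction S rule: finite_induct)
  case empty
  then show ?case by simp
next
  case (insert a S)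
  let ?X = "\<Prod>i\<in>S. x i" and ?Y = "\<Prod>i\<in>S. y i"
  let ?C = "\<Prod>i\<in>S. c i" and ?D = "\<Prod>i\<in>S. c i + d i"
  have y: "norm (y i) \<le> c i + d i" if "i \<in> S" for i
    using insert.prems(1)[of i] insert.prems(2)[of i] that norm_triangle_ineq[of "x i" "y i - x i"] by auto
  have Y: "norm ?Y \<le> ?D" unfolding prod_norm[symmetric] by (intro prod_mono) (auto simp: y)
  have "y a * ?Y - x a * ?X = x a * (?Y - ?X) + (y a - x a) * ?Y" by (simp add: algebra_simps)
  then have "norm (y a * ?Y - x a * ?X) \<le> norm (x a) * norm (?Y - ?X) + norm (y a - x a) * norm ?Y"
    by (metis norm_mult norm_triangle_ineq)
  also have "\<dots> \<le> c a * (?D - ?C) + d a * ?D"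
    using insert.prems insert.IH Y
    by (intro add_mono mult_mono) (auto intro: order_trans[OF norm_ge_zero])
  also have "\<dots> = (c a + d a) * ?D - c a * ?C" by (simp add: algebra_simps)
  finally show ?case using insert.hyps by simp
qed

lemma prod_le_exp_sum:
  fixes f :: "'i \<Rightarrow> real"
  assumes "\<And>i. i \<in> S \<Longrightarrow> 0 \<le> f i"
  shows "(\<Prod>i\<in>S. 1 + f i) \<le> exp (\<Sum>i\<in>S. f i)"
proof (cases "finite S")
  case True
  show ?thesis unfolding exp_sum[OF True]
    by (intro prod_mono) (use assms in \<open>auto simp: exp_ge_add_one_self\<close>)
qed simp

text \<open>In the Leibniz formula the terms are compared by \<open>norm_prod_diff_le\<close>. The sum of the majorants over
permutations only grows when it is extended to all maps from indices to indices, where it factors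
into row sums. The point is that the bound depends on the sums of the absolute values of the
entries but not on \<open>n\<close>.\<close>

lemma norm_det_one_plus_diff_le:
  fixes a b :: "nat \<Rightarrow> nat \<Rightarrow> 'a::{real_normed_field}"
  shows "norm (Determinant.det (1\<^sub>m n + Matrix.mat n n (\<lambda>(i, j). b i j)) -
           Determinant.det (1\<^sub>m n + Matrix.mat n n (\<lambda>(i, j). a i j)))
    \<le> exp (\<Sum>i<n. \<Sum>j<n. norm (a i j)) * (exp (\<Sum>i<n. \<Sum>j<n. norm (b i j - a i j)) - 1)"
proof -
  let ?\<delta> = "\<lambda>i j. if i = j then 1 else 0"
  (* row sums of c are 1 plus row sums of |a|: the unit comes from the identity matrix *)
  define c where "c = (\<lambda>i j. ?\<delta> i j + norm (a i j))"
  define d where "d = (\<lambda>i j. norm (b i j - a i j))"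
  let ?P = "{p. p permutes {0..<n}}"
  let ?W = "\<lambda>p. (\<Prod>i=0..<n. c i (p i) + d i (p i)) - (\<Prod>i=0..<n. c i (p i))"
  let ?E = "{0..<n} \<rightarrow>\<^sub>E {0..<n}"
  have det_eq: "Determinant.det (1\<^sub>m n + Matrix.mat n n (\<lambda>(i, j). h i j)) =
      (\<Sum>p\<in>?P. signof p * (\<Prod>i = 0..<n. ?\<delta> i (p i) + h i (p i)))" for h :: "nat \<Rightarrow> nat \<Rightarrow> 'a"
    by (subst Determinant.det_def'[of _ n])
      (auto intro!: sum.cong prod.cong dest: permutes_in_image)
  have cd: "0 \<le> c i j" "0 \<le> d i j" for i j by (auto simp: c_def d_def)
  have W0: "0 \<le> ?W p" for p
    using cd by (auto intro!: prod_mono)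
  have fin: "finite ?P" by (simp add: finite_permutations)
  have "norm (Determinant.det (1\<^sub>m n + Matrix.mat n n (\<lambda>(i, j). b i j)) -
           Determinant.det (1\<^sub>m n + Matrix.mat n n (\<lambda>(i, j). a i j)))
      = norm (\<Sum>p\<in>?P. signof p *
          ((\<Prod>i = 0..<n. ?\<delta> i (p i) + b i (p i)) - (\<Prod>i = 0..<n. ?\<delta> i (p i) + a i (p i))))"
    unfolding det_eq by (simp add: sum_subtractf right_diff_distrib)
  also have "\<dots> \<le> (\<Sum>p\<in>?P. ?W p)"
  proof (rule sum_norm_le)
    fix p assume "p \<in> ?P"
    have "norm (signof p :: 'a) = 1" by (auto simp: sign_def)
    moreover have "norm ((\<Prod>i = 0..<n. ?\<delta> i (p i) + b i (p i)) - (\<Prod>i = 0..<n. ?\<delta> i (p i) + a i (p i))) \<le> ?W p"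
      by (intro norm_prod_diff_le) (auto simp: c_def d_def intro: order_trans[OF norm_triangle_ineq])
    ultimately show "norm (signof p * ((\<Prod>i = 0..<n. ?\<delta> i (p i) + b i (p i)) -
        (\<Prod>i = 0..<n. ?\<delta> i (p i) + a i (p i)))) \<le> ?W p"
      by (simp add: norm_mult)
  qed
  (* permutations are the identity off the index set, extensional functions are undefined there *)
  also have "\<dots> = (\<Sum>p\<in>(\<lambda>p. restrict p {0..<n}) ` ?P. ?W p)"
  proof (subst sum.reindex)
    show "inj_on (\<lambda>p. restrict p {0..<n}) ?P"
    proof (rule inj_onI)
      fix p q assume pq: "p \<in> ?P" "q \<in> ?P" "restrict p {0..<n} = restrict q {0..<n}"
      show "p = q"
      proof
        fix i show "p i = q i"
          using pq by (cases "i \<in> {0..<n}") (metis restrict_apply', auto simp: permutes_def)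
      qed
    qed
  qed simp
  also have "\<dots> \<le> (\<Sum>p\<in>?E. ?W p)"
    using W0 by (intro sum_mono2) (auto intro!: finite_PiE dest: permutes_in_image)
  also have "\<dots> = (\<Prod>i=0..<n. \<Sum>j=0..<n. c i j + d i j) - (\<Prod>i=0..<n. \<Sum>j=0..<n. c i j)"
    by (simp add: sum_subtractf prod_sum_PiE)
  also have "\<dots> = (\<Prod>i<n. (1 + (\<Sum>j<n. norm (a i j))) + (\<Sum>j<n. d i j)) - (\<Prod>i<n. 1 + (\<Sum>j<n. norm (a i j)))"
    by (simp add: c_def sum.distrib atLeast0LessThan)
  also have "\<dots> \<le> (\<Prod>i<n. (1 + (\<Sum>j<n. norm (a i j))) * (1 + (\<Sum>j<n. d i j))) - (\<Prod>i<n. 1 + (\<Sum>j<n. norm (a i j)))"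
    using cd by (intro diff_right_mono prod_mono)
      (auto simp: algebra_simps intro!: add_nonneg_nonneg sum_nonneg mult_nonneg_nonneg)
  also have "\<dots> = (\<Prod>i<n. 1 + (\<Sum>j<n. norm (a i j))) * ((\<Prod>i<n. 1 + (\<Sum>j<n. d i j)) - 1)"
    by (simp only: prod.distrib) (simp add: algebra_simps)
  also have "\<dots> \<le> exp (\<Sum>i<n. \<Sum>j<n. norm (a i j)) * (exp (\<Sum>i<n. \<Sum>j<n. d i j) - 1)"
    using cd by (intro mult_mono diff_right_mono prod_le_exp_sum sum_nonneg)
      (auto intro!: prod_ge_1 sum_nonneg)
  finally show ?thesis by (simp add: d_def)
qed

section \<open>Finite-rank operators and reducing decompositions\<close>

lemma bounded_ops_iff:
  "A \<in> bounded_ops \<longleftrightarrow> bounded_linear A \<and> (\<forall>c x. A (scaleC c x) = scaleC c (A x))"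
  by (simp add: bounded_ops_def)

lemma bounded_opsD:
  assumes "A \<in> bounded_ops"
  shows "bounded_linear A" "A (scaleC c x) = scaleC c (A x)" "A (x + y) = A x + A y"
    "A (x - y) = A x - A y" "A 0 = 0" "A (sum f S) = (\<Sum>i\<in>S. A (f i))"
proof -
  show bl: "bounded_linear A" and "A (scaleC c x) = scaleC c (A x)"
    using assms by (auto simp: bounded_ops_iff)
  from bl interpret bounded_linear A .
  show "A (x + y) = A x + A y" "A (x - y) = A x - A y" "A 0 = 0" "A (sum f S) = (\<Sum>i\<in>S. A (f i))"
    by (rule add diff zero sum)+
qed

lemma bounded_opsI:
  assumes "\<And>x y. A (x + y) = A x + A y" "\<And>c x. A (scaleC c x) = scaleC c (A x)"
    "\<And>x. norm (A x) \<le> K * norm x"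
  shows "A \<in> bounded_ops"
  unfolding bounded_ops_iff
proof
  show "bounded_linear A"
    by (rule bounded_linear_intro[where K = K])
      (use assms in \<open>auto simp: scaleR_scaleC mult.commute\<close>)
qed (use assms in auto)

lemma subspace_range_kernel:
  assumes "A \<in> bounded_ops"
  shows "complex_vector.subspace (range A)" "complex_vector.subspace {x. A x = 0}"
proof -
  show "complex_vector.subspace (range A)"
  proof (rule complex_vector.subspaceI)
    show "0 \<in> range A" using bounded_opsD(5)[OF assms, symmetric] by (rule range_eqI)
    show "x + y \<in> range A" if "x \<in> range A" "y \<in> range A" for x y
      using that bounded_opsD(3)[OF assms, symmetric] by auto
    show "scaleC c x \<in> range A" if "x \<in> range A" for c x
      using that bounded_opsD(2)[OF assms, symmetric] by auto
  qed
  show "complex_vector.subspace {x. A x = 0}"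
    using bounded_opsD(2,3,5)[OF assms] by (auto simp: complex_vector.subspace_def)
qed

lemma span_disjoint_subsets_independent:
  assumes "complex_vector.independent B" "S \<subseteq> B" "T \<subseteq> B" "S \<inter> T = {}"
    "x \<in> complex_vector.span S" "x \<in> complex_vector.span T"
  shows "x = 0"
proof -
  have "complex_vector.representation B x b = 0" for b
  proof -
    note complex_vector.representation_extend[OF assms(1) assms(5) assms(2)]
      complex_vector.representation_extend[OF assms(1) assms(6) assms(3)]
    then show ?thesis
      using complex_vector.representation_ne_zero[of S x b]
        complex_vector.representation_ne_zero[of T x b] assms(4) by auto
  qed
  moreover have "x \<in> complex_vector.span B"
    using complex_vector.span_mono[OF assms(2)] assms(5) by auto
  ultimately show ?thesis
    using complex_vector.sum_nonzero_representation_eq[OF assms(1), of x] by simp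
qed

text \<open>Take \<open>M\<close> spanned by a basis of the range together with preimages of that basis: then \<open>M\<close> is
finite-dimensional, invariant, and \<open>M + ker F\<close> is everything. Shrinking the kernel to a complement
\<open>N\<close> of \<open>M \<inter> ker F\<close> in it makes the sum direct.\<close>

lemma finite_rank_reducing_decomposition:
  assumes "F \<in> finite_rank_ops"
  obtains M N bs where "reducing_decomposition F M N" "basis_list bs M"
proof -
  obtain S where F: "F \<in> bounded_ops" and S: "finite S" "range F \<subseteq> complex_vector.span S"
    using assms by (auto simp: finite_rank_ops_def)
  note Fd = bounded_opsD[OF F]
  let ?K = "{x. F x = 0}"
  note sub = subspace_range_kernel[OF F]
  obtain B where B: "B \<subseteq> range F" "complex_vector.independent B" "range F \<subseteq> complex_vector.span B"
    by (rule complex_vector.basis_exists)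
  have finB: "finite B"
    using complex_vector.independent_span_bound[OF S(1) B(2)] B(1) S(2) by auto
  have "\<forall>b\<in>B. \<exists>w. F w = b" using B(1) by (metis image_iff subsetD)
  then obtain w where w: "\<And>b. b \<in> B \<Longrightarrow> F (w b) = b" by metis
  (* M contains the range, and every x differs from a combination of the w b by a kernel element *)
  define M where "M = complex_vector.span (B \<union> w ` B)"
  have rM: "range F \<subseteq> M"
    unfolding M_def using B(3) complex_vector.span_mono[of B "B \<union> w ` B"] by auto
  obtain C where C: "C \<subseteq> M" "complex_vector.independent C" "M \<subseteq> complex_vector.span C"
    by (rule complex_vector.basis_exists)
  have finC: "finite C"
    using complex_vector.independent_span_bound[OF _ C(2), of "B \<union> w ` B"] C(1) finB
    by (auto simp: M_def)
  have spanC: "complex_vector.span C = M"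
    using C(3) complex_vector.span_minimal[OF C(1)] by (auto simp: M_def)
  obtain bs where bs: "set bs = C" "distinct bs" using finite_distinct_list[OF finC] by auto
  obtain L where L: "L \<subseteq> M \<inter> ?K" "complex_vector.independent L" "M \<inter> ?K \<subseteq> complex_vector.span L"
    by (rule complex_vector.basis_exists)
  obtain L' where L': "L \<subseteq> L'" "L' \<subseteq> ?K" "complex_vector.independent L'" "?K \<subseteq> complex_vector.span L'"
    using complex_vector.maximal_independent_subset_extend[of L ?K] L by blast
  (* L spans the part of the kernel inside M, L' the whole kernel *)
  define N where "N = complex_vector.span (L' - L)"
  have NK: "N \<subseteq> ?K"
    unfolding N_def using L'(2) by (intro complex_vector.span_minimal sub) auto
  have LM: "complex_vector.span L \<subseteq> M"
    using L(1) by (intro complex_vector.span_minimal) (auto simp: M_def)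
  have "M \<inter> N = {0}"
  proof -
    have "x = 0" if "x \<in> M" "x \<in> N" for x
      using span_disjoint_subsets_independent[OF L'(3,1), of "L' - L" x] that NK L(3)
      by (auto simp: N_def)
    then show ?thesis by (auto simp: M_def N_def complex_vector.span_zero)
  qed
  moreover have "\<exists>y z. x = y + z \<and> y \<in> M \<and> z \<in> N" for x
  proof -
    let ?c = "complex_vector.representation B (F x)"
    define y where "y = (\<Sum>b\<in>B. scaleC (?c b) (w b))"
    have "F y = (\<Sum>b\<in>B. scaleC (?c b) b)"
      unfolding y_def Fd(6) by (intro sum.cong) (simp_all add: Fd w)
    also have "\<dots> = F x"
      using B(3) by (intro complex_vector.sum_representation_eq B(2) finB) auto
    finally have "x - y \<in> complex_vector.span L'" using L'(4) by (auto simp: Fd)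
    also have "L' = L \<union> (L' - L)" using L'(1) by auto
    finally obtain l n where ln: "x - y = l + n" "l \<in> complex_vector.span L" "n \<in> N"
      unfolding complex_vector.span_Un N_def by auto
    have "y \<in> M"
      unfolding y_def M_def
      by (intro complex_vector.span_sum complex_vector.span_scale complex_vector.span_base) auto
    then have "y + l \<in> M"
      using ln(2) LM unfolding M_def by (auto intro: complex_vector.span_add)
    moreover have "x = (y + l) + n" using ln(1) by (simp add: algebra_simps)
    ultimately show ?thesis using ln(3) by blast
  qed
  ultimately have "reducing_decomposition F M N"
    unfolding reducing_decomposition_def using rM NK
    by (auto simp: M_def N_def) 
  moreover have "basis_list bs M"
    using bs C(2) spanC by (simp add: basis_list_def)
  ultimately show ?thesis by (rule that)
qed

section \<open>Trace and determinant of finite-rank operators from coordinate sections\<close>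

definition bounded_functional :: "('e::complex_normed_vector \<Rightarrow> complex) \<Rightarrow> bool" where
  "bounded_functional f \<longleftrightarrow> bounded_linear f \<and> (\<forall>c x. f (scaleC c x) = c * f x)"

lemma bounded_functionalD:
  assumes "bounded_functional f"
  shows "bounded_linear f" "f (scaleC c x) = c * f x" "f (x + y) = f x + f y"
    "f (x - y) = f x - f y" "f 0 = 0" "f (sum g S) = (\<Sum>i\<in>S. f (g i))"
proof -
  show bl: "bounded_linear f" and "f (scaleC c x) = c * f x"
    using assms by (auto simp: bounded_functional_def)
  from bl interpret bounded_linear f .
  show "f (x + y) = f x + f y" "f (x - y) = f x - f y" "f 0 = 0" "f (sum g S) = (\<Sum>i\<in>S. f (g i))"
    by (rule add diff zero sum)+
qed

lemma bounded_functional_const_mult: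
  "bounded_functional f \<Longrightarrow> bounded_functional (\<lambda>x. c * f x)"
  by (auto simp: bounded_functional_def bounded_linear_const_mult)

lemma bounded_functional_diff:
  "bounded_functional f \<Longrightarrow> bounded_functional g \<Longrightarrow> bounded_functional (\<lambda>x. f x - g x)"
  by (auto simp: bounded_functional_def bounded_linear_sub algebra_simps)

lemma bounded_functional_sum:
  "(\<And>i. i \<in> S \<Longrightarrow> bounded_functional (f i)) \<Longrightarrow> bounded_functional (\<lambda>x. \<Sum>i\<in>S. f i x)"
  unfolding bounded_functional_def by (auto intro: bounded_linear_sum simp: sum_distrib_left)

lemma bounded_functional_comp:
  assumes "bounded_functional f" "A \<in> bounded_ops"
  shows "bounded_functional (\<lambda>x. f (A x))"
  using assms bounded_linear_compose[of f A]
  by (auto simp: bounded_functional_def bounded_ops_iff)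

text \<open>Coordinates with respect to a finite independent set are bounded, since the dual functionals can be
taken as linear combinations of a given separating family \<open>u\<close>: when \<open>a\<close> is adjoined, its
residual \<open>r\<close> after subtracting the old coordinates is nonzero and hence detected by some \<open>u k\<close>.\<close>

lemma dual_functionals_exist:
  fixes u :: "'k \<Rightarrow> 'e::complex_normed_vector \<Rightarrow> complex" and S :: "'e set"
  assumes U: "\<And>k. bounded_functional (u k)" and sep: "\<And>x. (\<And>k. u k x = 0) \<Longrightarrow> x = 0"
    and "finite S" "complex_vector.independent S"
  obtains \<psi> where "\<And>b. bounded_functional (\<psi> b)"
    "\<And>b b'. b \<in> S \<Longrightarrow> b' \<in> S \<Longrightarrow> \<psi> b b' = (if b = b' then 1 else 0)"
proof -
  have "\<exists>\<psi>. (\<forall>b. bounded_functional (\<psi> b)) \<and> (\<forall>b\<in>S. \<forall>b'\<in>S. \<psi> b b' = (if b = b' then 1 else 0))"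
    using assms(3,4)
  proof (induction S rule: finite_induct)
    case empty
    show ?case
      by (intro exI[of _ "\<lambda>_ _. 0"]) (simp add: bounded_functional_def bounded_linear_zero)
  next
    case (insert a S)
    then have ind: "complex_vector.independent S" and a: "a \<notin> complex_vector.span S"
      by (auto simp: complex_vector.independent_insert)
    from insert.IH[OF ind] obtain \<psi> where \<psi>: "\<And>b. bounded_functional (\<psi> b)"
      "\<And>b b'. b \<in> S \<Longrightarrow> b' \<in> S \<Longrightarrow> \<psi> b b' = (if b = b' then 1 else 0)" by blast
    define r where "r = a - (\<Sum>s\<in>S. scaleC (\<psi> s a) s)"
    have "(\<Sum>s\<in>S. scaleC (\<psi> s a) s) \<in> complex_vector.span S"
      by (intro complex_vector.span_sum complex_vector.span_scale complex_vector.span_base)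
    then have "r \<noteq> 0" using a by (auto simp: r_def)
    then obtain k where k: "u k r \<noteq> 0" using sep by blast
    define \<rho> where "\<rho> = (\<lambda>x. inverse (u k r) * (u k x - (\<Sum>s\<in>S. u k s * \<psi> s x)))"
    have \<rho>: "bounded_functional \<rho>"
      unfolding \<rho>_def
      by (intro bounded_functional_const_mult bounded_functional_diff bounded_functional_sum \<psi> U)
    have \<rho>S: "\<rho> b = 0" if "b \<in> S" for b
    proof -
      have "(\<Sum>s\<in>S. u k s * \<psi> s b) = (\<Sum>s\<in>S. if s = b then u k s else 0)"
        using that by (intro sum.cong) (auto simp: \<psi>(2))
      then show ?thesis using that insert.hyps by (simp add: \<rho>_def)
    qed
    have \<rho>a: "\<rho> a = 1"
      using k by (simp add: \<rho>_def r_def bounded_functionalD[OF U] mult.commute)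
    show ?case
    proof (intro exI[of _ "\<lambda>b. if b = a then \<rho> else (\<lambda>x. \<psi> b x - \<psi> b a * \<rho> x)"] conjI allI ballI)
      show "bounded_functional (if b = a then \<rho> else (\<lambda>x. \<psi> b x - \<psi> b a * \<rho> x))" for b
        using \<rho> \<psi>(1) by (auto intro: bounded_functional_diff bounded_functional_const_mult)
    qed (use \<rho>S \<rho>a \<psi>(2) insert.hyps in auto)
  qed
  then show ?thesis using that by blast
qed

text \<open>A common framework for the unit vectors of \<open>\<ell>\<^sup>2\<close> and the exponentials in \<open>L\<^sup>2\<close> of the torus: \<open>u\<close> gives
the coordinates of a vector with respect to \<open>e\<close>.\<close>

locale coordinate_system =
  fixes e :: "nat \<Rightarrow> 'e::complex_normed_vector" and u :: "nat \<Rightarrow> 'e \<Rightarrow> complex"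
  assumes functional: "bounded_functional (u k)"
    and expansion: "(\<lambda>n. \<Sum>k<n. scaleC (u k x) (e k)) \<longlonglongrightarrow> x"
begin

lemma coordinates_separate: "(\<And>k. u k x = 0) \<Longrightarrow> x = 0"
  using expansion[of x] by (simp add: LIMSEQ_const_iff)

lemma functional_expansion:
  assumes "bounded_functional f"
  shows "(\<lambda>n. \<Sum>k<n. u k x * f (e k)) \<longlonglongrightarrow> f x"
  using bounded_linear.tendsto[OF bounded_functionalD(1)[OF assms] expansion[of x]]
  by (simp add: bounded_functionalD[OF assms])

definition section_trace :: "('e \<Rightarrow> 'e) \<Rightarrow> nat \<Rightarrow> complex" where
  "section_trace F n = (\<Sum>k<n. u k (F (e k)))"

definition section_det :: "('e \<Rightarrow> 'e) \<Rightarrow> nat \<Rightarrow> complex" where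
  "section_det F n = Determinant.det (1\<^sub>m n + Matrix.mat n n (\<lambda>(i, j). u i (F (e j))))"

text \<open>The functionals \<open>\<phi> i\<close> are the coordinates of \<open>F x\<close> with respect to \<open>bs\<close>. Their boundedness is what
allows evaluation on the expansions of the basis vectors later.\<close>

lemma finite_rank_factorization:
  fixes F :: "'e \<Rightarrow> 'e"
  assumes F: "F \<in> bounded_ops" and MN: "reducing_decomposition F M N" and bs: "basis_list bs M"
  obtains \<phi> where "\<And>i. bounded_functional (\<phi> i)"
    "\<And>x. F x = (\<Sum>i<length bs. scaleC (\<phi> i x) (bs ! i))"
    "matrix_on bs F = Matrix.mat (length bs) (length bs) (\<lambda>(i, j). \<phi> i (bs ! j))"
proof -
  have ind: "complex_vector.independent (set bs)" and sp: "complex_vector.span (set bs) = M"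
    and dist: "distinct bs"
    using bs by (auto simp: basis_list_def)
  obtain \<psi> where \<psi>: "\<And>b. bounded_functional (\<psi> b)"
    "\<And>b b'. b \<in> set bs \<Longrightarrow> b' \<in> set bs \<Longrightarrow> \<psi> b b' = (if b = b' then 1 else 0)"
    using dual_functionals_exist[of u "set bs", OF functional coordinates_separate finite_set ind]
    by metis
  have rng: "F x \<in> complex_vector.span (set bs)" for x
  proof -
    have "{x + y |x y. x \<in> M \<and> y \<in> N} = UNIV" and M: "F ` M \<subseteq> M" and N: "\<forall>x\<in>N. F x = 0"
      using MN unfolding reducing_decomposition_def by blast+
    then obtain y z where "x = y + z" "y \<in> M" "z \<in> N" by blast
    moreover from this have "F y \<in> M" "F z = 0" using M N by auto
    ultimately have "F x \<in> M" by (simp add: bounded_opsD(3)[OF F])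
    then show ?thesis by (simp add: sp)
  qed
  have rep: "complex_vector.representation (set bs) v b = \<psi> b v"
    if v: "v \<in> complex_vector.span (set bs)" and b: "b \<in> set bs" for v b
  proof -
    let ?r = "complex_vector.representation (set bs) v"
    have "\<psi> b v = \<psi> b (\<Sum>b'\<in>set bs. scaleC (?r b') b')"
      by (simp only: complex_vector.sum_representation_eq[OF ind v finite_set order_refl])
    also have "\<dots> = (\<Sum>b'\<in>set bs. if b' = b then ?r b' else 0)"
      unfolding bounded_functionalD(6)[OF \<psi>(1)]
      by (intro sum.cong) (auto simp: bounded_functionalD(2)[OF \<psi>(1)] \<psi>(2) b)
    finally show ?thesis using b by simp
  qed
  show ?thesis
  proof
    show "bounded_functional (\<lambda>x. \<psi> (bs ! i) (F x))" for i
      using \<psi>(1) F by (rule bounded_functional_comp)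
    show "F x = (\<Sum>i<length bs. scaleC (\<psi> (bs ! i) (F x)) (bs ! i))" for x
    proof -
      have "F x = (\<Sum>b\<in>set bs. scaleC (complex_vector.representation (set bs) (F x) b) b)"
        by (rule complex_vector.sum_representation_eq[OF ind rng finite_set order_refl, symmetric])
      also have "\<dots> = (\<Sum>b\<in>set bs. scaleC (\<psi> b (F x)) b)"
        by (intro sum.cong refl) (simp only: rep[OF rng])
      also have "\<dots> = (\<Sum>i<length bs. scaleC (\<psi> (bs ! i) (F x)) (bs ! i))"
        by (rule sum.reindex_bij_betw[symmetric, OF bij_betw_nth]) (use dist in auto)
      finally show ?thesis .
    qed
    show "matrix_on bs F = Matrix.mat (length bs) (length bs) (\<lambda>(i, j). \<psi> (bs ! i) (F (bs ! j)))"
      unfolding matrix_on_def by (intro eq_matI) (auto simp: rep rng)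
  qed
qed

text \<open>The section factors through the fixed dimension \<open>length bs\<close>; after commuting the factors, its trace
and determinant are those of a matrix of fixed size, whose entries are partial sums of the
expansions of \<open>\<phi> i (bs ! j)\<close>. As the sections do not refer to \<open>M\<close>, \<open>N\<close>, \<open>bs\<close>, the limits show that
trace and determinant are independent of the decomposition.\<close>

lemma finite_rank_section_limits:
  fixes F :: "'e \<Rightarrow> 'e"
  assumes F: "F \<in> bounded_ops" and MN: "reducing_decomposition F M N" and bs: "basis_list bs M"
  shows "section_trace F \<longlonglongrightarrow> (\<Sum>i<length bs. matrix_on bs F $$ (i, i))"
    and "section_det F \<longlonglongrightarrow> Determinant.det (1\<^sub>m (length bs) + matrix_on bs F)"
proof -
  let ?m = "length bs"
  obtain \<phi> where \<phi>: "\<And>i. bounded_functional (\<phi> i)"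
    and F_eq: "\<And>x. F x = (\<Sum>i<?m. scaleC (\<phi> i x) (bs ! i))"
    and mat: "matrix_on bs F = Matrix.mat ?m ?m (\<lambda>(i, j). \<phi> i (bs ! j))"
    by (rule finite_rank_factorization[OF assms]) (rule that)
  have entry: "u i (F (e j)) = (\<Sum>l<?m. u i (bs ! l) * \<phi> l (e j))" for i j
    by (simp add: F_eq bounded_functionalD[OF functional] mult.commute)
  have lim: "(\<lambda>n. \<Sum>k<n. \<phi> i (e k) * u k (bs ! j)) \<longlonglongrightarrow> \<phi> i (bs ! j)" for i j
    using functional_expansion[OF \<phi>[of i], of "bs ! j"] by (simp add: mult.commute)
  have "section_trace F = (\<lambda>n. \<Sum>i<?m. \<Sum>k<n. \<phi> i (e k) * u k (bs ! i))"
    unfolding section_trace_def entry by (subst sum.swap) (simp add: mult.commute)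
  then show "section_trace F \<longlonglongrightarrow> (\<Sum>i<?m. matrix_on bs F $$ (i, i))"
    using tendsto_sum[of "{..<?m}", OF lim] by (simp add: mat)
  have "section_det F n = Determinant.det
      (Matrix.mat ?m ?m (\<lambda>(i, j). (if i = j then 1 else 0) + (\<Sum>k<n. \<phi> i (e k) * u k (bs ! j))))" for n
  proof -
    let ?B = "Matrix.mat n ?m (\<lambda>(i, j). u i (bs ! j))" and ?C = "Matrix.mat ?m n (\<lambda>(i, j). \<phi> i (e j))"
    have "Matrix.mat n n (\<lambda>(i, j). u i (F (e j))) = ?B * ?C"
      by (intro eq_matI) (auto simp: scalar_prod_def entry atLeast0LessThan)
    moreover have "1\<^sub>m ?m + ?C * ?B =
      Matrix.mat ?m ?m (\<lambda>(i, j). (if i = j then 1 else 0) + (\<Sum>k<n. \<phi> i (e k) * u k (bs ! j)))"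
      by (intro eq_matI) (auto simp: scalar_prod_def atLeast0LessThan)
    ultimately show ?thesis
      using det_one_plus_mult_commute[of ?B n ?m ?C] by (simp add: section_det_def)
  qed
  moreover have "1\<^sub>m ?m + matrix_on bs F =
      Matrix.mat ?m ?m (\<lambda>(i, j). (if i = j then 1 else 0) + \<phi> i (bs ! j))"
    unfolding mat by (intro eq_matI) auto
  ultimately show "section_det F \<longlonglongrightarrow> Determinant.det (1\<^sub>m ?m + matrix_on bs F)"
    by (subst tendsto_cong[where g = "\<lambda>n. Determinant.det
      (Matrix.mat ?m ?m (\<lambda>(i, j). (if i = j then 1 else 0) + (\<Sum>k<n. \<phi> i (e k) * u k (bs ! j))))"])
      (auto intro!: tendsto_det_mat tendsto_add lim)
qed

lemma finite_rank_trace_limit: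
  fixes F :: "'e \<Rightarrow> 'e"
  assumes "F \<in> finite_rank_ops"
  shows "section_trace F \<longlonglongrightarrow> finite_rank_trace F"
proof -
  have F: "F \<in> bounded_ops" using assms by (simp add: finite_rank_ops_def)
  obtain M N bs where dec: "reducing_decomposition F M N" "basis_list bs M"
    using finite_rank_reducing_decomposition[OF assms] .
  note lim = finite_rank_section_limits(1)[OF F]
  have "finite_rank_trace F = (\<Sum>i<length bs. matrix_on bs F $$ (i, i))"
    unfolding finite_rank_trace_def
  proof (rule the_equality)
    fix t
    assume "\<exists>M N bs. reducing_decomposition F M N \<and> basis_list bs M \<and>
      t = (\<Sum>i<length bs. matrix_on bs F $$ (i, i))"
    then show "t = (\<Sum>i<length bs. matrix_on bs F $$ (i, i))"
      using LIMSEQ_unique[OF lim lim[OF dec]] by auto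
  qed (use dec in auto)
  then show ?thesis using lim[OF dec] by simp
qed

lemma finite_rank_det_limit:
  fixes F :: "'e \<Rightarrow> 'e"
  assumes "F \<in> finite_rank_ops"
  shows "section_det F \<longlonglongrightarrow> finite_rank_det F"
proof -
  have F: "F \<in> bounded_ops" using assms by (simp add: finite_rank_ops_def)
  obtain M N bs where dec: "reducing_decomposition F M N" "basis_list bs M"
    using finite_rank_reducing_decomposition[OF assms] .
  note lim = finite_rank_section_limits(2)[OF F]
  have "finite_rank_det F = Determinant.det (1\<^sub>m (length bs) + matrix_on bs F)"
    unfolding finite_rank_det_def
  proof (rule the_equality)
    fix d
    assume "\<exists>M N bs. reducing_decomposition F M N \<and> basis_list bs M \<and>
      d = Determinant.det (1\<^sub>m (length bs) + matrix_on bs F)"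
    then show "d = Determinant.det (1\<^sub>m (length bs) + matrix_on bs F)"
      using LIMSEQ_unique[OF lim lim[OF dec]] by auto
  qed (use dec in auto)
  then show ?thesis using lim[OF dec] by simp
qed

end

section \<open>Limits of section functionals as continuous extensions\<close>

text \<open>Equicontinuity transfers convergence from the dense set of finite-rank operators to the whole
algebra and makes the limit continuous; a continuous extension from a dense set is unique.\<close>

lemma section_functional_extension:
  fixes q :: "('a::complex_normed_vector \<Rightarrow> 'a) \<Rightarrow> nat \<Rightarrow> complex"
  assumes dense: "approximable D N"
    and sym: "\<And>A B. A \<in> D \<Longrightarrow> B \<in> D \<Longrightarrow> N (\<lambda>x. A x - B x) = N (\<lambda>x. B x - A x)"
    and lim: "\<And>F. F \<in> finite_rank_ops \<inter> D \<Longrightarrow> q F \<longlonglongrightarrow> f F"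
    and equi: "\<And>A \<epsilon>. A \<in> D \<Longrightarrow> \<epsilon> > 0 \<Longrightarrow>
      \<exists>\<delta>>0. \<forall>B\<in>D. N (\<lambda>x. B x - A x) < \<delta> \<longrightarrow> (\<forall>n. cmod (q B n - q A n) \<le> \<epsilon>)"
  defines "ext \<equiv> \<lambda>A. THE t. \<exists>g. continuous_extension D N f g \<and> t = g A"
  shows "A \<in> D \<Longrightarrow> q A \<longlonglongrightarrow> ext A" and "continuous_extension D N f ext"
proof -
  have approx: "\<exists>F\<in>finite_rank_ops \<inter> D. \<forall>n. cmod (q F n - q A n) \<le> \<epsilon>" if "A \<in> D" "\<epsilon> > 0" for A \<epsilon>
  proof -
    obtain \<delta> where "\<delta> > 0" "\<forall>B\<in>D. N (\<lambda>x. B x - A x) < \<delta> \<longrightarrow> (\<forall>n. cmod (q B n - q A n) \<le> \<epsilon>)"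
      using equi[OF \<open>A \<in> D\<close> \<open>\<epsilon> > 0\<close>] by blast
    moreover obtain F where "F \<in> finite_rank_ops \<inter> D" "N (\<lambda>x. A x - F x) < \<delta>"
      using dense \<open>A \<in> D\<close> \<open>\<delta> > 0\<close> by (auto simp: approximable_def)
    ultimately show ?thesis using sym[of A F] \<open>A \<in> D\<close> by auto
  qed
  have conv: "convergent (q A)" if A: "A \<in> D" for A
  proof (rule Cauchy_convergent, rule metric_CauchyI)
    fix \<epsilon> :: real assume "\<epsilon> > 0"
    then obtain F where F: "F \<in> finite_rank_ops \<inter> D" "\<And>n. cmod (q F n - q A n) \<le> \<epsilon> / 4"
      using approx[OF A, of "\<epsilon> / 4"] by auto
    obtain n0 where n0: "\<And>m n. m \<ge> n0 \<Longrightarrow> n \<ge> n0 \<Longrightarrow> dist (q F m) (q F n) < \<epsilon> / 4"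
      using metric_CauchyD[OF LIMSEQ_imp_Cauchy[OF lim[OF F(1)]], of "\<epsilon> / 4"] \<open>\<epsilon> > 0\<close> by auto
    have "dist (q A m) (q A n) < \<epsilon>" if "m \<ge> n0" "n \<ge> n0" for m n
    proof -
      have "dist (q A m) (q A n) \<le> dist (q F m) (q A m) + dist (q F m) (q F n) + dist (q F n) (q A n)"
        using dist_triangle[of "q A m" "q A n" "q F m"] dist_triangle[of "q F m" "q A n" "q F n"]
        by (simp add: dist_commute)
      also have "\<dots> < \<epsilon>" using F(2)[of m] F(2)[of n] n0[OF that] \<open>\<epsilon> > 0\<close> by (simp add: dist_norm)
      finally show ?thesis .
    qed
    then show "\<exists>M. \<forall>m\<ge>M. \<forall>n\<ge>M. dist (q A m) (q A n) < \<epsilon>" by blast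
  qed
  define g where "g = (\<lambda>A. lim (q A))"
  have g: "q A \<longlonglongrightarrow> g A" if "A \<in> D" for A
    using conv[OF that] by (simp add: g_def convergent_LIMSEQ_iff)
  have g_ext: "continuous_extension D N f g"
    unfolding continuous_extension_def
  proof (intro conjI ballI allI impI)
    fix F assume "F \<in> finite_rank_ops \<inter> D"
    then show "g F = f F" using g[of F] lim[of F] LIMSEQ_unique by blast
  next
    fix A and \<epsilon> :: real assume A: "A \<in> D" and "\<epsilon> > 0"
    then obtain \<delta> where \<delta>: "\<delta> > 0"
      "\<And>B n. B \<in> D \<Longrightarrow> N (\<lambda>x. B x - A x) < \<delta> \<Longrightarrow> cmod (q B n - q A n) \<le> \<epsilon> / 2"
      using equi[of A "\<epsilon> / 2"] by (auto simp: half_gt_zero)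
    have "cmod (g B - g A) < \<epsilon>" if "B \<in> D" "N (\<lambda>x. B x - A x) < \<delta>" for B
    proof -
      have "cmod (g B - g A) \<le> \<epsilon> / 2"
        by (rule LIMSEQ_le_const2[OF tendsto_norm[OF tendsto_diff[OF g[OF that(1)] g[OF A]]]])
          (use \<delta>(2)[OF that] in auto)
      then show ?thesis using \<open>\<epsilon> > 0\<close> by simp
    qed
    then show "\<exists>\<delta>>0. \<forall>B\<in>D. N (\<lambda>x. B x - A x) < \<delta> \<longrightarrow> cmod (g B - g A) < \<epsilon>"
      using \<delta>(1) by blast
  qed
  have uniq: "h A = g A" if h: "continuous_extension D N f h" and A: "A \<in> D" for h A
  proof (rule ccontr)
    assume "h A \<noteq> g A"
    define \<epsilon> where "\<epsilon> = cmod (h A - g A) / 2"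
    have "\<epsilon> > 0" using \<open>h A \<noteq> g A\<close> by (simp add: \<epsilon>_def)
    obtain \<delta>1 where \<delta>1: "\<delta>1 > 0" "\<And>B. B \<in> D \<Longrightarrow> N (\<lambda>x. B x - A x) < \<delta>1 \<Longrightarrow> cmod (h B - h A) < \<epsilon>"
      using h A \<open>\<epsilon> > 0\<close> unfolding continuous_extension_def by blast
    obtain \<delta>2 where \<delta>2: "\<delta>2 > 0" "\<And>B. B \<in> D \<Longrightarrow> N (\<lambda>x. B x - A x) < \<delta>2 \<Longrightarrow> cmod (g B - g A) < \<epsilon>"
      using g_ext A \<open>\<epsilon> > 0\<close> unfolding continuous_extension_def by blast
    obtain F where F: "F \<in> finite_rank_ops \<inter> D" "N (\<lambda>x. A x - F x) < min \<delta>1 \<delta>2"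
      using dense A \<delta>1(1) \<delta>2(1) unfolding approximable_def by (metis min_less_iff_conj)
    have "h F = g F" using h g_ext F(1) by (simp add: continuous_extension_def)
    moreover have "cmod (h F - h A) < \<epsilon>" "cmod (g F - g A) < \<epsilon>"
      using \<delta>1(2)[of F] \<delta>2(2)[of F] F sym[of A F] A by auto
    ultimately have "cmod (h A - g A) < 2 * \<epsilon>"
      using norm_triangle_ineq4[of "g F - g A" "h F - h A"] by (simp add: algebra_simps)
    then show False by (simp add: \<epsilon>_def)
  qed
  have ext_eq: "ext A = g A" if "A \<in> D" for A
    unfolding ext_def by (rule the_equality) (use g_ext uniq that in blast)+
  then show "A \<in> D \<Longrightarrow> q A \<longlonglongrightarrow> ext A" using g by simp
  show "continuous_extension D N f ext"
    using g_ext ext_eq unfolding continuous_extension_def by auto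
qed

section \<open>The algebra of operators with absolutely summable matrix\<close>

lemma bounded_ops_zero: "(\<lambda>x. 0) \<in> bounded_ops"
  by (simp add: bounded_ops_iff bounded_linear_zero complex_vector.scale_zero_right)

lemma bounded_ops_add:
  "A \<in> bounded_ops \<Longrightarrow> B \<in> bounded_ops \<Longrightarrow> (\<lambda>x. A x + B x) \<in> bounded_ops"
  by (simp add: bounded_ops_iff bounded_linear_add scaleC_add_right)

lemma bounded_ops_comp:
  "A \<in> bounded_ops \<Longrightarrow> B \<in> bounded_ops \<Longrightarrow> A \<circ> B \<in> bounded_ops"
  using bounded_linear_compose[of A B] by (simp add: bounded_ops_iff o_def)

lemma bounded_ops_scaleC:
  assumes "A \<in> bounded_ops"
  shows "(\<lambda>x. scaleC c (A x)) \<in> bounded_ops"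
proof -
  obtain K where K: "\<And>x. norm (A x) \<le> norm x * K"
    using bounded_linear.bounded[OF bounded_opsD(1)[OF assms]] by blast
  show ?thesis
  proof (rule bounded_opsI)
    show "norm (scaleC c (A x)) \<le> (cmod c * K) * norm x" for x
      using mult_left_mono[OF K, of "cmod c" x] by (simp add: norm_scaleC mult_ac)
  qed (simp_all add: bounded_opsD[OF assms] scaleC_add_right scaleC_scaleC mult.commute)
qed

lemma bounded_ops_sum:
  "(\<And>i. i \<in> S \<Longrightarrow> A i \<in> bounded_ops) \<Longrightarrow> (\<lambda>x. \<Sum>i\<in>S. A i x) \<in> bounded_ops"
  by (induction S rule: infinite_finite_induct) (simp_all add: bounded_ops_zero bounded_ops_add)

lemma bounded_ops_rank_one:
  fixes v :: "'e::complex_normed_vector"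
  assumes "bounded_functional (f :: 'e \<Rightarrow> complex)"
  shows "(\<lambda>x. scaleC (f x) v) \<in> bounded_ops"
proof -
  obtain K where K: "\<And>x. cmod (f x) \<le> norm x * K"
    using bounded_linear.bounded[OF bounded_functionalD(1)[OF assms]] by blast
  show ?thesis
  proof (rule bounded_opsI)
    show "norm (scaleC (f x) v) \<le> (K * norm v) * norm x" for x
      using mult_right_mono[OF K, of "norm v" x] by (simp add: norm_scaleC mult_ac)
  qed (simp_all add: bounded_functionalD[OF assms] scaleC_add_left scaleC_scaleC)
qed

lemma ell2_coeff_simps [simp]:
  "ell2_coeff 0 k = 0"
  "ell2_coeff (x + y) k = ell2_coeff x k + ell2_coeff y k"
  "ell2_coeff (x - y) k = ell2_coeff x k - ell2_coeff y k"
  "ell2_coeff (scaleC c x) k = c * ell2_coeff x k"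
  "ell2_coeff (ell2_unit l) k = (if k = l then 1 else 0)"
  by (transfer; simp)+

lemma ell2_coeff_sum [simp]: "ell2_coeff (\<Sum>i\<in>S. f i) k = (\<Sum>i\<in>S. ell2_coeff (f i) k)"
  by (induction S rule: infinite_finite_induct) auto

lemma ell2_eqI: "(\<And>k. ell2_coeff x k = ell2_coeff y k) \<Longrightarrow> x = y"
  by transfer auto

lemma norm_ell2_has_sum: "((\<lambda>k. (cmod (ell2_coeff x k))\<^sup>2) has_sum (norm x)\<^sup>2) UNIV"
proof (transfer)
  fix a :: "'a \<Rightarrow> complex"
  assume "(\<lambda>k. (cmod (a k))\<^sup>2) summable_on UNIV"
  then show "((\<lambda>k. (cmod (a k))\<^sup>2) has_sum (sqrt (\<Sum>\<^sub>\<infinity>k. (cmod (a k))\<^sup>2))\<^sup>2) UNIV"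
    by (simp add: infsum_nonneg)
qed

lemma cmod_ell2_coeff_le: "cmod (ell2_coeff x k) \<le> norm x"
proof -
  have "(\<Sum>k\<in>{k}. (cmod (ell2_coeff x k))\<^sup>2) \<le> (norm x)\<^sup>2"
    by (rule finite_sum_le_has_sum[OF norm_ell2_has_sum]) auto
  then show ?thesis by (simp add: power2_le_iff_abs_le)
qed

lemma bounded_functional_ell2_coeff: "bounded_functional (\<lambda>x. ell2_coeff x k)"
  unfolding bounded_functional_def
proof
  show "bounded_linear (\<lambda>x. ell2_coeff x k)"
    by (rule bounded_linear_intro[where K = 1])
      (simp_all add: scaleR_scaleC cmod_ell2_coeff_le scaleR_conv_of_real)
qed simp

text \<open>The squared distance of \<open>x\<close> to its truncation on \<open>S\<close> is the remainder of the convergent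
series for \<open>(norm x)\<^sup>2\<close>.\<close>

lemma ell2_expansion:
  "((\<lambda>S. \<Sum>k\<in>S. scaleC (ell2_coeff x k) (ell2_unit k)) \<longlongrightarrow> x) (finite_subsets_at_top UNIV)"
proof -
  let ?p = "\<lambda>S. \<Sum>k\<in>S. scaleC (ell2_coeff x k) (ell2_unit k)"
  let ?s = "\<lambda>S. \<Sum>k\<in>S. (cmod (ell2_coeff x k))\<^sup>2"
  have eq: "norm (?p S - x) = sqrt ((norm x)\<^sup>2 - ?s S)" if "finite S" for S
  proof -
    have "((\<lambda>k. (cmod (ell2_coeff x k))\<^sup>2) has_sum ((norm x)\<^sup>2 - ?s S)) (UNIV - S)"
      using that by (intro has_sum_Diff norm_ell2_has_sum has_sum_finite) auto
    then have "((\<lambda>k. (cmod (ell2_coeff (?p S - x) k))\<^sup>2) has_sum ((norm x)\<^sup>2 - ?s S)) UNIV"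
      by (subst has_sum_cong_neutral[where T = "UNIV - S"
            and g = "\<lambda>k. (cmod (ell2_coeff x k))\<^sup>2"]) 
        (use that in \<open>auto simp: if_distrib cong: if_cong\<close>)
    with norm_ell2_has_sum[of "?p S - x"] have "(norm (?p S - x))\<^sup>2 = (norm x)\<^sup>2 - ?s S"
      by (rule has_sum_unique)
    then show ?thesis by (metis norm_ge_zero real_sqrt_unique)
  qed
  have "(?s \<longlongrightarrow> (norm x)\<^sup>2) (finite_subsets_at_top UNIV)"
    using norm_ell2_has_sum by (simp add: has_sum_def)
  then have "((\<lambda>S. sqrt ((norm x)\<^sup>2 - ?s S)) \<longlongrightarrow> sqrt ((norm x)\<^sup>2 - (norm x)\<^sup>2)) (finite_subsets_at_top UNIV)"
    by (intro tendsto_intros)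
  then have "((\<lambda>S. norm (?p S - x)) \<longlongrightarrow> 0) (finite_subsets_at_top UNIV)"
    by (rule Lim_transform_eventually[THEN tendsto_eq_rhs])
      (auto simp: eq intro!: eventually_finite_subsets_at_top_weakI)
  then show ?thesis by (simp add: tendsto_norm_zero_iff LIM_zero_iff)
qed

lemma ell2_matrix_expansion:
  assumes "A \<in> bounded_ops"
  shows "((\<lambda>S. \<Sum>k\<in>S. ell2_matrix A j k * ell2_coeff x k) \<longlongrightarrow> ell2_coeff (A x) j)
    (finite_subsets_at_top UNIV)"
proof -
  note f = bounded_functional_comp[OF bounded_functional_ell2_coeff[of j] assms]
  show ?thesis
    using bounded_linear.tendsto[OF bounded_functionalD(1)[OF f] ell2_expansion[of x]]
    by (simp add: bounded_opsD[OF assms] ell2_matrix_def mult.commute)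
qed

lemma D2_norm_sum_le:
  assumes "A \<in> D2" "finite J" "finite K"
  shows "(\<Sum>j\<in>J. \<Sum>k\<in>K. cmod (ell2_matrix A j k)) \<le> D2_norm A"
proof -
  have "sum (\<lambda>(j, k). cmod (ell2_matrix A j k)) (J \<times> K) \<le> D2_norm A"
    unfolding D2_norm_def using assms by (intro finite_sum_le_infsum) (auto simp: D2_def)
  then show ?thesis by (simp add: sum.cartesian_product)
qed

text \<open>Estimates are made on finite blocks only; this passes them to the infinite matrix.\<close>

lemma D2_normI:
  assumes "A \<in> bounded_ops"
    and le: "\<And>J K. finite J \<Longrightarrow> finite K \<Longrightarrow> (\<Sum>j\<in>J. \<Sum>k\<in>K. cmod (ell2_matrix A j k)) \<le> C"
  shows "A \<in> D2" "D2_norm A \<le> C"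
proof -
  let ?f = "\<lambda>(j, k). cmod (ell2_matrix A j k)"
  have bound: "sum ?f P \<le> C" if "finite P" for P
  proof -
    have "sum ?f P \<le> sum ?f (fst ` P \<times> snd ` P)"
      using that by (intro sum_mono2) (force simp: split: prod.splits)+
    also have "\<dots> \<le> C" using le[of "fst ` P" "snd ` P"] that by (simp add: sum.cartesian_product)
    finally show ?thesis .
  qed
  have "?f summable_on UNIV"
    by (rule nonneg_bounded_partial_sums_imp_summable_on[where C = C])
      (auto intro!: eventually_finite_subsets_at_top_weakI bound)
  then show "A \<in> D2" "D2_norm A \<le> C"
    using assms(1) bound by (auto simp: D2_def D2_norm_def intro!: infsum_le_finite_sums)
qed

lemma D2_norm_nonneg: "0 \<le> D2_norm A"
  unfolding D2_norm_def by (rule infsum_nonneg) auto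

lemma D2_bounded: "A \<in> D2 \<Longrightarrow> A \<in> bounded_ops"
  by (simp add: D2_def)

text \<open>The coefficients of \<open>x\<close> are bounded by \<open>norm x\<close>, so the sum of \<open>\<bar>a\<^sub>j\<^sub>k x\<^sub>k\<bar>\<close> is at most the sum of
\<open>\<bar>a\<^sub>j\<^sub>k\<bar>\<close> times \<open>norm x\<close>.\<close>

lemma D2_maps_to_l1:
  assumes A: "A \<in> D2" and J: "finite J"
  shows "(\<Sum>j\<in>J. cmod (ell2_coeff (A x) j)) \<le> D2_norm A * norm x"
proof (rule tendsto_upperbound)
  show "((\<lambda>S. \<Sum>j\<in>J. cmod (\<Sum>k\<in>S. ell2_matrix A j k * ell2_coeff x k)) \<longlongrightarrow>
      (\<Sum>j\<in>J. cmod (ell2_coeff (A x) j))) (finite_subsets_at_top UNIV)"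
    by (intro tendsto_sum tendsto_norm ell2_matrix_expansion D2_bounded A)
  show "\<forall>\<^sub>F S in finite_subsets_at_top UNIV.
      (\<Sum>j\<in>J. cmod (\<Sum>k\<in>S. ell2_matrix A j k * ell2_coeff x k)) \<le> D2_norm A * norm x"
  proof (rule eventually_finite_subsets_at_top_weakI)
    fix S :: "'a set" assume "finite S"
    have "(\<Sum>j\<in>J. cmod (\<Sum>k\<in>S. ell2_matrix A j k * ell2_coeff x k))
        \<le> (\<Sum>j\<in>J. \<Sum>k\<in>S. cmod (ell2_matrix A j k) * norm x)"
      by (intro sum_mono order_trans[OF norm_sum])
        (simp add: norm_mult mult_left_mono cmod_ell2_coeff_le)
    also have "\<dots> = (\<Sum>j\<in>J. \<Sum>k\<in>S. cmod (ell2_matrix A j k)) * norm x"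
      by (simp add: sum_distrib_right)
    also have "\<dots> \<le> D2_norm A * norm x"
      by (intro mult_right_mono D2_norm_sum_le A J \<open>finite S\<close>) simp
    finally show "(\<Sum>j\<in>J. cmod (\<Sum>k\<in>S. ell2_matrix A j k * ell2_coeff x k)) \<le> D2_norm A * norm x" .
  qed
qed simp

lemma ell2_matrix_simps [simp]:
  "ell2_matrix (\<lambda>x. 0) j k = 0"
  "ell2_matrix (\<lambda>x. A x + B x) j k = ell2_matrix A j k + ell2_matrix B j k"
  "ell2_matrix (\<lambda>x. A x - B x) j k = ell2_matrix A j k - ell2_matrix B j k"
  "ell2_matrix (\<lambda>x. scaleC c (A x)) j k = c * ell2_matrix A j k"
  by (simp_all add: ell2_matrix_def)

lemma ell2_matrix_inject:
  assumes "A \<in> bounded_ops" "B \<in> bounded_ops" "\<And>j k. ell2_matrix A j k = ell2_matrix B j k"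
  shows "A = B"
proof (intro ext ell2_eqI)
  fix x j
  show "ell2_coeff (A x) j = ell2_coeff (B x) j"
    using tendsto_unique[OF _ ell2_matrix_expansion[OF assms(1)] ell2_matrix_expansion[OF assms(2), of j x,
          folded assms(3)]] by simp
qed

lemma D2_zero: "(\<lambda>x. 0) \<in> D2" "D2_norm (\<lambda>x. 0) = 0"
  by (simp_all add: D2_def D2_norm_def bounded_ops_zero case_prod_unfold)

lemma D2_add:
  assumes "A \<in> D2" "B \<in> D2"
  shows "(\<lambda>x. A x + B x) \<in> D2" "D2_norm (\<lambda>x. A x + B x) \<le> D2_norm A + D2_norm B"
proof -
  have "(\<Sum>j\<in>J. \<Sum>k\<in>K. cmod (ell2_matrix (\<lambda>x. A x + B x) j k)) \<le> D2_norm A + D2_norm B"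
    if "finite J" "finite K" for J K
  proof -
    have "(\<Sum>j\<in>J. \<Sum>k\<in>K. cmod (ell2_matrix (\<lambda>x. A x + B x) j k))
        \<le> (\<Sum>j\<in>J. \<Sum>k\<in>K. cmod (ell2_matrix A j k) + cmod (ell2_matrix B j k))"
      by (intro sum_mono) (simp add: norm_triangle_ineq)
    also have "\<dots> = (\<Sum>j\<in>J. \<Sum>k\<in>K. cmod (ell2_matrix A j k)) + (\<Sum>j\<in>J. \<Sum>k\<in>K. cmod (ell2_matrix B j k))"
      by (simp add: sum.distrib)
    also have "\<dots> \<le> D2_norm A + D2_norm B"
      by (intro add_mono D2_norm_sum_le assms that)
    finally show ?thesis .
  qed
  note D2_normI[OF bounded_ops_add[OF assms[THEN D2_bounded]] this]
  then show "(\<lambda>x. A x + B x) \<in> D2" "D2_norm (\<lambda>x. A x + B x) \<le> D2_norm A + D2_norm B"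
    by simp_all
qed

lemma D2_scaleC:
  assumes "A \<in> D2"
  shows "(\<lambda>x. scaleC c (A x)) \<in> D2" "D2_norm (\<lambda>x. scaleC c (A x)) = cmod c * D2_norm A"
proof -
  have eq: "(\<lambda>(j, k). cmod (ell2_matrix (\<lambda>x. scaleC c (A x)) j k)) =
      (\<lambda>p. cmod c * (case p of (j, k) \<Rightarrow> cmod (ell2_matrix A j k)))"
    by (auto simp: norm_mult)
  have "(\<lambda>p. cmod c * (case p of (j, k) \<Rightarrow> cmod (ell2_matrix A j k))) summable_on UNIV"
    using assms by (intro summable_on_cmult_right) (simp add: D2_def)
  then show "(\<lambda>x. scaleC c (A x)) \<in> D2"
    using assms by (simp add: D2_def bounded_ops_scaleC flip: eq)
  show "D2_norm (\<lambda>x. scaleC c (A x)) = cmod c * D2_norm A"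
    unfolding D2_norm_def eq by (rule infsum_cmult_right')
qed

lemma D2_diff:
  assumes "A \<in> D2" "B \<in> D2"
  shows "(\<lambda>x. A x - B x) \<in> D2"
  using D2_add(1)[OF assms(1) D2_scaleC(1)[OF assms(2), of "-1"]]
  by (simp add: complex_vector.scale_minus_left scaleC_one)

lemma D2_norm_eq_0:
  assumes "A \<in> D2" "D2_norm A = 0"
  shows "A = (\<lambda>x. 0)"
proof (rule ell2_matrix_inject)
  fix j k
  have "cmod (ell2_matrix A j k) \<le> 0"
    using D2_norm_sum_le[OF assms(1), of "{j}" "{k}"] assms(2) by simp
  then show "ell2_matrix A j k = ell2_matrix (\<lambda>x. 0) j k" by simp
qed (use assms D2_bounded bounded_ops_zero in auto)

text \<open>The matrix of the composition is the product of the matrices, and for a fixed intermediate index \<open>l\<close>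
the block sum factors into the \<open>l\<close>-th column sum of \<open>A\<close> and the \<open>l\<close>-th row sum of \<open>B\<close>. A sum
of products of nonnegative numbers is at most the product of the sums.\<close>

lemma D2_comp:
  assumes A: "A \<in> D2" and B: "B \<in> D2"
  shows "A \<circ> B \<in> D2" "D2_norm (A \<circ> B) \<le> D2_norm A * D2_norm B"
proof -
  let ?a = "ell2_matrix A" and ?b = "ell2_matrix B"
  have "(\<Sum>j\<in>J. \<Sum>k\<in>K. cmod (ell2_matrix (A \<circ> B) j k)) \<le> D2_norm A * D2_norm B"
    if J: "finite J" and K: "finite K" for J K
  proof (rule tendsto_upperbound)
    have "ell2_matrix (A \<circ> B) j k = ell2_coeff (A (B (ell2_unit k))) j" for j k
      by (simp add: ell2_matrix_def)
    then show "((\<lambda>L. \<Sum>j\<in>J. \<Sum>k\<in>K. cmod (\<Sum>l\<in>L. ?a j l * ?b l k)) \<longlongrightarrow>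
        (\<Sum>j\<in>J. \<Sum>k\<in>K. cmod (ell2_matrix (A \<circ> B) j k))) (finite_subsets_at_top UNIV)"
      using ell2_matrix_expansion[OF D2_bounded[OF A]]
      by (intro tendsto_sum tendsto_norm) (auto simp: ell2_matrix_def)
    show "\<forall>\<^sub>F L in finite_subsets_at_top UNIV.
        (\<Sum>j\<in>J. \<Sum>k\<in>K. cmod (\<Sum>l\<in>L. ?a j l * ?b l k)) \<le> D2_norm A * D2_norm B"
    proof (rule eventually_finite_subsets_at_top_weakI)
      fix L :: "'a set" assume L: "finite L"
      let ?x = "\<lambda>l. \<Sum>j\<in>J. cmod (?a j l)" and ?y = "\<lambda>l. \<Sum>k\<in>K. cmod (?b l k)"
      have "(\<Sum>j\<in>J. \<Sum>k\<in>K. cmod (\<Sum>l\<in>L. ?a j l * ?b l k))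
          \<le> (\<Sum>j\<in>J. \<Sum>k\<in>K. \<Sum>l\<in>L. cmod (?a j l) * cmod (?b l k))"
        by (intro sum_mono order_trans[OF norm_sum]) (simp add: norm_mult)
      also have "\<dots> = (\<Sum>j\<in>J. \<Sum>l\<in>L. \<Sum>k\<in>K. cmod (?a j l) * cmod (?b l k))"
        by (intro sum.cong refl sum.swap)
      also have "\<dots> = (\<Sum>l\<in>L. \<Sum>j\<in>J. \<Sum>k\<in>K. cmod (?a j l) * cmod (?b l k))"
        by (rule sum.swap)
      also have "\<dots> = (\<Sum>l\<in>L. ?x l * ?y l)"
        by (simp add: sum_product)
      also have "\<dots> \<le> (\<Sum>l\<in>L. ?x l * (\<Sum>l\<in>L. ?y l))"
        using L by (intro sum_mono mult_left_mono member_le_sum sum_nonneg) auto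
      also have "\<dots> = (\<Sum>l\<in>L. ?x l) * (\<Sum>l\<in>L. ?y l)"
        by (simp add: sum_distrib_right)
      also have "\<dots> = (\<Sum>j\<in>J. \<Sum>l\<in>L. cmod (?a j l)) * (\<Sum>l\<in>L. ?y l)"
        by (subst sum.swap) simp
      also have "\<dots> \<le> D2_norm A * D2_norm B"
        by (intro mult_mono D2_norm_sum_le A B J K L D2_norm_nonneg sum_nonneg) auto
      finally show "(\<Sum>j\<in>J. \<Sum>k\<in>K. cmod (\<Sum>l\<in>L. ?a j l * ?b l k)) \<le> D2_norm A * D2_norm B" .
    qed
  qed simp
  note D2_normI[OF bounded_ops_comp[OF A[THEN D2_bounded] B[THEN D2_bounded]] this]
  then show "A \<circ> B \<in> D2" "D2_norm (A \<circ> B) \<le> D2_norm A * D2_norm B"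
    by simp_all
qed

definition ell2_truncation :: "'i set \<Rightarrow> ('i ell2 \<Rightarrow> 'i ell2) \<Rightarrow> 'i ell2 \<Rightarrow> 'i ell2" where
  "ell2_truncation S A x =
     (\<Sum>j\<in>S. \<Sum>k\<in>S. scaleC (ell2_matrix A j k * ell2_coeff x k) (ell2_unit j))"

lemma ell2_truncation_finite_rank:
  assumes "finite S"
  shows "ell2_truncation S A \<in> finite_rank_ops"
proof -
  have "ell2_truncation S A \<in> bounded_ops"
    unfolding ell2_truncation_def[abs_def]
    by (intro bounded_ops_sum bounded_ops_rank_one bounded_functional_const_mult
        bounded_functional_ell2_coeff)
  moreover have "range (ell2_truncation S A) \<subseteq> complex_vector.span (ell2_unit ` S)"
    unfolding image_subset_iff ell2_truncation_def
    by (intro ballI complex_vector.span_sum complex_vector.span_scale complex_vector.span_base imageI)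
  ultimately show ?thesis
    using assms by (auto simp: finite_rank_ops_def)
qed

lemma ell2_matrix_truncation:
  assumes "finite S"
  shows "ell2_matrix (ell2_truncation S A) j k = (if j \<in> S \<and> k \<in> S then ell2_matrix A j k else 0)"
proof -
  have "ell2_matrix (ell2_truncation S A) j k =
      (\<Sum>j'\<in>S. \<Sum>k'\<in>S. if j' = j \<and> k' = k then ell2_matrix A j' k' else 0)"
    unfolding ell2_matrix_def[of "ell2_truncation S A"] ell2_truncation_def ell2_coeff_sum
    by (intro sum.cong refl) auto
  also have "\<dots> = (\<Sum>j'\<in>S. if j' = j then \<Sum>k'\<in>S. if k' = k then ell2_matrix A j' k' else 0 else 0)"
    by (intro sum.cong refl) auto
  also have "\<dots> = (if j \<in> S \<and> k \<in> S then ell2_matrix A j k else 0)"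
    using assms by simp
  finally show ?thesis .
qed

lemma ell2_truncation_in_D2:
  assumes "finite S"
  shows "ell2_truncation S A \<in> D2"
proof -
  have "(\<lambda>(j, k). cmod (ell2_matrix (ell2_truncation S A) j k)) summable_on S \<times> S"
    using assms by (intro summable_on_finite) auto
  then have "(\<lambda>(j, k). cmod (ell2_matrix (ell2_truncation S A) j k)) summable_on UNIV"
    by (rule summable_on_cong_neutral[THEN iffD1, rotated -1])
      (auto simp: ell2_matrix_truncation[OF assms] split: if_splits)
  then show ?thesis
    using ell2_truncation_finite_rank[OF assms] by (auto simp: D2_def finite_rank_ops_def)
qed

text \<open>A finite part \<open>P\<close> of the index set of the matrix carries almost the whole norm, and \<open>P\<close> is contained in
a square \<open>S \<times> S\<close>.\<close>

lemma ell2_truncation_approximates: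
  assumes A: "A \<in> D2" and "\<epsilon> > 0"
  obtains S where "finite S" "D2_norm (\<lambda>x. A x - ell2_truncation S A x) < \<epsilon>"
proof -
  let ?f = "\<lambda>(j, k). cmod (ell2_matrix A j k)"
  have "?f summable_on UNIV" using A by (simp add: D2_def)
  from infsum_finite_approximation[OF this, of "\<epsilon> / 2"] \<open>\<epsilon> > 0\<close>
  obtain P where P: "finite P" "dist (sum ?f P) (D2_norm A) \<le> \<epsilon> / 2"
    by (auto simp: D2_norm_def)
  define S where "S = fst ` P \<union> snd ` P"
  have S: "finite S" using P by (simp add: S_def)
  have "sum ?f P \<le> sum ?f (S \<times> S)"
    using S by (intro sum_mono2) (force simp: S_def split: prod.splits)+
  then have PS: "D2_norm A - \<epsilon> / 2 \<le> sum ?f (S \<times> S)"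
    using P(2) by (auto simp: dist_real_def abs_if split: if_splits)
  let ?R = "\<lambda>x. A x - ell2_truncation S A x"
  have R: "?R \<in> D2" using A ell2_truncation_in_D2[OF S] by (rule D2_diff)
  have "D2_norm ?R \<le> \<epsilon> / 2"
  proof (rule D2_normI(2)[OF D2_bounded[OF R]])
    fix J K :: "'a set" assume "finite J" "finite K"
    have "(\<Sum>j\<in>J. \<Sum>k\<in>K. cmod (ell2_matrix ?R j k)) =
        sum (\<lambda>(j, k). cmod (ell2_matrix ?R j k)) (J \<times> K)"
      by (rule sum.cartesian_product)
    also have "\<dots> = sum ?f (J \<times> K - S \<times> S)"
      using \<open>finite J\<close> \<open>finite K\<close>
      by (intro sum.mono_neutral_cong_right) (auto simp: ell2_matrix_truncation[OF S] split: if_splits)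
    also have "\<dots> = sum ?f (J \<times> K \<union> S \<times> S) - sum ?f (S \<times> S)"
      using \<open>finite J\<close> \<open>finite K\<close> S
      by (subst sum_diff[symmetric]) (auto intro!: sum.cong)
    also have "\<dots> \<le> sum ?f ((J \<union> S) \<times> (K \<union> S)) - sum ?f (S \<times> S)"
      using \<open>finite J\<close> \<open>finite K\<close> S by (intro diff_right_mono sum_mono2) auto
    also have "\<dots> \<le> D2_norm A - sum ?f (S \<times> S)"
      using D2_norm_sum_le[OF A, of "J \<union> S" "K \<union> S"] \<open>finite J\<close> \<open>finite K\<close> S
      by (simp add: sum.cartesian_product)
    also have "\<dots> \<le> \<epsilon> / 2" using PS by simp
    finally show "(\<Sum>j\<in>J. \<Sum>k\<in>K. cmod (ell2_matrix ?R j k)) \<le> \<epsilon> / 2" .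
  qed
  then show ?thesis using that[OF S] \<open>\<epsilon> > 0\<close> by simp
qed

lemma approximable_D2: "approximable D2 D2_norm"
  unfolding approximable_def
  by (metis ell2_truncation_approximates ell2_truncation_finite_rank ell2_truncation_in_D2 IntI)

lemma operator_subalgebra_D2: "operator_subalgebra D2"
  unfolding operator_subalgebra_def using D2_zero D2_add(1) D2_scaleC(1) D2_comp(1) D2_bounded by blast

lemma D2_norm_minus_commute: "D2_norm (\<lambda>x. A x - B x) = D2_norm (\<lambda>x. B x - A x)"
  unfolding D2_norm_def by (simp add: norm_minus_commute)

lemma filterlim_image_finite_subsets_at_top:
  fixes h :: "nat \<Rightarrow> 'i"
  assumes "bij h"
  shows "filterlim (\<lambda>n. h ` {..<n}) (finite_subsets_at_top UNIV) sequentially"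
  unfolding filterlim_finite_subsets_at_top
proof (intro allI impI)
  fix X :: "'i set" assume "finite X \<and> X \<subseteq> UNIV"
  then have "finite (h -` X)" using assms by (simp add: bij_is_inj finite_vimageI)
  then obtain n where n: "h -` X \<subseteq> {..<n}" unfolding finite_nat_set_iff_bounded by blast
  have "X \<subseteq> h ` {..<m}" if "m \<ge> n" for m
  proof
    fix y assume y: "y \<in> X"
    obtain i where "y = h i" using assms by (metis bij_pointE)
    with y n that show "y \<in> h ` {..<m}" by auto
  qed
  then show "\<forall>\<^sub>F m in sequentially. finite (h ` {..<m}) \<and> X \<subseteq> h ` {..<m} \<and> h ` {..<m} \<subseteq> UNIV"
    by (auto simp: eventually_sequentially)
qed

text \<open>Unconditional expansions over a countably infinite index set become expansions along a sequence,
so that sections are matrices indexed by natural numbers.\<close>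

lemma coordinate_system_reindex:
  fixes h :: "nat \<Rightarrow> 'i" and e :: "'i \<Rightarrow> 'e::complex_normed_vector"
  assumes h: "bij h" and u: "\<And>k. bounded_functional (u k)"
    and ex: "\<And>x. ((\<lambda>S. \<Sum>k\<in>S. scaleC (u k x) (e k)) \<longlongrightarrow> x) (finite_subsets_at_top UNIV)"
  shows "coordinate_system (\<lambda>n. e (h n)) (\<lambda>n. u (h n))"
proof
  fix x
  have "(\<lambda>n. \<Sum>k\<in>h ` {..<n}. scaleC (u k x) (e k)) \<longlonglongrightarrow> x"
    by (rule filterlim_compose[OF ex filterlim_image_finite_subsets_at_top[OF h]])
  also have "(\<lambda>n. \<Sum>k\<in>h ` {..<n}. scaleC (u k x) (e k)) = (\<lambda>n. \<Sum>k<n. scaleC (u (h k) x) (e (h k)))"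
    using h by (subst sum.reindex) (auto intro: inj_on_subset bij_is_inj)
  finally show "(\<lambda>n. \<Sum>k<n. scaleC (u (h k) x) (e (h k))) \<longlonglongrightarrow> x" .
qed (rule u)

definition matrix_section_trace :: "(nat \<Rightarrow> 'i) \<Rightarrow> ('i ell2 \<Rightarrow> 'i ell2) \<Rightarrow> nat \<Rightarrow> complex" where
  "matrix_section_trace h A n = (\<Sum>k<n. ell2_matrix A (h k) (h k))"

definition matrix_section_det :: "(nat \<Rightarrow> 'i) \<Rightarrow> ('i ell2 \<Rightarrow> 'i ell2) \<Rightarrow> nat \<Rightarrow> complex" where
  "matrix_section_det h A n =
     Determinant.det (1\<^sub>m n + Matrix.mat n n (\<lambda>(i, j). ell2_matrix A (h i) (h j)))"

lemma D2_norm_section_le: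
  fixes h :: "nat \<Rightarrow> 'i"
  assumes "bij h" "A \<in> D2"
  shows "(\<Sum>i<n. \<Sum>j<n. cmod (ell2_matrix A (h i) (h j))) \<le> D2_norm A"
proof -
  have inj: "inj_on h {..<n}" using assms(1) by (auto intro: inj_on_subset bij_is_inj)
  show ?thesis
    using D2_norm_sum_le[OF assms(2), of "h ` {..<n}" "h ` {..<n}"]
    by (simp add: sum.reindex[OF inj])
qed

lemma D2_trace_limit:
  fixes h :: "nat \<Rightarrow> 'i"
  assumes h: "bij h"
  shows "A \<in> D2 \<Longrightarrow> matrix_section_trace h A \<longlonglongrightarrow> D2_trace A"
    and "continuous_extension D2 D2_norm finite_rank_trace (D2_trace :: ('i ell2 \<Rightarrow> 'i ell2) \<Rightarrow> complex)"
proof -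
  interpret coordinate_system "\<lambda>n. ell2_unit (h n)" "\<lambda>n x. ell2_coeff x (h n)"
    by (rule coordinate_system_reindex[OF h bounded_functional_ell2_coeff ell2_expansion])
  have lim: "matrix_section_trace h F \<longlonglongrightarrow> finite_rank_trace F" if "F \<in> finite_rank_ops \<inter> D2" for F
    using finite_rank_trace_limit[of F] that
    by (simp add: matrix_section_trace_def[abs_def] section_trace_def[abs_def] ell2_matrix_def)
  have equi: "\<exists>\<delta>>0. \<forall>B\<in>D2. D2_norm (\<lambda>x. B x - A x) < \<delta> \<longrightarrow>
      (\<forall>n. cmod (matrix_section_trace h B n - matrix_section_trace h A n) \<le> \<epsilon>)"
    if A: "A \<in> D2" and "\<epsilon> > 0" for A :: "'i ell2 \<Rightarrow> 'i ell2" and \<epsilon> :: real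
  proof -
    have "cmod (matrix_section_trace h B n - matrix_section_trace h A n) \<le> D2_norm (\<lambda>x. B x - A x)"
      if B: "B \<in> D2" for B n
    proof -
      have "cmod (matrix_section_trace h B n - matrix_section_trace h A n) \<le>
          (\<Sum>i<n. cmod (ell2_matrix (\<lambda>x. B x - A x) (h i) (h i)))"
        by (simp add: matrix_section_trace_def norm_sum flip: sum_subtractf)
      also have "\<dots> \<le> (\<Sum>i<n. \<Sum>j<n. cmod (ell2_matrix (\<lambda>x. B x - A x) (h i) (h j)))"
        by (intro sum_mono member_le_sum) auto
      also have "\<dots> \<le> D2_norm (\<lambda>x. B x - A x)"
        by (rule D2_norm_section_le[OF h D2_diff[OF B A]])
      finally show ?thesis .
    qed
    then show "\<exists>\<delta>>0. \<forall>B\<in>D2. D2_norm (\<lambda>x. B x - A x) < \<delta> \<longrightarrow>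
        (\<forall>n. cmod (matrix_section_trace h B n - matrix_section_trace h A n) \<le> \<epsilon>)"
      using \<open>\<epsilon> > 0\<close> by (intro exI[of _ \<epsilon>]) (meson less_imp_le order_trans)
  qed
  note ext = section_functional_extension[OF approximable_D2 D2_norm_minus_commute lim equi]
  show "A \<in> D2 \<Longrightarrow> matrix_section_trace h A \<longlonglongrightarrow> D2_trace A"
    unfolding D2_trace_def by (rule ext(1))
  show "continuous_extension D2 D2_norm finite_rank_trace (D2_trace :: ('i ell2 \<Rightarrow> 'i ell2) \<Rightarrow> complex)"
    unfolding D2_trace_def[abs_def] by (rule ext(2))
qed

text \<open>The perturbation bound makes the section determinants equicontinuous at \<open>A\<close>, with a modulus that
depends on \<open>D2_norm A\<close> only.\<close>

lemma D2_det_limit: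
  fixes h :: "nat \<Rightarrow> 'i"
  assumes h: "bij h"
  shows "A \<in> D2 \<Longrightarrow> matrix_section_det h A \<longlonglongrightarrow> D2_det A"
    and "continuous_extension D2 D2_norm finite_rank_det (D2_det :: ('i ell2 \<Rightarrow> 'i ell2) \<Rightarrow> complex)"
proof -
  interpret coordinate_system "\<lambda>n. ell2_unit (h n)" "\<lambda>n x. ell2_coeff x (h n)"
    by (rule coordinate_system_reindex[OF h bounded_functional_ell2_coeff ell2_expansion])
  have lim: "matrix_section_det h F \<longlonglongrightarrow> finite_rank_det F" if "F \<in> finite_rank_ops \<inter> D2" for F
    using finite_rank_det_limit[of F] that
    by (simp add: matrix_section_det_def[abs_def] section_det_def[abs_def] ell2_matrix_def)
  have equi: "\<exists>\<delta>>0. \<forall>B\<in>D2. D2_norm (\<lambda>x. B x - A x) < \<delta> \<longrightarrow>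
      (\<forall>n. cmod (matrix_section_det h B n - matrix_section_det h A n) \<le> \<epsilon>)"
    if A: "A \<in> D2" and "\<epsilon> > 0" for A :: "'i ell2 \<Rightarrow> 'i ell2" and \<epsilon> :: real
  proof -
    let ?N = "\<lambda>B. D2_norm (\<lambda>x. B x - A x)"
    have le: "cmod (matrix_section_det h B n - matrix_section_det h A n) \<le>
        exp (D2_norm A) * (exp (?N B) - 1)" if B: "B \<in> D2" for B n
    proof -
      have "cmod (matrix_section_det h B n - matrix_section_det h A n) \<le>
          exp (\<Sum>i<n. \<Sum>j<n. cmod (ell2_matrix A (h i) (h j))) *
          (exp (\<Sum>i<n. \<Sum>j<n. cmod (ell2_matrix (\<lambda>x. B x - A x) (h i) (h j))) - 1)"
        unfolding matrix_section_det_def ell2_matrix_simps by (rule norm_det_one_plus_diff_le)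
      also have "\<dots> \<le> exp (D2_norm A) * (exp (?N B) - 1)"
        using D2_norm_section_le[OF h A, of n] D2_norm_section_le[OF h D2_diff[OF B A], of n]
        by (intro mult_mono diff_right_mono) (auto intro!: sum_nonneg)
      finally show ?thesis .
    qed
    (* the solution of exp (D2_norm A) * (exp \<delta> - 1) = \<epsilon> *)
  define \<delta> where "\<delta> = ln (1 + \<epsilon> / exp (D2_norm A))"
    have "\<delta> > 0" using \<open>\<epsilon> > 0\<close> unfolding \<delta>_def by (intro ln_gt_zero) simp
    moreover have "exp (D2_norm A) * (exp t - 1) \<le> \<epsilon>" if "t < \<delta>" for t
    proof -
      have "exp t \<le> exp \<delta>" using that by simp
      also have "exp \<delta> = 1 + \<epsilon> / exp (D2_norm A)"
        using \<open>\<epsilon> > 0\<close> by (simp add: \<delta>_def add_pos_pos)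
      finally show ?thesis by (simp add: field_simps)
    qed
    ultimately show "\<exists>\<delta>>0. \<forall>B\<in>D2. D2_norm (\<lambda>x. B x - A x) < \<delta> \<longrightarrow>
        (\<forall>n. cmod (matrix_section_det h B n - matrix_section_det h A n) \<le> \<epsilon>)"
      using le by (intro exI[of _ \<delta>]) (meson order_trans)
  qed
  note ext = section_functional_extension[OF approximable_D2 D2_norm_minus_commute lim equi]
  show "A \<in> D2 \<Longrightarrow> matrix_section_det h A \<longlonglongrightarrow> D2_det A"
    unfolding D2_det_def by (rule ext(1))
  show "continuous_extension D2 D2_norm finite_rank_det (D2_det :: ('i ell2 \<Rightarrow> 'i ell2) \<Rightarrow> complex)"
    unfolding D2_det_def[abs_def] by (rule ext(2))
qed

section \<open>Orthonormality of the characters and the topology of the torus\<close>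

lemma integral_lborel_prod:
  fixes f :: "'a::euclidean_space \<Rightarrow> real \<Rightarrow> complex"
  assumes int: "\<And>b. b \<in> Basis \<Longrightarrow> integrable lborel (f b)"
  shows "(LINT x|lborel. (\<Prod>b\<in>Basis. f b (x \<bullet> b))) = (\<Prod>b\<in>Basis. LINT t|lborel. f b t)"
proof -
  interpret product_sigma_finite "\<lambda>_::'a. lborel :: real measure" ..
  have [measurable]: "f b \<in> borel_measurable borel" if "b \<in> Basis" for b
    using int[OF that] by auto
  have "(LINT x|lborel. (\<Prod>b\<in>Basis. f b (x \<bullet> b))) =
      (LINT x|(\<Pi>\<^sub>M b\<in>(Basis::'a set). lborel). (\<Prod>b\<in>Basis. f b ((\<Sum>b'\<in>Basis. x b' *\<^sub>R b') \<bullet> b)))"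
    by (subst lborel_eq, subst integral_distr) measurable
  also have "\<dots> = (LINT x|(\<Pi>\<^sub>M b\<in>(Basis::'a set). lborel). (\<Prod>b\<in>Basis. f b (x b)))"
    by (intro Bochner_Integration.integral_cong prod.cong) simp_all
  also have "\<dots> = (\<Prod>b\<in>Basis. LINT t|lborel. f b t)"
    by (rule product_integral_prod) (use int in auto)
  finally show ?thesis .
qed

lemma integral_exp_unit_interval:
  fixes m :: real
  assumes "m \<in> \<int>" "m \<noteq> 0"
  shows "(LINT t|lborel. indicator {0..<1} t *\<^sub>R exp (- 2 * complex_of_real pi * \<i> * of_real (t * m))) = 0"
proof -
  define c where "c = - 2 * complex_of_real pi * \<i> * of_real m"
  have c: "c \<noteq> 0" using assms(2) by (simp add: c_def)
  have e1: "exp c = 1"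
  proof -
    obtain j where "m = of_int j" using assms(1) by (auto elim: Ints_cases)
    then show ?thesis unfolding exp_eq_1 c_def by (auto intro!: exI[of _ "- j"])
  qed
  have "(LINT t|lborel. indicator {0..<1} t *\<^sub>R exp (- 2 * complex_of_real pi * \<i> * of_real (t * m))) =
      (LINT t|lborel. indicator {0..1} t *\<^sub>R exp (c * of_real t))"
    by (intro integral_cong_AE, measurable, measurable)
      (use AE_lborel_singleton[of "1::real"] in eventually_elim, auto simp: c_def indicator_def mult_ac)
  also have "\<dots> = exp (c * of_real 1) / c - exp (c * of_real 0) / c"
  proof (rule integral_FTC_atLeastAtMost)
    show "((\<lambda>t. exp (c * of_real t) / c) has_vector_derivative exp (c * of_real x)) (at x within {0..1})"
      for x
    proof -
      have "((\<lambda>z. exp (c * z) / c) has_field_derivative exp (c * of_real x)) (at (of_real x))"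
        using c by (auto intro!: derivative_eq_intros)
      then show ?thesis by (rule has_vector_derivative_real_field)
    qed
  qed (auto intro!: continuous_intros)
  finally show ?thesis using e1 by simp
qed

lemma abs_torus_measurable: "(abs_torus :: real ^ 'n \<Rightarrow> 'n::finite torus) \<in> borel_measurable borel"
  by (rule borel_measurable_continuous_onI) (simp add: continuous_on_open_vimage flip: open_torus_def)

abbreviation unit_cube :: "(real ^ 'n::finite) set" where
  "unit_cube \<equiv> {x. \<forall>i. 0 \<le> x $ i \<and> x $ i < 1}"

lemma Basis_vec_real: "(Basis :: (real ^ 'n::finite) set) = (\<lambda>i. axis i 1) ` UNIV"
  by (auto simp: Basis_vec_def)

lemma indicator_unit_cube:
  "indicator (unit_cube :: (real ^ 'n::finite) set) x =
    (\<Prod>b\<in>Basis. indicator {0..<1} (x \<bullet> b) :: 'b::comm_semiring_1)"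
proof -
  have iff: "x \<in> unit_cube \<longleftrightarrow> (\<forall>b\<in>Basis. x \<bullet> b \<in> {0..<1})"
    by (auto simp: Basis_vec_real inner_axis)
  show ?thesis
  proof (cases "x \<in> unit_cube")
    case True
    then show ?thesis
      using iff by (metis (no_types, lifting) indicator_simps(1) prod.neutral)
  next
    case False
    then obtain b where "b \<in> Basis" "x \<bullet> b \<notin> {0..<1}" using iff by blast
    then have "(\<Prod>b\<in>Basis. indicator {0..<1} (x \<bullet> b) :: 'b) = 0"
      by (intro prod_zero) (auto intro!: bexI[of _ b])
    then show ?thesis using False by simp
  qed
qed

lemma unit_cube_measurable [measurable]: "(unit_cube :: (real ^ 'n::finite) set) \<in> sets borel"
proof -
  have "unit_cube = (\<Inter>i::'n. {x. 0 \<le> x $ i} \<inter> {x. x $ i < 1})" by auto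
  also have "\<dots> \<in> sets borel"
    by (intro sets.finite_INT sets.Int borel_closed borel_open closed_Collect_le open_Collect_less
        continuous_intros) auto
  finally show ?thesis .
qed

lemma torus_integral:
  fixes f :: "'n::finite torus \<Rightarrow> complex"
  assumes "f \<in> borel_measurable borel"
  shows "(LINT x|torus_measure. f x) = (LINT x|lborel. indicator unit_cube x *\<^sub>R f (abs_torus x))"
  unfolding torus_measure_def
  using abs_torus_measurable assms
  by (subst integral_distr) (auto intro!: measurable_restrict_space1 simp: integral_restrict_space)

lemma sets_torus_measure [simp, measurable_cong]: "sets torus_measure = sets borel"
  and space_torus_measure [simp]: "space torus_measure = UNIV"
  by (simp_all add: torus_measure_def)

lemma emeasure_torus_UNIV: "emeasure (torus_measure :: 'n::finite torus measure) UNIV = 1"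
proof -
  have "emeasure (torus_measure :: 'n torus measure) (space torus_measure) =
      emeasure lborel (unit_cube :: (real ^ 'n) set)"
    unfolding torus_measure_def
    by (subst emeasure_distr)
      (auto intro!: measurable_restrict_space1 abs_torus_measurable simp: space_restrict_space emeasure_restrict_space)
  also have "\<dots> = (\<integral>\<^sup>+x. (\<Prod>b\<in>Basis. indicator {0..<1} (x \<bullet> b)) \<partial>(lborel :: (real ^ 'n) measure))"
    by (simp add: flip: indicator_unit_cube)
  also have "\<dots> = (\<Prod>b\<in>(Basis :: (real ^ 'n) set). 1)"
    by (subst nn_integral_lborel_prod) auto
  finally show ?thesis by simp
qed

interpretation torus: finite_measure "torus_measure :: 'n::finite torus measure"
  by standard (simp add: emeasure_torus_UNIV)

lemma measure_torus_UNIV [simp]: "measure (torus_measure :: 'n::finite torus measure) UNIV = 1"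
  by (simp add: measure_def emeasure_torus_UNIV)

lemma torus_character_add:
  "torus_character (k + l) x = torus_character k x * torus_character l x"
  by transfer (simp add: exp_add[symmetric] algebra_simps sum.distrib)

lemma torus_character_0 [simp]: "torus_character 0 x = 1"
  by transfer simp

lemma cnj_torus_character: "cnj (torus_character k x) = torus_character (- k) x"
  by transfer (simp add: exp_cnj sum_negf)

lemma cmod_torus_character [simp]: "cmod (torus_character k x) = 1"
  by transfer simp

text \<open>On the unit cube the character is a product of functions of one coordinate, and a coordinate in which
\<open>k\<close> does not vanish contributes a full period of an exponential.\<close>

lemma integral_torus_character:
  "(LINT x|torus_measure. torus_character k x) = (if k = 0 then 1 else 0)"
  for k :: "int ^ 'n::finite"
proof (cases "k = 0")
  case True
  then show ?thesis by simp
next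
  case False
  then obtain i where i: "k $ i \<noteq> 0" by (auto simp: Finite_Cartesian_Product.vec_eq_iff)
  define r :: "real ^ 'n" where "r = (\<chi> i. real_of_int (k $ i))"
  define f where "f = (\<lambda>(b :: real ^ 'n) t. indicator {0..<1} t *\<^sub>R
    exp (- 2 * complex_of_real pi * \<i> * of_real (t * (r \<bullet> b))))"
  have "(LINT x|torus_measure. torus_character k x) =
      (LINT x|lborel. indicator unit_cube x *\<^sub>R torus_character k (abs_torus x))"
    using torus_character_measurable[of k] by (intro torus_integral) simp
  also have "\<dots> = (LINT x|lborel. (\<Prod>b\<in>Basis. f b (x \<bullet> b)))"
  proof (rule Bochner_Integration.integral_cong[OF refl])
    fix x :: "real ^ 'n"
    have "(\<Sum>i\<in>UNIV. x $ i * real_of_int (k $ i)) = (\<Sum>b\<in>Basis. (x \<bullet> b) * (r \<bullet> b))"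
      by (subst euclidean_inner[symmetric]) (simp add: inner_vec_def r_def)
    then have "torus_character k (abs_torus x) =
        (\<Prod>b\<in>Basis. exp (- 2 * complex_of_real pi * \<i> * of_real ((x \<bullet> b) * (r \<bullet> b))))"
      by (simp add: torus_character.abs_eq sum_distrib_left flip: exp_sum)
    then show "indicator unit_cube x *\<^sub>R torus_character k (abs_torus x) = (\<Prod>b\<in>Basis. f b (x \<bullet> b))"
      by (simp add: f_def scaleR_conv_of_real prod.distrib indicator_unit_cube)
  qed
  also have "\<dots> = (\<Prod>b\<in>Basis. LINT t|lborel. f b t)"
  proof (rule integral_lborel_prod)
    show "integrable lborel (f b)" for b
    proof (rule Bochner_Integration.integrable_bound)
      show "integrable lborel (indicator {0..<1} :: real \<Rightarrow> real)" by simp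
      show "f b \<in> borel_measurable lborel" unfolding f_def by measurable
    qed (auto simp: f_def)
  qed
  also have "\<dots> = 0"
  proof (rule prod_zero)
    have "r \<bullet> axis i 1 = real_of_int (k $ i)" by (simp add: r_def inner_axis)
    then have "(LINT t|lborel. f (axis i 1) t) = 0"
      unfolding f_def using i by (intro integral_exp_unit_interval) auto
    then show "\<exists>b\<in>Basis. (LINT t|lborel. f b t) = 0" by (auto simp: Basis_vec_real)
  qed simp
  finally show ?thesis using False by simp
qed

lemma continuous_torus_character: "continuous_on UNIV (torus_character k)"
proof -
  have "continuous_on UNIV (\<lambda>x. torus_character k (abs_torus x))"
    unfolding torus_character.abs_eq by (intro continuous_intros)
  then have "open ((\<lambda>x. torus_character k (abs_torus x)) -` U)" if "open U" for U
    using that by (simp add: open_vimage)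
  then show ?thesis
    by (auto simp: continuous_on_open_vimage open_torus_def vimage_def)
qed

lemma compact_torus: "compact (UNIV :: 'n::finite torus set)"
proof -
  have cont: "continuous_on A (abs_torus :: real ^ 'n \<Rightarrow> 'n torus)" for A
    by (rule continuous_on_subset[of UNIV])
      (simp_all add: continuous_on_open_vimage flip: open_torus_def)
  have "t \<in> abs_torus ` cbox 0 (\<chi> i. 1)" for t :: "'n torus"
  proof -
    have x: "t = abs_torus (rep_torus t)" by (rule Quotient3_abs_rep[OF Quotient3_torus, symmetric])
    define x where "x = rep_torus t"
    have "abs_torus x = abs_torus (\<chi> i. frac (x $ i))"
      by (simp add: torus.abs_eq_iff frac_def)
    moreover have "(\<chi> i. frac (x $ i)) \<in> cbox 0 (\<chi> i. 1)"
      by (simp add: mem_box_cart less_imp_le frac_lt_1)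
    ultimately show ?thesis using x unfolding x_def by (metis imageI)
  qed
  then have "abs_torus ` cbox 0 (\<chi> i. 1) = (UNIV :: 'n torus set)" by auto
  with compact_continuous_image[OF cont compact_cbox[of 0 "\<chi> i. 1"]] show ?thesis by simp
qed

text \<open>Realising the torus as a compact subset of a Euclidean space makes the Stone-Weierstrass theorem for
polynomial functions applicable; polynomials in the coordinates are trigonometric polynomials.\<close>

definition torus_embedding :: "'n::finite torus \<Rightarrow> complex ^ 'n" where
  "torus_embedding x = (\<chi> i. torus_character (axis i 1) x)"

lemma continuous_torus_embedding: "continuous_on A torus_embedding"
  unfolding torus_embedding_def
  by (intro continuous_on_vec_lambda continuous_on_subset[OF continuous_torus_character]) auto

lemma inj_torus_embedding: "inj (torus_embedding :: 'n::finite torus \<Rightarrow> complex ^ 'n)"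
proof (rule injI)
  fix x y :: "'n torus"
  assume eq: "torus_embedding x = torus_embedding y"
  define a b where "a = rep_torus x" and "b = rep_torus y"
  then have ab: "x = abs_torus a" "y = abs_torus b"
    by (simp_all add: Quotient3_abs_rep[OF Quotient3_torus])
  have "a $ i - b $ i \<in> \<int>" for i
  proof -
    have sum: "(\<Sum>j\<in>UNIV. c $ j * real_of_int (axis i 1 $ j)) = c $ i" for c :: "real ^ 'n"
      by (subst sum.cong[OF refl, of _ _ "\<lambda>j. if j = i then c $ j else 0"]) (auto simp: axis_def)
    have "torus_character (axis i 1) x = torus_character (axis i 1) y"
      using eq by (simp add: torus_embedding_def Finite_Cartesian_Product.vec_eq_iff)
    then obtain n :: int where "- 2 * complex_of_real pi * \<i> * of_real (a $ i) =
        - 2 * complex_of_real pi * \<i> * of_real (b $ i) + (of_int (2 * n) * pi) * \<i>"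
      unfolding ab torus_character.abs_eq sum exp_eq by blast
    then have "complex_of_real (2 * pi * (b $ i - a $ i)) * \<i> = complex_of_real (2 * pi * of_int n) * \<i>"
      by (simp add: algebra_simps)
    then have "2 * pi * (b $ i - a $ i) = 2 * pi * of_int n"
      by (metis mult_right_cancel complex_i_not_zero of_real_eq_iff)
    then have "b $ i - a $ i = of_int n" by simp
    then have "a $ i - b $ i = of_int (- n)" by simp
    then show ?thesis by (metis Ints_of_int)
  qed
  then show "x = y" by (simp add: ab torus.abs_eq_iff)
qed

section \<open>Bessel inequality\<close>

lemma L2_torus_cases:
  obtains f where "square_integrable f" "x = abs_L2_torus f"
  by (induct x rule: L2_torus.abs_induct) auto

lemma L2_torus_abs:
  assumes "square_integrable f"
  shows "norm (abs_L2_torus f) = sqrt (LINT x|torus_measure. (cmod (f x))\<^sup>2)"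
    "scaleC c (abs_L2_torus f) = abs_L2_torus (\<lambda>x. c * f x)"
    "fourier_coeff (abs_L2_torus f) k = (LINT x|torus_measure. torus_character k x * f x)"
    "square_integrable g \<Longrightarrow> abs_L2_torus f + abs_L2_torus g = abs_L2_torus (\<lambda>x. f x + g x)"
    "square_integrable g \<Longrightarrow> abs_L2_torus f - abs_L2_torus g = abs_L2_torus (\<lambda>x. f x - g x)"
  using assms
  by (simp_all add: norm_L2_torus.abs_eq scaleC_L2_torus.abs_eq fourier_coeff.abs_eq
      plus_L2_torus.abs_eq minus_L2_torus.abs_eq)

lemma square_integrable_bounded:
  assumes "f \<in> borel_measurable borel" "\<And>x. cmod (f x) \<le> B"
  shows "square_integrable f"
  unfolding square_integrable_def
proof
  show m: "f \<in> borel_measurable torus_measure" using assms(1) by simp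
  show "integrable torus_measure (\<lambda>x. (cmod (f x))\<^sup>2)"
    by (rule torus.integrable_const_bound[where B = "B\<^sup>2"])
      (use m assms(2) in \<open>auto intro!: power_mono\<close>)
qed

lemma square_integrable_imp_integrable:
  assumes "square_integrable f"
  shows "integrable torus_measure f"
proof (rule Bochner_Integration.integrable_bound)
  show "integrable torus_measure (\<lambda>x. 1 + (cmod (f x))\<^sup>2)"
    using assms by (simp add: square_integrable_def)
  have "t \<le> 1 + t\<^sup>2" for t :: real
    using sum_squares_bound[of t 1] zero_le_power2[of t] by (simp; linarith)
  then show "AE x in torus_measure. norm (f x) \<le> norm (1 + (cmod (f x))\<^sup>2)"
    by simp
qed (use assms in \<open>simp add: square_integrable_def\<close>)

lemma torus_character_borel [measurable]: "torus_character k \<in> borel_measurable borel"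
  using torus_character_measurable[of k] by simp

text \<open>\<open>torus_character k\<close> is \<open>x \<mapsto> exp (-2 \<pi> i k \<cdot> x)\<close>, the kernel of the Fourier transform, so the basis
function with \<open>k\<close>-th coefficient 1 is its conjugate.\<close>

definition L2_exponential :: "int ^ 'n \<Rightarrow> ('n::finite) L2_torus" where
  "L2_exponential k = abs_L2_torus (torus_character (- k))"

lemma square_integrable_torus_character: "square_integrable (torus_character k)"
  by (rule square_integrable_bounded[where B = 1]) auto

lemma L2_mult_character:
  assumes "square_integrable f"
  shows "square_integrable (\<lambda>x. torus_character k x * f x)"
  using assms unfolding square_integrable_def
  by (auto simp: norm_mult)

lemma fourier_coeff_add: "fourier_coeff (x + y) k = fourier_coeff x k + fourier_coeff y k"
proof -
  obtain f g where fg: "square_integrable f" "x = abs_L2_torus f" "square_integrable g" "y = abs_L2_torus g"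
    using L2_torus_cases by metis
  then show ?thesis
    using square_integrable_imp_integrable[OF L2_mult_character[of f k]]
      square_integrable_imp_integrable[OF L2_mult_character[of g k]]
    by (simp add: L2_torus_abs square_integrable_add distrib_left)
qed

lemma fourier_coeff_scaleC: "fourier_coeff (scaleC c x) k = c * fourier_coeff x k"
proof -
  obtain f where f: "square_integrable f" "x = abs_L2_torus f" using L2_torus_cases by metis
  have "(LINT x|torus_measure. torus_character k x * (c * f x)) =
      (LINT x|torus_measure. c * (torus_character k x * f x))" by (simp add: mult_ac)
  then show ?thesis
    using f by (simp add: L2_torus_abs square_integrable_scale)
qed

lemma fourier_coeff_exponential: "fourier_coeff (L2_exponential l) k = (if k = l then 1 else 0)"
proof -
  have "fourier_coeff (L2_exponential l) k = (LINT x|torus_measure. torus_character (k - l) x)"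
    unfolding L2_exponential_def
    by (simp add: L2_torus_abs(3) square_integrable_torus_character flip: torus_character_add)
  then show ?thesis by (simp add: integral_torus_character)
qed

text \<open>Expand the square under the integral and complete the square in \<open>d\<close>. With \<open>d\<close> equal to the
coefficient this bounds the coefficient; iterated, it is Bessel's identity.\<close>

lemma norm_diff_exponential:
  "(norm (x - scaleC d (L2_exponential k)))\<^sup>2 =
     (norm x)\<^sup>2 - (cmod (fourier_coeff x k))\<^sup>2 + (cmod (fourier_coeff x k - d))\<^sup>2"
proof -
  obtain f where f: "square_integrable f" "x = abs_L2_torus f" using L2_torus_cases by metis
  let ?c = "fourier_coeff x k" and ?g = "\<lambda>t. torus_character k t * f t"
  define R where "R = (\<lambda>t. Re (cnj d * ?g t))"
  have eq: "(cmod (f t - d * torus_character (- k) t))\<^sup>2 = (cmod (f t))\<^sup>2 + (cmod d)\<^sup>2 - 2 * R t" for t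
  proof -
    have "cmod (f t - d * torus_character (- k) t) = cmod (torus_character k t * (f t - d * torus_character (- k) t))"
      by (simp add: norm_mult)
    also have "torus_character k t * (f t - d * torus_character (- k) t) =
        ?g t - d * (torus_character k t * torus_character (- k) t)" by (simp add: algebra_simps)
    also have "torus_character k t * torus_character (- k) t = 1"
      by (simp flip: torus_character_add)
    also have "(cmod (?g t - d * 1))\<^sup>2 = (cmod (?g t))\<^sup>2 + (cmod d)\<^sup>2 - 2 * Re (cnj d * ?g t)"
      unfolding cmod_power2 by (simp add: power2_eq_square algebra_simps)
    finally show ?thesis by (simp add: norm_mult R_def)
  qed
  have ig: "integrable torus_measure ?g"
    by (rule square_integrable_imp_integrable[OF L2_mult_character[OF f(1)]])
  have iR: "integrable torus_measure R"
    unfolding R_def by (intro integrable_Re integrable_mult_right ig)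
  have i2: "integrable torus_measure (\<lambda>t. (cmod (f t))\<^sup>2)"
    using f(1) by (simp add: square_integrable_def)
  have "(norm (x - scaleC d (L2_exponential k)))\<^sup>2 =
      (LINT t|torus_measure. (cmod (f t - d * torus_character (- k) t))\<^sup>2)"
    unfolding f(2) L2_exponential_def using f(1)
    by (simp add: L2_torus_abs square_integrable_torus_character square_integrable_scale square_integrable_diff)
  also have "\<dots> = (LINT t|torus_measure. (cmod (f t))\<^sup>2) + (cmod d)\<^sup>2
      - 2 * (LINT t|torus_measure. R t)"
    unfolding eq using iR i2 by (subst Bochner_Integration.integral_diff) auto
  also have "(LINT t|torus_measure. R t) = Re (cnj d * ?c)"
    unfolding R_def integral_Re[OF integrable_mult_right[OF ig]]
    by (simp add: L2_torus_abs(3)[OF f(1)] f(2))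
  also have "(LINT t|torus_measure. (cmod (f t))\<^sup>2) = (norm x)\<^sup>2"
    using f by (simp add: L2_torus_abs)
  also have "(norm x)\<^sup>2 + (cmod d)\<^sup>2 - 2 * Re (cnj d * ?c) =
      (norm x)\<^sup>2 - (cmod ?c)\<^sup>2 + (cmod (?c - d))\<^sup>2"
    unfolding cmod_power2 by (simp add: power2_eq_square algebra_simps)
  finally show ?thesis .
qed

lemma bounded_functional_fourier_coeff: "bounded_functional (\<lambda>x. fourier_coeff x k)"
  unfolding bounded_functional_def
proof
  show "bounded_linear (\<lambda>x. fourier_coeff x k)"
  proof (rule bounded_linear_intro[where K = 1])
    show "norm (fourier_coeff x k) \<le> norm x * 1" for x
    proof -
      have "0 \<le> (norm x)\<^sup>2 - (cmod (fourier_coeff x k))\<^sup>2"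
        using norm_diff_exponential[of x "fourier_coeff x k" k] by (metis add.right_neutral
            diff_self norm_zero power_zero_numeral zero_le_power2)
      then show ?thesis by (simp add: power2_le_iff_abs_le)
    qed
  qed (simp_all add: fourier_coeff_add fourier_coeff_scaleC scaleR_scaleC scaleR_conv_of_real)
qed (simp add: fourier_coeff_scaleC)

text \<open>Removing multiples of other exponentials does not change the coefficient at \<open>l\<close>, so the one-term
identity can be applied successively. The Fourier coefficients minimise the left-hand side.\<close>

lemma norm_diff_trigonometric_sum:
  assumes "finite S"
  shows "(norm (x - (\<Sum>k\<in>S. scaleC (d k) (L2_exponential k))))\<^sup>2 =
     (norm x)\<^sup>2 - (\<Sum>k\<in>S. (cmod (fourier_coeff x k))\<^sup>2) + (\<Sum>k\<in>S. (cmod (fourier_coeff x k - d k))\<^sup>2)"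
  using assms
proof (induction S rule: finite_induct)
  case empty
  then show ?case by simp
next
  case (insert l S)
  note fc = bounded_functionalD[OF bounded_functional_fourier_coeff]
  let ?y = "x - (\<Sum>k\<in>S. scaleC (d k) (L2_exponential k))"
  have "(\<Sum>k\<in>S. d k * fourier_coeff (L2_exponential k) l) = 0"
    using insert.hyps by (intro sum.neutral) (auto simp: fourier_coeff_exponential)
  then have "fourier_coeff ?y l = fourier_coeff x l" by (simp add: fc)
  then show ?case
    using norm_diff_exponential[of ?y "d l" l] insert by (simp add: algebra_simps)
qed

lemma bessel_inequality:
  assumes "finite S"
  shows "(\<Sum>k\<in>S. (cmod (fourier_coeff x k))\<^sup>2) \<le> (norm x)\<^sup>2"
  using norm_diff_trigonometric_sum[OF assms, of x "fourier_coeff x"]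
    zero_le_power2[of "norm (x - (\<Sum>k\<in>S. scaleC (fourier_coeff x k) (L2_exponential k)))"] by simp

lemma ell2_coeff_fourier [simp]: "ell2_coeff (fourier x) = fourier_coeff x"
proof -
  have "(\<lambda>k. (cmod (fourier_coeff x k))\<^sup>2) summable_on UNIV"
    by (rule nonneg_bounded_partial_sums_imp_summable_on[where C = "(norm x)\<^sup>2"])
      (auto intro!: eventually_finite_subsets_at_top_weakI bessel_inequality)
  then show ?thesis by (simp add: fourier_def Abs_ell2_inverse)
qed

section \<open>Density of trigonometric polynomials\<close>

inductive trig_poly :: "('n::finite torus \<Rightarrow> complex) \<Rightarrow> bool" where
  character: "trig_poly (\<lambda>x. c * torus_character k x)"
| add: "trig_poly f \<Longrightarrow> trig_poly g \<Longrightarrow> trig_poly (\<lambda>x. f x + g x)"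

lemma trig_poly_const: "trig_poly (\<lambda>x. c)"
  using character[of c 0] by simp

lemma trig_poly_sum: "(\<And>i. i \<in> S \<Longrightarrow> trig_poly (f i)) \<Longrightarrow> trig_poly (\<lambda>x. \<Sum>i\<in>S. f i x)"
  by (induction S rule: infinite_finite_induct) (auto intro: trig_poly_const trig_poly.add)

lemma trig_poly_mult_character: "trig_poly f \<Longrightarrow> trig_poly (\<lambda>x. c * torus_character k x * f x)"
proof (induction rule: trig_poly.induct)
  case (character d l)
  have "(\<lambda>x. c * torus_character k x * (d * torus_character l x)) = (\<lambda>x. (c * d) * torus_character (k + l) x)"
    by (simp add: torus_character_add mult_ac)
  then show ?case by (simp add: trig_poly.character)
qed (simp add: distrib_left trig_poly.add)

lemma trig_poly_mult: "trig_poly f \<Longrightarrow> trig_poly g \<Longrightarrow> trig_poly (\<lambda>x. f x * g x)"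
proof (induction rule: trig_poly.induct)
  case (add f g')
  then show ?case by (simp add: distrib_right trig_poly.add)
qed (rule trig_poly_mult_character)

text \<open>The real and imaginary parts of a coordinate \<open>z\<close> of the embedding are combinations of \<open>z\<close> and its
conjugate, which is the inverse character.\<close>

lemma trig_poly_real_linear:
  fixes f :: "complex ^ 'n \<Rightarrow> real"
  assumes "bounded_linear f"
  shows "trig_poly (\<lambda>x. complex_of_real (f (torus_embedding x)))"
proof -
  interpret bounded_linear f by fact
  have "complex_of_real (f (torus_embedding x)) =
    (\<Sum>i\<in>UNIV. (of_real (f (axis i 1)) / 2 + of_real (f (axis i \<i>)) / (2 * \<i>)) * torus_character (axis i 1) x
      + (of_real (f (axis i 1)) / 2 - of_real (f (axis i \<i>)) / (2 * \<i>)) * torus_character (- axis i 1) x)" for x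
  proof -
    let ?z = "\<lambda>i. torus_character (axis i 1) x"
    have "torus_embedding x = (\<Sum>i\<in>UNIV. Re (?z i) *\<^sub>R axis i 1 + Im (?z i) *\<^sub>R axis i \<i>)"
      unfolding Finite_Cartesian_Product.vec_eq_iff
    proof
      fix j
      have "(\<Sum>i\<in>UNIV. Re (?z i) *\<^sub>R axis i 1 + Im (?z i) *\<^sub>R axis i \<i>) $ j =
          (\<Sum>i\<in>UNIV. if i = j then of_real (Re (?z i)) + of_real (Im (?z i)) * \<i> else 0)"
        unfolding sum_component
        by (intro sum.cong refl) (auto simp: axis_def scaleR_conv_of_real[where 'a = complex])
      also have "\<dots> = ?z j" by (simp add: complex_eq_iff)
      finally show "torus_embedding x $ j =
          (\<Sum>i\<in>UNIV. Re (?z i) *\<^sub>R axis i 1 + Im (?z i) *\<^sub>R axis i \<i>) $ j"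
        by (simp add: torus_embedding_def)
    qed
    then have "f (torus_embedding x) = (\<Sum>i\<in>UNIV. Re (?z i) * f (axis i 1) + Im (?z i) * f (axis i \<i>))"
      by (simp add: sum add scaleR)
    moreover have "complex_of_real (Re z * a + Im z * b) =
        (of_real a / 2 + of_real b / (2 * \<i>)) * z + (of_real a / 2 - of_real b / (2 * \<i>)) * cnj z" for z a b
      by (simp add: complex_eq_iff field_simps)
    ultimately show ?thesis by (simp add: cnj_torus_character)
  qed
  then show ?thesis
    by (simp only:) (intro trig_poly_sum trig_poly.intros)
qed

lemma trig_poly_real_polynomial:
  fixes p :: "complex ^ 'n \<Rightarrow> real"
  assumes "real_polynomial_function p"
  shows "trig_poly (\<lambda>x. complex_of_real (p (torus_embedding x)))"
  using assms
  by induction (simp_all add: trig_poly_real_linear trig_poly_const trig_poly.add trig_poly_mult)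

lemma trig_poly_L2:
  assumes "trig_poly f"
  shows "square_integrable f \<and> abs_L2_torus f \<in> complex_vector.span (range L2_exponential)"
  using assms
proof induction
  case (character c k)
  have "abs_L2_torus (\<lambda>x. c * torus_character k x) = scaleC c (L2_exponential (- k))"
    by (simp add: L2_exponential_def L2_torus_abs square_integrable_torus_character)
  then show ?case
    by (simp add: square_integrable_scale square_integrable_torus_character complex_vector.span_scale
        complex_vector.span_base)
next
  case (add f g)
  then show ?case
    by (auto intro: square_integrable_add complex_vector.span_add simp flip: L2_torus_abs(4))
qed

text \<open>Membership in the closed linear span of the exponentials, phrased for representing functions so that
measure-theoretic induction applies.\<close>

definition L2_approximable :: "('n::finite torus \<Rightarrow> complex) \<Rightarrow> bool" where
  "L2_approximable f \<longleftrightarrow> square_integrable f \<and>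
     (\<forall>\<epsilon>>0. \<exists>p\<in>complex_vector.span (range L2_exponential). norm (abs_L2_torus f - p) < \<epsilon>)"

lemma L2_approximableI:
  assumes f: "square_integrable f"
    and approx: "\<And>\<epsilon>. \<epsilon> > 0 \<Longrightarrow> \<exists>g. L2_approximable g \<and> norm (abs_L2_torus f - abs_L2_torus g) < \<epsilon>"
  shows "L2_approximable f"
  unfolding L2_approximable_def
proof (intro conjI allI impI f)
  fix \<epsilon> :: real assume "\<epsilon> > 0"
  then obtain g where g: "L2_approximable g" "norm (abs_L2_torus f - abs_L2_torus g) < \<epsilon> / 2"
    using approx[of "\<epsilon> / 2"] by auto
  then obtain p where p: "p \<in> complex_vector.span (range L2_exponential)" "norm (abs_L2_torus g - p) < \<epsilon> / 2"
    using \<open>\<epsilon> > 0\<close> unfolding L2_approximable_def by (meson half_gt_zero)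
  have "norm (abs_L2_torus f - p) \<le> norm (abs_L2_torus f - abs_L2_torus g) + norm (abs_L2_torus g - p)"
    using norm_triangle_ineq[of "abs_L2_torus f - abs_L2_torus g" "abs_L2_torus g - p"] by simp
  with g(2) p show "\<exists>p\<in>complex_vector.span (range L2_exponential). norm (abs_L2_torus f - p) < \<epsilon>"
    by (intro bexI[of _ p]) auto
qed

lemma L2_approximable_add:
  assumes "L2_approximable f" "L2_approximable g"
  shows "L2_approximable (\<lambda>x. f x + g x)"
  unfolding L2_approximable_def
proof (intro conjI allI impI)
  have sq: "square_integrable f" "square_integrable g" using assms by (auto simp: L2_approximable_def)
  then show "square_integrable (\<lambda>x. f x + g x)" by (rule square_integrable_add)
  fix \<epsilon> :: real assume "\<epsilon> > 0"
  then obtain p q where "p \<in> complex_vector.span (range L2_exponential)" "norm (abs_L2_torus f - p) < \<epsilon> / 2"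
    "q \<in> complex_vector.span (range L2_exponential)" "norm (abs_L2_torus g - q) < \<epsilon> / 2"
    using assms unfolding L2_approximable_def by (meson half_gt_zero)
  moreover have "norm ((abs_L2_torus f + abs_L2_torus g) - (p + q)) \<le>
      norm (abs_L2_torus f - p) + norm (abs_L2_torus g - q)"
    by (rule norm_diff_triangle_ineq)
  ultimately show "\<exists>r\<in>complex_vector.span (range L2_exponential). norm (abs_L2_torus (\<lambda>x. f x + g x) - r) < \<epsilon>"
    using sq by (intro bexI[of _ "p + q"]) (auto simp: L2_torus_abs(4) complex_vector.span_add)
qed

lemma L2_approximable_scale:
  assumes "L2_approximable f"
  shows "L2_approximable (\<lambda>x. c * f x)"
  unfolding L2_approximable_def
proof (intro conjI allI impI)
  have sq: "square_integrable f" using assms by (auto simp: L2_approximable_def)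
  then show "square_integrable (\<lambda>x. c * f x)" by (rule square_integrable_scale)
  fix \<epsilon> :: real assume "\<epsilon> > 0"
  have pos: "cmod c + 1 > 0" by (simp add: add_nonneg_pos)
  then have "\<epsilon> / (cmod c + 1) > 0" using \<open>\<epsilon> > 0\<close> by simp
  then obtain p where p: "p \<in> complex_vector.span (range L2_exponential)"
    "norm (abs_L2_torus f - p) < \<epsilon> / (cmod c + 1)"
    using assms unfolding L2_approximable_def by meson
  have "norm (scaleC c (abs_L2_torus f) - scaleC c p) = cmod c * norm (abs_L2_torus f - p)"
    by (simp add: norm_scaleC flip: complex_vector.scale_right_diff_distrib)
  also have "\<dots> \<le> (cmod c + 1) * norm (abs_L2_torus f - p)" by (intro mult_right_mono) auto
  also have "\<dots> < \<epsilon>" using p(2) pos by (simp add: field_simps)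
  finally show "\<exists>r\<in>complex_vector.span (range L2_exponential). norm (abs_L2_torus (\<lambda>x. c * f x) - r) < \<epsilon>"
    using sq p(1) by (intro bexI[of _ "scaleC c p"]) (auto simp: L2_torus_abs(2) complex_vector.span_scale)
qed

lemma L2_approximable_trig_poly: "trig_poly f \<Longrightarrow> L2_approximable f"
  using trig_poly_L2[of f] unfolding L2_approximable_def by force

lemma L2_approximable_continuous:
  fixes g :: "complex ^ 'n \<Rightarrow> real"
  assumes "continuous_on UNIV g"
  shows "L2_approximable (\<lambda>x. complex_of_real (g (torus_embedding x)))"
proof -
  let ?K = "range (torus_embedding :: 'n torus \<Rightarrow> complex ^ 'n)" and ?f = "\<lambda>x. complex_of_real (g (torus_embedding x))"
  have K: "compact ?K"
    by (rule compact_continuous_image[OF continuous_torus_embedding compact_torus])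
  have gK: "continuous_on ?K g" using assms by (rule continuous_on_subset) simp
  have "bounded (g ` ?K)" by (intro compact_imp_bounded compact_continuous_image gK K)
  then obtain B where B: "\<And>x. \<bar>g (torus_embedding x)\<bar> \<le> B" by (auto simp: bounded_iff)
  have "continuous_on UNIV ?f"
    by (intro continuous_intros continuous_on_compose2[OF assms continuous_torus_embedding]) auto
  then have f: "square_integrable ?f"
    using B by (intro square_integrable_bounded[where B = B] borel_measurable_continuous_onI) auto
  show ?thesis
  proof (rule L2_approximableI[OF f])
    fix \<epsilon> :: real assume "\<epsilon> > 0"
    then obtain p where p: "real_polynomial_function p" "\<And>z. z \<in> ?K \<Longrightarrow> \<bar>g z - p z\<bar> < \<epsilon> / 2"
      using Stone_Weierstrass_real_polynomial_function[OF K gK, of "\<epsilon> / 2"] by auto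
    let ?h = "\<lambda>x. complex_of_real (p (torus_embedding x))"
    have h: "L2_approximable ?h"
      by (intro L2_approximable_trig_poly trig_poly_real_polynomial p)
    then have sh: "square_integrable ?h" by (simp add: L2_approximable_def)
    have "(LINT x|torus_measure. (cmod (?f x - ?h x))\<^sup>2) \<le> (LINT x|(torus_measure :: 'n torus measure). (\<epsilon> / 2)\<^sup>2)"
    proof (rule integral_mono)
      show "integrable torus_measure (\<lambda>x. (cmod (?f x - ?h x))\<^sup>2)"
        using square_integrable_diff[OF f sh] by (simp add: square_integrable_def)
      show "(cmod (?f x - ?h x))\<^sup>2 \<le> (\<epsilon> / 2)\<^sup>2" for x
        using p(2)[of "torus_embedding x"] by (intro power_mono) (auto simp flip: of_real_diff)
    qed simp
    then have "sqrt (LINT x|torus_measure. (cmod (?f x - ?h x))\<^sup>2) \<le> sqrt ((\<epsilon> / 2)\<^sup>2)"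
      by (intro real_sqrt_le_mono) simp
    then have "norm (abs_L2_torus ?f - abs_L2_torus ?h) \<le> sqrt ((\<epsilon> / 2)\<^sup>2)"
      by (simp only: L2_torus_abs f sh square_integrable_diff)
    also have "\<dots> < \<epsilon>" using \<open>\<epsilon> > 0\<close> by simp
    finally show "\<exists>h. L2_approximable h \<and> norm (abs_L2_torus ?f - abs_L2_torus h) < \<epsilon>" using h by blast
  qed
qed

lemma L2_approximable_dominated_limit:
  fixes F :: "nat \<Rightarrow> 'n::finite torus \<Rightarrow> complex"
  assumes F: "\<And>i. L2_approximable (F i)" and lim: "\<And>x. (\<lambda>i. F i x) \<longlonglongrightarrow> f x"
    and w: "integrable torus_measure (\<lambda>x. (w x)\<^sup>2)" and le: "\<And>i x. cmod (F i x) \<le> w x"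
  shows "L2_approximable f"
proof (rule L2_approximableI)
  have sq: "square_integrable (F i)" for i using F by (simp add: L2_approximable_def)
  then have mF [measurable]: "F i \<in> borel_measurable torus_measure" for i
    by (simp add: square_integrable_def)
  have mf [measurable]: "f \<in> borel_measurable torus_measure"
    by (rule borel_measurable_LIMSEQ_metric[where f = F]) (use lim in auto)
  have fw: "cmod (f x) \<le> w x" for x
    by (rule LIMSEQ_le_const2[OF tendsto_norm[OF lim]]) (use le in auto)
  have w0: "0 \<le> w x" for x using le[of 0 x] norm_ge_zero order_trans by blast
  show f: "square_integrable f"
    unfolding square_integrable_def
  proof
    show "integrable torus_measure (\<lambda>x. (cmod (f x))\<^sup>2)"
      by (rule Bochner_Integration.integrable_bound[OF w])
        (use fw w0 in \<open>auto intro!: power_mono\<close>)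
  qed (rule mf)
  have "(\<lambda>i. LINT x|torus_measure. (cmod (f x - F i x))\<^sup>2) \<longlonglongrightarrow> (LINT x|(torus_measure :: 'n torus measure). 0)"
  proof (rule integral_dominated_convergence[where w = "\<lambda>x. 4 * (w x)\<^sup>2"])
    show "AE x in torus_measure. (\<lambda>i. (cmod (f x - F i x))\<^sup>2) \<longlonglongrightarrow> 0"
    proof (rule AE_I2)
      fix x
      have "(\<lambda>i. (cmod (f x - F i x))\<^sup>2) \<longlonglongrightarrow> (cmod (f x - f x))\<^sup>2"
        by (intro tendsto_intros lim)
      then show "(\<lambda>i. (cmod (f x - F i x))\<^sup>2) \<longlonglongrightarrow> 0" by simp
    qed
    show "AE x in torus_measure. norm ((cmod (f x - F i x))\<^sup>2) \<le> 4 * (w x)\<^sup>2" for i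
    proof (rule AE_I2)
      fix x
      have "cmod (f x - F i x) \<le> 2 * w x"
        using norm_triangle_ineq4[of "f x" "F i x"] fw[of x] le[of i x] by simp
      then have "(cmod (f x - F i x))\<^sup>2 \<le> (2 * w x)\<^sup>2" by (intro power_mono) auto
      then show "norm ((cmod (f x - F i x))\<^sup>2) \<le> 4 * (w x)\<^sup>2" by (simp add: power_mult_distrib)
    qed
  qed (use w in auto)
  then have "(\<lambda>i. sqrt (LINT x|torus_measure. (cmod (f x - F i x))\<^sup>2)) \<longlonglongrightarrow> sqrt 0"
    by (intro tendsto_real_sqrt) simp
  then have lim0: "(\<lambda>i. norm (abs_L2_torus f - abs_L2_torus (F i))) \<longlonglongrightarrow> 0"
    using f sq by (simp add: L2_torus_abs square_integrable_diff)
  fix \<epsilon> :: real assume "\<epsilon> > 0"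
  with lim0 have "\<forall>\<^sub>F i in sequentially. norm (abs_L2_torus f - abs_L2_torus (F i)) < \<epsilon>"
    by (rule order_tendstoD)
  then obtain i where "norm (abs_L2_torus f - abs_L2_torus (F i)) < \<epsilon>"
    using eventually_happens'[OF sequentially_bot] by blast
  then show "\<exists>g. L2_approximable g \<and> norm (abs_L2_torus f - abs_L2_torus g) < \<epsilon>"
    using F by blast
qed

lemma L2_approximable_const: "L2_approximable (\<lambda>x. c)"
  by (intro L2_approximable_trig_poly trig_poly_const)

text \<open>The complement of \<open>U\<close> is compact, hence so is its image \<open>C\<close> under the embedding. Truncated multiples of the
distance to \<open>C\<close> are continuous and increase to the indicator of \<open>U\<close>.\<close>

lemma L2_approximable_open:
  assumes "open (U :: 'n::finite torus set)"
  shows "L2_approximable (indicator U)"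
  (* infdist to the empty set is 0, so an empty complement has to be treated separately *)
proof (cases "U = UNIV")
  case True
  then show ?thesis using L2_approximable_const[of 1] by (simp add: indicator_def)
next
  case False
  define C where "C = torus_embedding ` (- U)"
  have "compact (- U)" using compact_Int_closed[OF compact_torus, of "- U"] assms by auto
  then have "compact C"
    unfolding C_def by (rule compact_continuous_image[OF continuous_torus_embedding])
  then have C: "closed C" "C \<noteq> {}" using False by (auto simp: C_def compact_imp_closed)
  have mem: "torus_embedding x \<in> C \<longleftrightarrow> x \<notin> U" for x
    unfolding C_def by (auto simp: inj_image_mem_iff[OF inj_torus_embedding])
  let ?F = "\<lambda>i x. complex_of_real (min 1 (real i * infdist (torus_embedding x) C))"
  show ?thesis
  proof (rule L2_approximable_dominated_limit[where F = ?F and w = "\<lambda>_. 1"])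
    show "L2_approximable (?F i)" for i
      by (rule L2_approximable_continuous[where g = "\<lambda>z. min 1 (real i * infdist z C)"])
        (intro continuous_intros)
    show "(\<lambda>i. ?F i x) \<longlonglongrightarrow> indicator U x" for x
    proof (cases "x \<in> U")
      case True
      then have "infdist (torus_embedding x) C > 0"
        using C mem infdist_pos_not_in_closed by blast
      then obtain n where n: "1 \<le> real n * infdist (torus_embedding x) C"
        using reals_Archimedean3[of "infdist (torus_embedding x) C"] less_imp_le by blast
      have "?F i x = 1" if "i \<ge> n" for i
      proof -
        have "real n * infdist (torus_embedding x) C \<le> real i * infdist (torus_embedding x) C"
          using that by (intro mult_right_mono) (auto simp: infdist_nonneg)
        then show ?thesis using n by (simp add: min_def)
      qed
      then show ?thesis using True by (intro tendsto_eventually) (auto simp: eventually_sequentially)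
    next
      case False
      then show ?thesis using mem by simp
    qed
    show "cmod (?F i x) \<le> 1" for i x
      by (simp add: infdist_nonneg min_def del: of_real_mult)
  qed simp
qed

text \<open>Open sets form an intersection-stable generator of the Borel sets, and sets with approximable
indicator are closed under complements and countable disjoint unions.\<close>

lemma L2_approximable_indicator:
  assumes "A \<in> sets (borel :: 'n::finite torus measure)"
  shows "L2_approximable (indicator A)"
proof -
  have "A \<in> sigma_sets UNIV {U :: 'n torus set. open U}" using assms by (simp add: sets_borel)
  then show ?thesis
  proof (induction rule: sigma_sets_induct_disjoint[rotated 2, consumes 1])
    show "Int_stable {U :: 'n torus set. open U}" by (auto simp: Int_stable_def)
    show "{U :: 'n torus set. open U} \<subseteq> Pow UNIV" by simp
    show "L2_approximable (indicator A)" if "A \<in> {U :: 'n torus set. open U}" for A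
      using that by (auto intro: L2_approximable_open)
    show "L2_approximable (indicator ({} :: 'n torus set))"
      using L2_approximable_const[where c = 0 and 'a = 'n]
      by (rule back_subst[of L2_approximable]) auto
  next
    fix A :: "'n torus set" assume "L2_approximable (indicator A)"
    then have "L2_approximable (\<lambda>x. 1 + (- 1) * indicator A x)"
      by (intro L2_approximable_add L2_approximable_scale L2_approximable_const)
    also have "(\<lambda>x. 1 + (- 1) * indicator A x :: complex) = indicator (UNIV - A)"
      by (auto simp: indicator_def)
    finally show "L2_approximable (indicator (UNIV - A))" .
  next
    fix A :: "nat \<Rightarrow> 'n torus set"
    assume dis: "disjoint_family A" and A: "\<And>i. L2_approximable (indicator (A i))"
    have part: "(\<Sum>j<i. indicator (A j) x) = (indicator (\<Union>j<i. A j) x :: complex)" for i x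
      by (rule indicator_UN_disjoint[symmetric, THEN trans])
        (use dis in \<open>auto simp: disjoint_family_on_def\<close>)
    show "L2_approximable (indicator (\<Union>i. A i))"
    proof (rule L2_approximable_dominated_limit[where w = "\<lambda>_. 1"])
      show "L2_approximable (\<lambda>x. \<Sum>j<i. indicator (A j) x)" for i
        by (induction i) (simp_all add: L2_approximable_const L2_approximable_add A)
      show "(\<lambda>i. \<Sum>j<i. indicator (A j) x) \<longlonglongrightarrow> (indicator (\<Union>i. A i) x :: complex)" for x
        unfolding part by (rule LIMSEQ_indicator_UN)
      show "cmod (\<Sum>j<i. indicator (A j) x) \<le> 1" for i x
        unfolding part by (simp add: indicator_def)
    qed simp
  qed
qed

lemma L2_approximable_nonneg:
  fixes u :: "'n::finite torus \<Rightarrow> real"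
  assumes "u \<in> borel_measurable torus_measure" "\<And>x. 0 \<le> u x"
  shows "integrable torus_measure (\<lambda>x. (u x)\<^sup>2) \<Longrightarrow> L2_approximable (\<lambda>x. complex_of_real (u x))"
  using assms
proof (induction rule: borel_measurable_induct_real)
  case (set A)
  have "(\<lambda>x. complex_of_real (indicator A x)) = indicator A" by (auto simp: indicator_def)
  then show ?case using set L2_approximable_indicator[of A] by simp
next
  case (mult u c)
  show ?case
  proof (cases "c = 0")
    case True
    then show ?thesis using L2_approximable_const[of 0] by simp
  next
    case False
    then have "integrable torus_measure (\<lambda>x. (u x)\<^sup>2)"
      using mult.prems by (simp add: power_mult_distrib)
    then show ?thesis using L2_approximable_scale[OF mult.IH, of "of_real c"] by simp
  qed
next
  case (add u v)
  have "integrable torus_measure (\<lambda>x. (u x)\<^sup>2)" "integrable torus_measure (\<lambda>x. (v x)\<^sup>2)"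
    by (rule Bochner_Integration.integrable_bound[OF add.prems];
        use add.hyps in \<open>auto intro!: power_mono\<close>)+
  then show ?case using L2_approximable_add[OF add.IH(2,1)] by simp
next
  case (seq U)
  have le: "U i x \<le> u x" for i x
    by (rule incseq_le) (use seq.hyps in \<open>auto simp: incseq_def le_fun_def\<close>)
  show ?case
  proof (rule L2_approximable_dominated_limit[where F = "\<lambda>i x. of_real (U i x)" and w = u])
    show "L2_approximable (\<lambda>x. complex_of_real (U i x))" for i
    proof (rule seq.IH, rule Bochner_Integration.integrable_bound[OF seq.prems])
      show "AE x in torus_measure. norm ((U i x)\<^sup>2) \<le> norm ((u x)\<^sup>2)"
        using le seq.hyps(2) by (auto intro!: power_mono)
    qed (use seq.hyps(1) in simp)
    show "(\<lambda>i. complex_of_real (U i x)) \<longlonglongrightarrow> of_real (u x)" for x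
      using seq.hyps(4)[of x] by (intro tendsto_of_real) simp
    show "cmod (of_real (U i x)) \<le> u x" for i x
      using le seq.hyps(2) by simp
  qed (use seq.prems in simp)
qed

lemma L2_approximable_all:
  assumes "square_integrable f"
  shows "L2_approximable f"
proof -
  have [measurable]: "f \<in> borel_measurable torus_measure" and
    i: "integrable torus_measure (\<lambda>x. (cmod (f x))\<^sup>2)"
    using assms by (auto simp: square_integrable_def)
  have part: "L2_approximable (\<lambda>x. complex_of_real (max 0 (g x)))"
    if [measurable]: "g \<in> borel_measurable torus_measure" and le: "\<And>x. \<bar>g x\<bar> \<le> cmod (f x)" for g
  proof (rule L2_approximable_nonneg)
    show "integrable torus_measure (\<lambda>x. (max 0 (g x))\<^sup>2)"
    proof (rule Bochner_Integration.integrable_bound[OF i])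
      show "AE x in torus_measure. norm ((max 0 (g x))\<^sup>2) \<le> norm ((cmod (f x))\<^sup>2)"
        using le by (auto intro!: power_mono simp: max_def abs_le_iff)
    qed measurable
  qed auto
  have "L2_approximable (\<lambda>x. (of_real (max 0 (Re (f x))) + (- 1) * of_real (max 0 (- Re (f x)))) +
      \<i> * (of_real (max 0 (Im (f x))) + (- 1) * of_real (max 0 (- Im (f x)))))"
    by (intro L2_approximable_add L2_approximable_scale part)
      (auto simp: abs_Re_le_cmod abs_Im_le_cmod)
  also have "(\<lambda>x. (of_real (max 0 (Re (f x))) + (- 1) * of_real (max 0 (- Re (f x)))) +
      \<i> * (of_real (max 0 (Im (f x))) + (- 1) * of_real (max 0 (- Im (f x))))) = f"
    by (auto simp: complex_eq_iff max_def)
  finally show ?thesis .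
qed

section \<open>Fourier expansion and prescribed coefficients\<close>

text \<open>Partial sums of the Fourier series are best approximations, so an approximation by any element of the
span with exponents in \<open>S\<close> bounds the error of all partial sums over supersets of \<open>S\<close>.\<close>

lemma fourier_expansion:
  "((\<lambda>S. \<Sum>k\<in>S. scaleC (fourier_coeff x k) (L2_exponential k)) \<longlongrightarrow> x) (finite_subsets_at_top UNIV)"
proof (rule tendstoI)
  fix \<epsilon> :: real assume "\<epsilon> > 0"
  let ?s = "\<lambda>S. \<Sum>k\<in>S. scaleC (fourier_coeff x k) (L2_exponential k)"
  obtain f where "square_integrable f" "x = abs_L2_torus f" using L2_torus_cases by metis
  then obtain p where p: "p \<in> complex_vector.span (range L2_exponential)" "norm (x - p) < \<epsilon>"
    using L2_approximable_all \<open>\<epsilon> > 0\<close> unfolding L2_approximable_def by metis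
  obtain t r where t: "finite t" "t \<subseteq> range L2_exponential" "p = (\<Sum>a\<in>t. scaleC (r a) a)"
    using p(1) unfolding complex_vector.span_explicit by blast
  obtain S where S: "inj_on L2_exponential S" "t = L2_exponential ` S"
    using t(2) by (auto simp: subset_image_inj)
  have finS: "finite S" using t(1) S by (simp add: finite_image_iff)
  have p_eq: "p = (\<Sum>k\<in>S. scaleC (r (L2_exponential k)) (L2_exponential k))"
    unfolding t(3) S(2) by (simp add: sum.reindex[OF S(1)])
  have "norm (x - ?s T) < \<epsilon>" if "finite T" "S \<subseteq> T" for T
  proof -
    have "(norm (x - ?s T))\<^sup>2 = (norm x)\<^sup>2 - (\<Sum>k\<in>T. (cmod (fourier_coeff x k))\<^sup>2)"
      using norm_diff_trigonometric_sum[OF that(1), of x "fourier_coeff x"] by simp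
    also have "\<dots> \<le> (norm x)\<^sup>2 - (\<Sum>k\<in>S. (cmod (fourier_coeff x k))\<^sup>2)"
      using that by (intro diff_left_mono sum_mono2) auto
    also have "\<dots> \<le> (norm (x - p))\<^sup>2"
      unfolding p_eq norm_diff_trigonometric_sum[OF finS] by (simp add: sum_nonneg)
    finally have "norm (x - ?s T) \<le> norm (x - p)" by (simp add: power2_le_iff_abs_le)
    then show ?thesis using p(2) by simp
  qed
  then show "\<forall>\<^sub>F T in finite_subsets_at_top UNIV. dist (?s T) x < \<epsilon>"
    unfolding eventually_finite_subsets_at_top dist_norm
    using finS by (intro exI[of _ S]) (simp add: norm_minus_commute)
qed

text \<open>The series converges uniformly to a bounded function and may be integrated termwise.\<close>

lemma absolutely_summable_is_fourier_coeff:
  fixes c :: "int ^ 'n::finite \<Rightarrow> complex" and h :: "nat \<Rightarrow> int ^ 'n"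
  assumes h: "bij h" and sum: "summable (\<lambda>n. cmod (c (h n)))"
  obtains x :: "'n L2_torus" where "fourier_coeff x = c"
proof -
  define f where "f = (\<lambda>t. \<Sum>n. c (h n) * torus_character (- h n) t)"
  have s: "summable (\<lambda>n. cmod (c (h n) * torus_character k t))" for k t
    using sum by (simp add: norm_mult)
  have s': "summable (\<lambda>n. cmod (c (h n) * torus_character (- h n) t))" for t
    using sum by (simp add: norm_mult)
  have "cmod (f t) \<le> (\<Sum>n. cmod (c (h n)))" for t
    using summable_norm[OF s'[of t]] by (simp add: f_def norm_mult)
  moreover have "f \<in> borel_measurable borel"
    unfolding f_def by (rule borel_measurable_suminf) measurable
  ultimately have sq: "square_integrable f" by (intro square_integrable_bounded)
  have "fourier_coeff (abs_L2_torus f) k = c k" for k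
  proof -
    obtain m where m: "h m = k" using h by (metis bij_pointE)
    have "fourier_coeff (abs_L2_torus f) k =
        (LINT t|torus_measure. (\<Sum>n. c (h n) * torus_character (k - h n) t))"
    proof -
      have "torus_character k t * f t = (\<Sum>n. c (h n) * torus_character (k - h n) t)" for t
      proof -
        have "torus_character k t * f t = (\<Sum>n. torus_character k t * (c (h n) * torus_character (- h n) t))"
          unfolding f_def by (rule suminf_mult[symmetric, OF summable_norm_cancel[OF s']])
        also have "\<dots> = (\<Sum>n. c (h n) * torus_character (k - h n) t)"
          using torus_character_add[of k "- h _" t] by (intro arg_cong[where f = suminf]) (auto simp: mult_ac)
        finally show ?thesis .
      qed
      then show ?thesis by (simp add: L2_torus_abs(3)[OF sq])
    qed
    also have "\<dots> = (\<Sum>n. LINT t|torus_measure. c (h n) * torus_character (k - h n) t)"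
    proof (rule integral_suminf)
      show "integrable torus_measure (\<lambda>t. c (h n) * torus_character (k - h n) t)" for n
        by (intro integrable_mult_right square_integrable_imp_integrable
            square_integrable_torus_character)
      show "AE t in torus_measure. summable (\<lambda>n. norm (c (h n) * torus_character (k - h n) t))"
        using sum by (simp add: norm_mult)
      show "summable (\<lambda>n. LINT t|torus_measure. norm (c (h n) * torus_character (k - h n) t))"
        using sum by (simp add: norm_mult)
    qed
    also have "\<dots> = (\<Sum>n. if n = m then c k else 0)"
      using h m by (intro arg_cong[where f = suminf] ext)
        (auto simp: integral_torus_character bij_is_inj inj_eq)
    also have "\<dots> = c k"
      using suminf_finite[of "{m}" "\<lambda>n. if n = m then c k else 0"] by simp
    finally show ?thesis .
  qed
  then show ?thesis using that[of "abs_L2_torus f"] by blast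
qed

section \<open>Conjugation by the Fourier transform\<close>

lemma ex_bij_nat_int_vec: "\<exists>h :: nat \<Rightarrow> int ^ 'n::finite. bij h"
proof -
  have "inj (\<lambda>m :: int. (\<chi> i. m) :: int ^ 'n)"
    by (auto simp: inj_def Finite_Cartesian_Product.vec_eq_iff)
  then have "infinite (UNIV :: (int ^ 'n) set)"
    using finite_subset[OF subset_UNIV] finite_imageD infinite_UNIV_int by blast
  then show ?thesis
    using bij_betw_from_nat_into[of "UNIV :: (int ^ 'n) set"] by blast
qed

lemma fourier_exponential: "fourier (L2_exponential k) = ell2_unit k"
  by (rule ell2_eqI) (simp add: fourier_coeff_exponential)

lemma norm_L2_exponential [simp]: "norm (L2_exponential k) = 1"
proof -
  have "(norm (L2_exponential k))\<^sup>2 = 1"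
    using norm_diff_exponential[of "L2_exponential k" 1 k]
    by (simp add: scaleC_one fourier_coeff_exponential)
  then show ?thesis using power2_eq_imp_eq[of "norm (L2_exponential k)" 1] by simp
qed

lemma norm_fourier_le: "norm (fourier x) \<le> norm x"
proof -
  have "(norm (fourier x))\<^sup>2 \<le> (norm x)\<^sup>2"
    by (rule has_sum_le_finite_sums[OF norm_ell2_has_sum]) (simp add: bessel_inequality)
  then show ?thesis by (simp add: power2_le_iff_abs_le)
qed

lemma fourier_linear:
  "fourier (x + y) = fourier x + fourier y" "fourier (scaleC c x) = scaleC c (fourier x)"
  "fourier 0 = 0"
  by (auto intro!: ell2_eqI simp: bounded_functionalD[OF bounded_functional_fourier_coeff])

lemma inj_fourier: "inj fourier"
proof (rule injI)
  fix x y :: "'a L2_torus"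
  assume "fourier x = fourier y"
  then have "fourier_coeff x = fourier_coeff y" by (metis ell2_coeff_fourier)
  then show "x = y"
    using tendsto_unique[OF _ fourier_expansion[of x] fourier_expansion[of y, folded \<open>fourier_coeff x = fourier_coeff y\<close>]]
    by simp
qed

text \<open>This makes the inverse transform in \<open>fourier_conj\<close> meaningful on all vectors to which it is
applied.\<close>

lemma D2_range_fourier:
  fixes A :: "(int ^ 'n::finite) ell2 \<Rightarrow> (int ^ 'n) ell2"
  assumes A: "A \<in> D2"
  shows "A y \<in> range fourier"
proof -
  obtain h :: "nat \<Rightarrow> int ^ 'n" where h: "bij h" using ex_bij_nat_int_vec by blast
  have inj: "inj_on h S" for S using h by (auto intro: inj_on_subset bij_is_inj)
  have "summable (\<lambda>n. cmod (ell2_coeff (A y) (h n)))"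
  proof (rule summableI_nonneg_bounded)
    show "(\<Sum>i<n. cmod (ell2_coeff (A y) (h i))) \<le> D2_norm A * norm y" for n
      using D2_maps_to_l1[OF A, of "h ` {..<n}" y] by (simp add: sum.reindex[OF inj])
  qed simp
  then obtain x :: "'n L2_torus" where "fourier_coeff x = ell2_coeff (A y)"
    by (rule absolutely_summable_is_fourier_coeff[OF h])
  then have "fourier x = A y" by (intro ell2_eqI) simp
  then show ?thesis by (metis rangeI)
qed

lemma fourier_fourier_conj:
  assumes "A \<in> D2"
  shows "fourier (fourier_conj A x) = A (fourier x)"
  unfolding fourier_conj_def using f_inv_into_f[OF D2_range_fourier[OF assms]] by simp

lemma fourier_conj_eqI:
  assumes "A \<in> D2" "\<And>x. fourier (T x) = A (fourier x)"
  shows "fourier_conj A = T"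
  using assms by (intro ext injD[OF inj_fourier]) (simp add: fourier_fourier_conj)

text \<open>Exponentials have norm one, so the norm of a function is at most the \<open>\<ell>\<^sup>1\<close> norm of its coefficients.\<close>

lemma norm_fourier_conj_le:
  assumes A: "A \<in> D2"
  shows "norm (fourier_conj A x) \<le> D2_norm A * norm x"
proof (rule tendsto_upperbound[OF tendsto_norm[OF fourier_expansion]])
  let ?y = "fourier_conj A x"
  show "\<forall>\<^sub>F S in finite_subsets_at_top UNIV.
      norm (\<Sum>k\<in>S. scaleC (fourier_coeff ?y k) (L2_exponential k)) \<le> D2_norm A * norm x"
  proof (rule eventually_finite_subsets_at_top_weakI)
    fix S :: "(int ^ 'a) set" assume "finite S"
    have "norm (\<Sum>k\<in>S. scaleC (fourier_coeff ?y k) (L2_exponential k)) \<le>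
        (\<Sum>k\<in>S. cmod (ell2_coeff (A (fourier x)) k))"
      by (intro sum_norm_le) (simp add: norm_scaleC flip: fourier_fourier_conj[OF A])
    also have "\<dots> \<le> D2_norm A * norm (fourier x)"
      by (rule D2_maps_to_l1[OF A \<open>finite S\<close>])
    also have "\<dots> \<le> D2_norm A * norm x"
      by (intro mult_left_mono norm_fourier_le D2_norm_nonneg)
    finally show "norm (\<Sum>k\<in>S. scaleC (fourier_coeff ?y k) (L2_exponential k)) \<le> D2_norm A * norm x" .
  qed
qed simp

lemma fourier_conj_bounded:
  assumes A: "A \<in> D2"
  shows "fourier_conj A \<in> bounded_ops"
proof (rule bounded_opsI)
  note A' = bounded_opsD[OF D2_bounded[OF A]]
  show "fourier_conj A (x + y) = fourier_conj A x + fourier_conj A y" for x y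
    by (rule injD[OF inj_fourier]) (simp add: fourier_fourier_conj[OF A] fourier_linear A')
  show "fourier_conj A (scaleC c x) = scaleC c (fourier_conj A x)" for c x
    by (rule injD[OF inj_fourier]) (simp add: fourier_fourier_conj[OF A] fourier_linear A')
qed (rule norm_fourier_conj_le[OF A])

lemma fourier_conj_zero:
  "fourier_conj (\<lambda>x :: (int ^ 'n::finite) ell2. 0) = (\<lambda>y. 0)"
  by (rule fourier_conj_eqI[OF D2_zero(1)]) (simp add: fourier_linear)

lemma fourier_conj_add:
  assumes A: "A \<in> D2" and B: "B \<in> D2"
  shows "fourier_conj (\<lambda>x. A x + B x) = (\<lambda>y. fourier_conj A y + fourier_conj B y)"
  by (rule fourier_conj_eqI[OF D2_add(1)[OF A B]])
    (simp add: fourier_linear fourier_fourier_conj[OF A] fourier_fourier_conj[OF B])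

lemma fourier_conj_scaleC:
  assumes A: "A \<in> D2"
  shows "fourier_conj (\<lambda>x. scaleC c (A x)) = (\<lambda>y. scaleC c (fourier_conj A y))"
  by (rule fourier_conj_eqI[OF D2_scaleC(1)[OF A]])
    (simp add: fourier_linear fourier_fourier_conj[OF A])

lemma fourier_conj_comp:
  assumes A: "A \<in> D2" and B: "B \<in> D2"
  shows "fourier_conj (A \<circ> B) = fourier_conj A \<circ> fourier_conj B"
  by (rule fourier_conj_eqI[OF D2_comp(1)[OF A B]])
    (simp add: fourier_fourier_conj[OF A] fourier_fourier_conj[OF B])

lemma fourier_conj_diff:
  assumes A: "A \<in> D2" and B: "B \<in> D2"
  shows "fourier_conj (\<lambda>x. A x - B x) = (\<lambda>y. fourier_conj A y - fourier_conj B y)"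
proof (rule fourier_conj_eqI[OF D2_diff[OF A B]])
  show "fourier (fourier_conj A x - fourier_conj B x) = A (fourier x) - B (fourier x)" for x
    by (rule ell2_eqI) (simp add: bounded_functionalD[OF bounded_functional_fourier_coeff]
        flip: fourier_fourier_conj[OF A] fourier_fourier_conj[OF B])
qed

lemma fourier_conj_matrix:
  assumes "A \<in> D2"
  shows "fourier_coeff (fourier_conj A (L2_exponential k)) j = ell2_matrix A j k"
  unfolding ell2_matrix_def
  by (simp flip: ell2_coeff_fourier add: fourier_fourier_conj[OF assms] fourier_exponential)

lemma inj_on_fourier_conj: "inj_on fourier_conj D2"
proof (rule inj_onI)
  fix A B :: "(int ^ 'a) ell2 \<Rightarrow> (int ^ 'a) ell2"
  assume AB: "A \<in> D2" "B \<in> D2" "fourier_conj A = fourier_conj B"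
  then show "A = B"
    by (intro ell2_matrix_inject D2_bounded) (simp_all flip: fourier_conj_matrix)
qed

lemma the_inv_fourier_conj [simp]: "A \<in> D2 \<Longrightarrow> the_inv_into D2 fourier_conj (fourier_conj A) = A"
  by (rule the_inv_into_f_f[OF inj_on_fourier_conj])

lemma operator_subalgebra_fourier_conj: "operator_subalgebra (fourier_conj ` D2)"
  unfolding operator_subalgebra_def
proof (intro conjI ballI allI)
  show "fourier_conj ` D2 \<subseteq> bounded_ops" using fourier_conj_bounded by blast
  show "(\<lambda>x. 0) \<in> fourier_conj ` D2"
    by (rule image_eqI[where f = fourier_conj, OF fourier_conj_zero[symmetric] D2_zero(1)])
next
  fix S T :: "'a L2_torus \<Rightarrow> 'a L2_torus" and c
  assume "S \<in> fourier_conj ` D2" "T \<in> fourier_conj ` D2"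
  then obtain A B where AB: "A \<in> D2" "B \<in> D2" and ST: "S = fourier_conj A" "T = fourier_conj B"
    by blast
  show "(\<lambda>x. S x + T x) \<in> fourier_conj ` D2"
    unfolding ST by (rule image_eqI[where f = fourier_conj, OF fourier_conj_add[OF AB, symmetric] D2_add(1)[OF AB]])
  show "S \<circ> T \<in> fourier_conj ` D2"
    unfolding ST by (rule image_eqI[where f = fourier_conj, OF fourier_conj_comp[OF AB, symmetric] D2_comp(1)[OF AB]])
next
  fix T :: "'a L2_torus \<Rightarrow> 'a L2_torus" and c
  assume "T \<in> fourier_conj ` D2"
  then obtain A where A: "A \<in> D2" and T: "T = fourier_conj A" by blast
  show "(\<lambda>x. scaleC c (T x)) \<in> fourier_conj ` D2"
    unfolding T by (rule image_eqI[where f = fourier_conj, OF fourier_conj_scaleC[OF A, symmetric] D2_scaleC(1)[OF A]])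
qed

lemma algebra_isomorphism_fourier_conj: "algebra_isomorphism D2 (fourier_conj ` D2) fourier_conj"
  unfolding algebra_isomorphism_def
  by (auto simp: operator_subalgebra_D2 operator_subalgebra_fourier_conj bij_betw_def
      inj_on_fourier_conj fourier_conj_add fourier_conj_scaleC fourier_conj_comp)

lemma Gamma_norm_fourier_conj [simp]: "A \<in> D2 \<Longrightarrow> Gamma_norm (fourier_conj A) = D2_norm A"
  by (simp add: Gamma_norm_def)

lemma embedded_subalgebra_fourier_conj:
  "embedded_subalgebra (fourier_conj ` D2 :: ('n::finite L2_torus \<Rightarrow> 'n L2_torus) set) Gamma_norm"
proof -
  have zero_iff: "D2_norm A = 0 \<longleftrightarrow> fourier_conj A = (\<lambda>x. 0)"
    if A: "A \<in> D2" for A :: "(int ^ 'n) ell2 \<Rightarrow> (int ^ 'n) ell2"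
  proof
    note hom0 = fourier_conj_zero[where 'n = 'n]
    show "fourier_conj A = (\<lambda>x. 0)" if "D2_norm A = 0"
      using D2_norm_eq_0[OF A that] hom0 by simp
    show "D2_norm A = 0" if "fourier_conj A = (\<lambda>x. 0)"
      using inj_onD[OF inj_on_fourier_conj, of A "\<lambda>x. 0"] that hom0 A D2_zero by (metis (no_types))
  qed
  have "norm_on_algebra (fourier_conj ` D2 :: ('n L2_torus \<Rightarrow> 'n L2_torus) set) Gamma_norm"
    unfolding norm_on_algebra_def
    by (auto simp: D2_norm_nonneg zero_iff D2_scaleC D2_add
        simp flip: fourier_conj_add fourier_conj_scaleC)
  moreover have "onorm (fourier_conj A) \<le> 1 * Gamma_norm (fourier_conj A)"
    if "A \<in> D2" for A :: "(int ^ 'n) ell2 \<Rightarrow> (int ^ 'n) ell2"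
    using that by (simp add: onorm_bound[OF D2_norm_nonneg norm_fourier_conj_le])
  ultimately show ?thesis
    unfolding embedded_subalgebra_def
    by (auto simp: operator_subalgebra_fourier_conj D2_comp simp flip: fourier_conj_comp
        intro!: exI[of _ "1 :: real"])
qed

lemma fourier_conj_truncation_finite_rank:
  fixes A :: "(int ^ 'n::finite) ell2 \<Rightarrow> (int ^ 'n) ell2"
  assumes "finite S"
  shows "fourier_conj (ell2_truncation S A) \<in> finite_rank_ops"
proof -
  note D2 = ell2_truncation_in_D2[OF assms, of A]
  have "fourier_conj (ell2_truncation S A) = (\<lambda>x. \<Sum>j\<in>S. \<Sum>k\<in>S.
      scaleC (ell2_matrix A j k * fourier_coeff x k) (L2_exponential j))"
  proof (rule fourier_conj_eqI[OF D2])
    show "fourier (\<Sum>j\<in>S. \<Sum>k\<in>S. scaleC (ell2_matrix A j k * fourier_coeff x k) (L2_exponential j)) =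
        ell2_truncation S A (fourier x)" for x
      by (rule ell2_eqI) (simp add: ell2_truncation_def fourier_coeff_exponential
          bounded_functionalD[OF bounded_functional_fourier_coeff])
  qed
  then have "range (fourier_conj (ell2_truncation S A)) \<subseteq> complex_vector.span (L2_exponential ` S)"
    unfolding image_subset_iff
    by (simp add: complex_vector.span_sum complex_vector.span_scale complex_vector.span_base)
  then show ?thesis
    using fourier_conj_bounded[OF D2] assms by (auto simp: finite_rank_ops_def)
qed

lemma approximable_fourier_conj:
  "approximable (fourier_conj ` D2 :: ('n::finite L2_torus \<Rightarrow> 'n L2_torus) set) Gamma_norm"
  unfolding approximable_def
proof (intro ballI allI impI)
  fix T :: "'n L2_torus \<Rightarrow> 'n L2_torus" and \<epsilon> :: real
  assume "T \<in> fourier_conj ` D2" "\<epsilon> > 0"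
  then obtain A where A: "A \<in> D2" "T = fourier_conj A" by auto
  obtain S where S: "finite S" "D2_norm (\<lambda>x. A x - ell2_truncation S A x) < \<epsilon>"
    using ell2_truncation_approximates[OF A(1) \<open>\<epsilon> > 0\<close>] .
  note F = ell2_truncation_in_D2[OF S(1), of A]
  have "Gamma_norm (\<lambda>x. T x - fourier_conj (ell2_truncation S A) x) < \<epsilon>"
    using S(2) A F by (simp add: D2_diff flip: fourier_conj_diff)
  then show "\<exists>F\<in>finite_rank_ops \<inter> fourier_conj ` D2. Gamma_norm (\<lambda>x. T x - F x) < \<epsilon>"
    using fourier_conj_truncation_finite_rank[OF S(1)] F by blast
qed

text \<open>Since \<open>fourier_conj\<close> is isometric, continuity carries over verbatim; agreement on finite-rank operators
is the only real condition.\<close>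

lemma Gamma_functional_extension:
  fixes f h :: "('n::finite L2_torus \<Rightarrow> 'n L2_torus) \<Rightarrow> complex"
  assumes ext: "continuous_extension D2 D2_norm f' g"
    and agree: "\<And>A. A \<in> D2 \<Longrightarrow> fourier_conj A \<in> finite_rank_ops \<Longrightarrow> g A = f (fourier_conj A)"
    and h: "\<And>A. A \<in> D2 \<Longrightarrow> h (fourier_conj A) = g A"
  shows "continuous_extension (fourier_conj ` D2) Gamma_norm f h"
  unfolding continuous_extension_def
proof (intro conjI ballI allI impI)
  fix F :: "'n L2_torus \<Rightarrow> 'n L2_torus"
  assume "F \<in> finite_rank_ops \<inter> fourier_conj ` D2"
  then show "h F = f F" using agree h by auto
next
  fix T :: "'n L2_torus \<Rightarrow> 'n L2_torus" and \<epsilon> :: real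
  assume "T \<in> fourier_conj ` D2" "\<epsilon> > 0"
  then obtain A where A: "A \<in> D2" "T = fourier_conj A" by auto
  obtain \<delta> where \<delta>: "\<delta> > 0" "\<And>B. B \<in> D2 \<Longrightarrow> D2_norm (\<lambda>x. B x - A x) < \<delta> \<Longrightarrow> cmod (g B - g A) < \<epsilon>"
    using ext A(1) \<open>\<epsilon> > 0\<close> unfolding continuous_extension_def by blast
  show "\<exists>\<delta>>0. \<forall>S\<in>fourier_conj ` D2. Gamma_norm (\<lambda>x. S x - T x) < \<delta> \<longrightarrow> cmod (h S - h T) < \<epsilon>"
    using \<delta> A h by (intro exI[of _ \<delta>]) (auto simp: D2_diff simp flip: fourier_conj_diff)
qed

text \<open>With respect to the exponentials the conjugated operator has the same sections as \<open>A\<close> with respect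
to the unit vectors. The limit of these sections is the extended functional of \<open>A\<close> on one side and the
functional of the finite-rank operator \<open>fourier_conj A\<close> on the other.\<close>

lemma finite_rank_functionals_fourier_conj:
  fixes A :: "(int ^ 'n::finite) ell2 \<Rightarrow> (int ^ 'n) ell2"
  assumes A: "A \<in> D2" and fin: "fourier_conj A \<in> finite_rank_ops"
  shows "D2_trace A = finite_rank_trace (fourier_conj A)"
    and "D2_det A = finite_rank_det (fourier_conj A)"
proof -
  obtain h :: "nat \<Rightarrow> int ^ 'n" where h: "bij h" using ex_bij_nat_int_vec by blast
  interpret coordinate_system "\<lambda>n. L2_exponential (h n)" "\<lambda>n x. fourier_coeff x (h n)"
    by (rule coordinate_system_reindex[OF h bounded_functional_fourier_coeff fourier_expansion])
  have "section_trace (fourier_conj A) = matrix_section_trace h A"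
    by (simp add: section_trace_def[abs_def] matrix_section_trace_def[abs_def] fourier_conj_matrix[OF A])
  then show "D2_trace A = finite_rank_trace (fourier_conj A)"
    using LIMSEQ_unique[OF D2_trace_limit(1)[OF h A]] finite_rank_trace_limit[OF fin] by simp
  have "section_det (fourier_conj A) = matrix_section_det h A"
    by (simp add: section_det_def[abs_def] matrix_section_det_def[abs_def] fourier_conj_matrix[OF A])
  then show "D2_det A = finite_rank_det (fourier_conj A)"
    using LIMSEQ_unique[OF D2_det_limit(1)[OF h A]] finite_rank_det_limit[OF fin] by simp
qed

theorem theorem3p5:
  fixes \<Gamma> :: "((int ^ 'n::finite) ell2 \<Rightarrow> (int ^ 'n) ell2) \<Rightarrow> ('n L2_torus \<Rightarrow> 'n L2_torus)"
  assumes "\<Gamma> = fourier_conj"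
  shows "algebra_isomorphism D2 (\<Gamma> ` D2) \<Gamma>
    \<and> (\<forall>A\<in>D2. Gamma_norm (\<Gamma> A) = D2_norm A)
    \<and> embedded_subalgebra (\<Gamma> ` D2) Gamma_norm
    \<and> approximable (\<Gamma> ` D2) Gamma_norm
    \<and> (\<forall>A\<in>D2. Gamma_trace (\<Gamma> A) = D2_trace A \<and> Gamma_det (\<Gamma> A) = D2_det A)
    \<and> continuous_extension (\<Gamma> ` D2) Gamma_norm finite_rank_trace Gamma_trace
    \<and> continuous_extension (\<Gamma> ` D2) Gamma_norm finite_rank_det Gamma_det"
proof -
  obtain h :: "nat \<Rightarrow> int ^ 'n" where h: "bij h" using ex_bij_nat_int_vec by blast
  have vals: "Gamma_trace (fourier_conj A) = D2_trace A" "Gamma_det (fourier_conj A) = D2_det A"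
    if "A \<in> D2" for A :: "(int ^ 'n) ell2 \<Rightarrow> (int ^ 'n) ell2"
    using that by (simp_all add: Gamma_trace_def Gamma_det_def)
  have "continuous_extension (fourier_conj ` (D2 :: ((int ^ 'n) ell2 \<Rightarrow> _) set)) Gamma_norm
      finite_rank_trace Gamma_trace"
    by (rule Gamma_functional_extension[OF D2_trace_limit(2)[OF h]
          finite_rank_functionals_fourier_conj(1) vals(1)])
  moreover have "continuous_extension (fourier_conj ` (D2 :: ((int ^ 'n) ell2 \<Rightarrow> _) set)) Gamma_norm
      finite_rank_det Gamma_det"
    by (rule Gamma_functional_extension[OF D2_det_limit(2)[OF h]
          finite_rank_functionals_fourier_conj(2) vals(2)])
  ultimately show ?thesis
    unfolding assms
    by (simp add: algebra_isomorphism_fourier_conj embedded_subalgebra_fourier_conj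
        approximable_fourier_conj vals)
qed

end
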